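(* Consider the panel $y_{i,t}=\alpha_i+\beta_i'f_t+u_{i,t}$, $1\le i\le N$, $1\le t\le T$, and suppose that for some $\nu\ge 4$: (A1) for all $1\le i\le N$, $\{u_{i,t},-\infty<t<\infty\}$ is an $\mathcal{L}_\nu$-decomposable Bernoulli shift with $a>(\nu-1)/(\nu-2)$, $\mathbb{E}u_{i,t}=0$ and $\min_{1\le i\le N}\mathbb{E}u_{i,t}^2>0$; (A2) $\{f_t,-\infty<t<\infty\}$ is a $K$-dimensional $\mathcal{L}_\nu$-decomposable Bernoulli shift with $a>(\nu-1)/(\nu-2)$ and positive definite covariance matrix; (A3) $\mathbb{E}(f_tu_{i,t})=0$ for all $1\le i\le N$; (A4) $N=O\big(T^{\frac12(\frac{\nu}{2}-1)-\varepsilon}\big)$ for some $\varepsilon>0$. Let $Z_{N,T}=\max_{1\le i\le N}(\psi_{i,NT}+\omega_i)$, and let $a_N,b_N$ and $\mathbb{P}^*$ be as in the context. If $\mathbb{H}_0:\alpha_i=0$ for all $1\le i\le N$ holds, then $$\lim_{\min\{N,T\}\to\infty}\mathbb{P}^*\left[a_N^{-1}(Z_{N,T}-b_N)\le x\right]=\exp(-\exp(-x))$$ for almost all realizations of $\{(u_{i,t},f_t')',1\le i\le N,1\le t\le T\}$ and all $-\infty<x<\infty$. If $\mathbb{H}_A:\alpha_i\ne0$ for at least one $1\le i\le N$ holds, then $$\lim_{\min\{N,T\}\to\infty}\mathbb{P}^*\left[a_N^{-1}(Z_{N,T}-b_N)\le x\right]=0$$ for almost all realizations of $\{(u_{i,t},f_t')',1\le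 i\le N,1\le t\le T\}$ and all $-\infty<x<\infty$.
   Context: Model: $y_{i,t}\in\mathbb{R}$ and $f_t\in\mathbb{R}^K$ are observed, $\alpha_i\in\mathbb{R}$ and $\beta_i\in\mathbb{R}^K$ are unknown coefficients, $u_{i,t}$ are errors. Norm: $|X|_r=(\mathbb{E}\|X\|^r)^{1/r}$. Definition ($\mathcal{L}_\nu$-decomposable Bernoulli shift): $\{m_t,-\infty<t<\infty\}$ is an $\mathcal{L}_\nu$-decomposable Bernoulli shift if and only if $m_t=g(\eta_t,\eta_{t-1},\dots)$ where (i) $g:S^\infty\to\mathbb{R}^k$ is a nonrandom measurable function; (ii) $\{\eta_t\}$ is an i.i.d. sequence with values in a measurable space $S$; (iii) $|m_t|_\nu<\infty$; (iv) $|m_t-m^*_{t,\ell}|_\nu\le c_0\ell^{-a}$ for some $c_0>0$, $a>0$, where $m^*_{t,\ell}=g(\eta_t,\dots,\eta_{t-\ell+1},\eta^*_{t-\ell,t,\ell},\eta^*_{t-\ell-1,t,\ell},\dots)$ and $\{\eta^*_{s,t,\ell},-\infty<s,\ell,t<\infty\}$ are i.i.d. copies of $\eta_0$ independent of $\{\eta_t\}$. The exponent "$a$" in the assumptions is the one in (iv). OLS estimation: with $\overline y_i=T^{-1}\sum_{t=1}^Ty_{i,t}$, $\overline f=T^{-1}\sum_{t=1}^Tf_t$, let $\widehat\beta_{i,T}=\big[\sum_{t=1}^T(f_t-\overline f)(f_t-\overline f)'\big]^{-1}\big[\sum_{t=1}^T(f_t-\overline f)y_{i,t}\big]$ and $\widehat\alpha_{i,T}=\overline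 y_i-\widehat\beta_{i,T}'\overline f$; residuals $\widehat u_{i,t}=y_{i,t}-\widehat\alpha_{i,T}-\widehat\beta_{i,T}'f_t$. Statistic: $\widehat s_{NT}=\sqrt{(NT)^{-1}\sum_{i=1}^N\sum_{t=1}^T\widehat u_{i,t}^2}$ and $\psi_{i,NT}=\left|T^{1/\nu}\widehat\alpha_{i,T}/\widehat s_{NT}\right|^{\nu/2}$. The $\omega_i$ are i.i.d. $\mathcal{N}(0,1)$, generated independently of the sample $\{(u_{i,t},f_t')',1\le i\le N,1\le t\le T\}$. Norming: $b_N=\sqrt{2\log N}-\dfrac{\log\log N+\log(4\pi)}{2\sqrt{2\log N}}$, $a_N=\dfrac{b_N}{1+b_N^2}$. $\mathbb{P}^*$ denotes probability conditional on the sample $\{(u_{i,t},f_t')',1\le i\le N,1\le t\le T\}$.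
   Formalization: All u_i and f are taken as Bernoulli shifts of one common innovation sequence, and (A1) is taken uniformly in i: common c_0 and a, bounded ν-norms over i, and inf over i of E u_{i,t}^2 positive; the claim fails without such conditions. *)

theory Defs
  imports "HOL-Probability.Probability" "HOL-Library.Landau_Symbols"
begin

text \<open>
  Individuals are indexed by naturals \<open>i \<ge> 1\<close>, time by integers. A process is a function from
  time to random variables on the probability space \<open>M\<close>.
\<close>

subsection \<open>Decomposable Bernoulli shifts\<close>

text \<open>
  The Bochner integral of a non-integrable function is 0, so \<open>L_norm\<close> has its usual meaning only
  when \<open>\<bar>X\<bar>\<^sup>r\<close> is integrable.
\<close>

definition L_norm :: "'a measure \<Rightarrow> real \<Rightarrow> ('a \<Rightarrow> 'b::euclidean_space) \<Rightarrow> real" where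
  "L_norm M r X = (\<integral>\<omega>. norm (X \<omega>) powr r \<partial>M) powr (1 / r)"

definition iid_family :: "'a measure \<Rightarrow> 's measure \<Rightarrow> ('i \<Rightarrow> 'a \<Rightarrow> 's) \<Rightarrow> bool" where
  "iid_family M S X \<longleftrightarrow> prob_space.indep_vars M (\<lambda>_. S) X UNIV \<and>
     (\<forall>i j. distr M S (X i) = distr M S (X j))"

definition generated_algebra ::
  "'a measure \<Rightarrow> 's measure \<Rightarrow> ('i \<Rightarrow> 'a \<Rightarrow> 's) \<Rightarrow> 'i set \<Rightarrow> 'a measure" where
  "generated_algebra M S X I = sigma (space M) {X i -` A \<inter> space M | i A. i \<in> I \<and> A \<in> sets S}"

definition independent_copies ::
  "'a measure \<Rightarrow> 's measure \<Rightarrow> (int \<Rightarrow> 'a \<Rightarrow> 's) \<Rightarrow> (int \<times> int \<times> int \<Rightarrow> 'a \<Rightarrow> 's) \<Rightarrow> bool" where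
  "independent_copies M S \<eta> \<eta>s \<longleftrightarrow> iid_family M S \<eta>s \<and>
     (\<forall>j. distr M S (\<eta>s j) = distr M S (\<eta> 0)) \<and>
     prob_space.indep_set M
       (sets (generated_algebra M S \<eta> UNIV)) (sets (generated_algebra M S \<eta>s UNIV))"

text \<open>
  \<open>coupled g \<eta> \<eta>s t l\<close> is \<open>g (\<eta>\<^sub>t, \<dots>, \<eta>\<^bsub>t-l+1\<^esub>, \<eta>s (t-l,t,l), \<eta>s (t-l-1,t,l), \<dots>)\<close>: position \<open>j\<close> of
  the argument sequence of \<open>g\<close> is time \<open>t - j\<close>.
\<close>

definition coupled ::
  "((nat \<Rightarrow> 's) \<Rightarrow> 'b) \<Rightarrow> (int \<Rightarrow> 'a \<Rightarrow> 's) \<Rightarrow> (int \<times> int \<times> int \<Rightarrow> 'a \<Rightarrow> 's) \<Rightarrow> int \<Rightarrow> int \<Rightarrow> 'a \<Rightarrow> 'b" where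
  "coupled g \<eta> \<eta>s t l \<omega> =
     g (\<lambda>j. if int j < l then \<eta> (t - int j) \<omega> else \<eta>s (t - int j, t, l) \<omega>)"

text \<open>
  \<open>m\<close> is an \<open>\<L>\<^sub>\<nu>\<close>-decomposable Bernoulli shift in the innovations \<open>\<eta>\<close>, with constants \<open>c\<^sub>0\<close> and \<open>a\<close> in
  the coupling bound. The innovations and the constants are arguments so that several processes
  can be required to share them. Under the other conjuncts, the coupled process has the law of
  \<open>m t\<close>, so the norms in the last conjunct are those of integrable functions.
\<close>

definition decomposable_bernoulli_shift ::
  "'a measure \<Rightarrow> 's measure \<Rightarrow> (int \<Rightarrow> 'a \<Rightarrow> 's) \<Rightarrow> real \<Rightarrow> real \<Rightarrow> real \<Rightarrow>
   (int \<Rightarrow> 'a \<Rightarrow> 'b::euclidean_space) \<Rightarrow> bool" where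
  "decomposable_bernoulli_shift M S \<eta> \<nu> c\<^sub>0 a m \<longleftrightarrow>
     c\<^sub>0 > 0 \<and> a > 0 \<and> iid_family M S \<eta> \<and>
     (\<exists>g \<eta>s. g \<in> (\<Pi>\<^sub>M j\<in>(UNIV :: nat set). S) \<rightarrow>\<^sub>M borel \<and>
        independent_copies M S \<eta> \<eta>s \<and>
        (\<forall>t. \<forall>\<omega>\<in>space M. m t \<omega> = g (\<lambda>j. \<eta> (t - int j) \<omega>)) \<and>
        (\<forall>t. integrable M (\<lambda>\<omega>. norm (m t \<omega>) powr \<nu>)) \<and>
        (\<forall>t. \<forall>l\<ge>1. L_norm M \<nu> (\<lambda>\<omega>. m t \<omega> - coupled g \<eta> \<eta>s t l \<omega>)
                     \<le> c\<^sub>0 * real_of_int l powr (- a)))"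

definition covariance_matrix :: "'a measure \<Rightarrow> ('a \<Rightarrow> real^'k) \<Rightarrow> real^'k^'k" where
  "covariance_matrix M X =
     (\<chi> i j. \<integral>\<omega>. (X \<omega> $ i - (\<integral>\<omega>'. X \<omega>' $ i \<partial>M)) * (X \<omega> $ j - (\<integral>\<omega>'. X \<omega>' $ j \<partial>M)) \<partial>M)"

definition positive_definite :: "real^'k^'k \<Rightarrow> bool" where
  "positive_definite A \<longleftrightarrow> transpose A = A \<and> (\<forall>v. v \<noteq> 0 \<longrightarrow> v \<bullet> (A *v v) > 0)"

subsection \<open>OLS estimation and the test statistic, for a given path of the data\<close>

definition time_mean :: "nat \<Rightarrow> (int \<Rightarrow> 'b::real_vector) \<Rightarrow> 'b" where
  "time_mean T x = (1 / real T) *\<^sub>R (\<Sum>t = 1..int T. x t)"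

definition outer_square :: "real^'k \<Rightarrow> real^'k^'k" where
  "outer_square v = (\<chi> i j. v $ i * v $ j)"

definition ols_slope :: "nat \<Rightarrow> (int \<Rightarrow> real) \<Rightarrow> (int \<Rightarrow> real^'k) \<Rightarrow> real^'k" where
  "ols_slope T y f =
     matrix_inv (\<Sum>t = 1..int T. outer_square (f t - time_mean T f))
       *v (\<Sum>t = 1..int T. y t *\<^sub>R (f t - time_mean T f))"

definition ols_alpha :: "nat \<Rightarrow> (int \<Rightarrow> real) \<Rightarrow> (int \<Rightarrow> real^'k) \<Rightarrow> real" where
  "ols_alpha T y f = time_mean T y - ols_slope T y f \<bullet> time_mean T f"

definition ols_resid :: "nat \<Rightarrow> (int \<Rightarrow> real) \<Rightarrow> (int \<Rightarrow> real^'k) \<Rightarrow> int \<Rightarrow> real" where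
  "ols_resid T y f t = y t - ols_alpha T y f - ols_slope T y f \<bullet> f t"

definition s_hat :: "nat \<Rightarrow> nat \<Rightarrow> (nat \<Rightarrow> int \<Rightarrow> real) \<Rightarrow> (int \<Rightarrow> real^'k) \<Rightarrow> real" where
  "s_hat N T y f =
     sqrt (1 / (real N * real T) * (\<Sum>i = 1..N. \<Sum>t = 1..int T. (ols_resid T (y i) f t)\<^sup>2))"

definition psi ::
  "real \<Rightarrow> nat \<Rightarrow> nat \<Rightarrow> (nat \<Rightarrow> int \<Rightarrow> real) \<Rightarrow> (int \<Rightarrow> real^'k) \<Rightarrow> nat \<Rightarrow> real" where
  "psi \<nu> N T y f i =
     \<bar>real T powr (1 / \<nu>) * ols_alpha T (y i) f / s_hat N T y f\<bar> powr (\<nu> / 2)"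

definition Z_stat ::
  "real \<Rightarrow> nat \<Rightarrow> nat \<Rightarrow> (nat \<Rightarrow> int \<Rightarrow> real) \<Rightarrow> (int \<Rightarrow> real^'k) \<Rightarrow> (nat \<Rightarrow> real) \<Rightarrow> real" where
  "Z_stat \<nu> N T y f w = Max ((\<lambda>i. psi \<nu> N T y f i + w i) ` {1..N})"

definition b_norm :: "nat \<Rightarrow> real" where
  "b_norm N = sqrt (2 * ln (real N)) -
     (ln (ln (real N)) + ln (4 * pi)) / (2 * sqrt (2 * ln (real N)))"

definition a_norm :: "nat \<Rightarrow> real" where
  "a_norm N = b_norm N / (1 + (b_norm N)\<^sup>2)"

subsection \<open>Conditioning on the sample\<close>

definition sample_algebra ::
  "'a measure \<Rightarrow> (nat \<Rightarrow> int \<Rightarrow> 'a \<Rightarrow> real) \<Rightarrow> (int \<Rightarrow> 'a \<Rightarrow> real^'k) \<Rightarrow> nat \<Rightarrow> nat \<Rightarrow> 'a measure" where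
  "sample_algebra M u f N T = sigma (space M)
     ({u i t -` A \<inter> space M | i t A. i \<in> {1..N} \<and> t \<in> {1..int T} \<and> A \<in> sets borel} \<union>
      {f t -` A \<inter> space M | t A. t \<in> {1..int T} \<and> A \<in> sets borel})"

text \<open>
  \<open>\<kappa>\<close> is a regular conditional distribution of the real random variable \<open>X\<close> given the
  sub-\<open>\<sigma>\<close>-algebra \<open>G\<close>. Conditional probabilities of single events are only determined up to null
  sets; a regular version is what gives a meaning to statements on \<open>P(X \<le> x | G)\<close> for all \<open>x\<close>
  simultaneously on an almost sure event.
\<close>

definition regular_cond_distr ::
  "'a measure \<Rightarrow> 'a measure \<Rightarrow> ('a \<Rightarrow> real) \<Rightarrow> ('a \<Rightarrow> real measure) \<Rightarrow> bool" where
  "regular_cond_distr M G X \<kappa> \<longleftrightarrow> \<kappa> \<in> G \<rightarrow>\<^sub>M prob_algebra borel \<and>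
     (\<forall>A\<in>sets borel. AE \<omega> in M.
        measure (\<kappa> \<omega>) A = real_cond_exp M G (indicator (X -` A \<inter> space M)) \<omega>)"

end

theory Submission
  imports Defs "HOL-Real_Asymp.Real_Asymp"
begin

text \<open>
  A Bernoulli shift is approximated in \<open>L\<^sup>\<nu>\<close> by functions of finitely many innovations, obtained by
  freezing the independent copies of the coupled process. Products of two such processes are
  approximable in \<open>L\<^bsup>\<nu>/2\<^esup>\<close>; telescoping over windows of dyadic length and the
  Marcinkiewicz--Zygmund inequality bound the moments of order \<open>\<nu>/2\<close> of their partial sums by those
  of independent sums. With (A4), chaining and the Borel--Cantelli lemma this gives, almost surely
  and uniformly in \<open>i \<le> N\<close>, sample means of \<open>u\<^sub>i\<close>, \<open>u\<^sub>i f\<close>, \<open>u\<^sub>i\<^sup>2\<close>, \<open>f\<close> and \<open>f f'\<close> within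
  \<open>T\<^bsup>-1/\<nu>-\<delta>\<^esup>\<close> of their expectations. Hence the estimated intercepts are within a constant times
  \<open>T\<^bsup>-1/\<nu>-\<delta>\<^esup>\<close> of \<open>\<alpha>\<^sub>i\<close>: under the null hypothesis the perturbations \<open>\<psi>\<^sub>i\<close> are uniformly of smaller
  order than \<open>a\<^sub>N\<close>, and otherwise one of them is of order \<open>\<surd>T\<close>. Conditionally on the sample the
  law of the statistic is \<open>\<Prod>\<^sub>i \<Phi>(a\<^sub>N x + b\<^sub>N - \<psi>\<^sub>i)\<close>, and \<open>\<Phi>(a\<^sub>N x + b\<^sub>N)\<^sup>N\<close> converges to the Gumbel
  distribution function by Mills' ratio.
\<close>

subsection \<open>Moment bounds\<close>

text \<open>The order \<nu>/2 is that of the products \<open>u f\<close> and \<open>u^2\<close>, for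
  which no higher moments are given; \<nu> \<ge> 4 makes it at least 2. The exponent in (A4) is the
  budget of a union bound: moments of order p = \<nu>/2 of a sum over T times are of order T^(p/2),
  so by Markov's inequality the sum exceeds T^(1-\<rho>) with probability of order T^(p/2 -
  p(1-\<rho>)). For T^\<gamma> series and \<rho> = 1/\<nu> + \<delta> this is summable along T = 2^k
  if \<gamma> < (\<nu>/2 - 1)/2 - \<delta>\<nu>/2. Uniformity in i rests on constants shared by all
  errors, and products on shared innovations, as both factors must be functions of the same window.
  Conditional laws are fixed up to null sets depending on N, T and x, so the limit is found at
  rational x on one event and extended by monotonicity. \<open>Lp_le\<close> uses a bound K > 0 in
  place of a norm: integrability becomes explicit (the Bochner integral defaults to 0) and one may
  divide by K, which turns Minkowski, Cauchy-Schwarz and Lyapunov into pointwise inequalities for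
  X/K.\<close>

definition Lp_le :: "'a measure \<Rightarrow> real \<Rightarrow> ('a \<Rightarrow> real) \<Rightarrow> real \<Rightarrow> bool" where
  "Lp_le M p X K \<longleftrightarrow> K > 0 \<and> X \<in> borel_measurable M \<and> integrable M (\<lambda>\<omega>. \<bar>X \<omega>\<bar> powr p) \<and>
     (\<integral>\<omega>. \<bar>X \<omega>\<bar> powr p \<partial>M) \<le> K powr p"

lemma Lp_leD:
  assumes "Lp_le M p X K"
  shows "K > 0" "X \<in> borel_measurable M" "integrable M (\<lambda>\<omega>. \<bar>X \<omega>\<bar> powr p)"
    "(\<integral>\<omega>. \<bar>X \<omega>\<bar> powr p \<partial>M) \<le> K powr p"
  using assms by (auto simp: Lp_le_def)

lemma Lp_leI:
  assumes "K > 0" "X \<in> borel_measurable M" "integrable M g"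
    "\<And>\<omega>. \<omega> \<in> space M \<Longrightarrow> \<bar>X \<omega>\<bar> powr p \<le> g \<omega>" "(\<integral>\<omega>. g \<omega> \<partial>M) \<le> K powr p"
  shows "Lp_le M p X K"
proof -
  note [measurable] = assms(2)
  have i: "integrable M (\<lambda>\<omega>. \<bar>X \<omega>\<bar> powr p)"
    by (rule Bochner_Integration.integrable_bound[OF assms(3)])
      (use assms(4) in \<open>auto intro!: AE_I2 order.trans[OF _ abs_ge_self]\<close>)
  have "(\<integral>\<omega>. \<bar>X \<omega>\<bar> powr p \<partial>M) \<le> (\<integral>\<omega>. g \<omega> \<partial>M)"
    by (rule integral_mono[OF i assms(3,4)])
  then show ?thesis using i assms by (auto simp: Lp_le_def)
qed

lemma Lp_le_mono: "Lp_le M p X K \<Longrightarrow> K \<le> K' \<Longrightarrow> p \<ge> 0 \<Longrightarrow> Lp_le M p X K'"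
  by (auto simp: Lp_le_def intro: order.trans[OF _ powr_mono2])

lemma Lp_le_uminus: "Lp_le M p X K \<Longrightarrow> Lp_le M p (\<lambda>\<omega>. - X \<omega>) K"
  by (auto simp: Lp_le_def)

text \<open>Zero arguments form a case of their own: if one summand vanishes, the claim reduces to
  \<open>w powr p \<le> w\<close> for a weight w in (0,1).\<close>

lemma powr_convex_nonneg:
  fixes p x y u v :: real
  assumes "p \<ge> 1" "x \<ge> 0" "y \<ge> 0" "u > 0" "v > 0" "u + v = 1"
  shows "(u * x + v * y) powr p \<le> u * x powr p + v * y powr p"
proof (cases "x = 0 \<or> y = 0")
  case True
  have "w powr p \<le> w" if "0 < w" "w < 1" for w :: real
    using that assms(1) by (metis less_imp_le powr_mono' powr_one)
  then show ?thesis
    using True assms by (auto simp: powr_mult intro!: mult_right_mono)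
next
  case False
  have u: "u = 1 - v" using assms by simp
  show ?thesis
    using convex_onD[OF powr_convex[OF assms(1)], of v x y] False assms unfolding u by simp
qed

text \<open>Convexity with the weights \<open>K / (K + L)\<close> and \<open>L / (K + L)\<close>.\<close>
lemma Lp_le_add:
  assumes p: "p \<ge> 1" and X: "Lp_le M p X K" and Y: "Lp_le M p Y L"
  shows "Lp_le M p (\<lambda>\<omega>. X \<omega> + Y \<omega>) (K + L)"
proof -
  have [simp]: "K > 0" "L > 0" "K \<ge> 0" "L \<ge> 0" "K \<noteq> 0" "L \<noteq> 0"
    using Lp_leD(1)[OF X] Lp_leD(1)[OF Y] by auto
  define u v where "u = K / (K + L)" and "v = L / (K + L)"
  have KL: "K + L > 0" by (simp add: add_pos_pos)
  have uv: "u > 0" "v > 0" "u + v = 1" using KL by (auto simp: u_def v_def add_divide_distrib[symmetric])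
  define g where "g = (\<lambda>\<omega>. (K + L) powr p * (u * (\<bar>X \<omega>\<bar> powr p / K powr p) + v * (\<bar>Y \<omega>\<bar> powr p / L powr p)))"
  show ?thesis
  proof (rule Lp_leI[where g = g])
    show "K + L > 0" by fact
    show "(\<lambda>\<omega>. X \<omega> + Y \<omega>) \<in> borel_measurable M" using X Y by (auto simp: Lp_le_def)
    show gi: "integrable M g" unfolding g_def using X Y by (auto simp: Lp_le_def)
    fix \<omega> assume "\<omega> \<in> space M"
    have "\<bar>X \<omega> + Y \<omega>\<bar> \<le> \<bar>X \<omega>\<bar> + \<bar>Y \<omega>\<bar>" by simp
    also have "\<dots> = (K + L) * (u * (\<bar>X \<omega>\<bar> / K) + v * (\<bar>Y \<omega>\<bar> / L))"
      using KL by (simp add: u_def v_def distrib_left)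
    finally have "\<bar>X \<omega> + Y \<omega>\<bar> powr p \<le> ((K + L) * (u * (\<bar>X \<omega>\<bar> / K) + v * (\<bar>Y \<omega>\<bar> / L))) powr p"
      using p by (intro powr_mono2) auto
    also have "\<dots> = (K + L) powr p * (u * (\<bar>X \<omega>\<bar> / K) + v * (\<bar>Y \<omega>\<bar> / L)) powr p"
      using uv KL by (intro powr_mult) 
    also have "\<dots> \<le> (K + L) powr p * (u * (\<bar>X \<omega>\<bar> / K) powr p + v * (\<bar>Y \<omega>\<bar> / L) powr p)"
      using uv p by (intro mult_left_mono powr_convex_nonneg) auto
    also have "\<dots> = g \<omega>" by (simp add: g_def powr_divide)
    finally show "\<bar>X \<omega> + Y \<omega>\<bar> powr p \<le> g \<omega>" .
  next
    have "(\<integral>\<omega>. g \<omega> \<partial>M) = (K + L) powr p *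
        (u * ((\<integral>\<omega>. \<bar>X \<omega>\<bar> powr p \<partial>M) / K powr p) + v * ((\<integral>\<omega>. \<bar>Y \<omega>\<bar> powr p \<partial>M) / L powr p))"
      using X Y unfolding g_def by (simp add: Lp_le_def)
    also have "\<dots> \<le> (K + L) powr p * (u * 1 + v * 1)"
      using Lp_leD(4)[OF X] Lp_leD(4)[OF Y] uv by (intro mult_left_mono add_mono) auto
    finally show "(\<integral>\<omega>. g \<omega> \<partial>M) \<le> (K + L) powr p" using uv by simp
  qed
qed

lemma Lp_le_diff:
  assumes "p \<ge> 1" "Lp_le M p X K" "Lp_le M p Y L"
  shows "Lp_le M p (\<lambda>\<omega>. X \<omega> - Y \<omega>) (K + L)"
  using Lp_le_add[OF assms(1,2) Lp_le_uminus[OF assms(3)]] by simp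

lemma Lp_le_sum:
  assumes p: "p \<ge> 1" and "finite I" "I \<noteq> {}" and "\<And>i. i \<in> I \<Longrightarrow> Lp_le M p (X i) (K i)"
  shows "Lp_le M p (\<lambda>\<omega>. \<Sum>i\<in>I. X i \<omega>) (\<Sum>i\<in>I. K i)"
  using assms(2,3,4)
proof (induction I rule: finite_ne_induct)
  case (insert i I)
  then show ?case using Lp_le_add[OF p, of M "X i" "K i"] by simp
qed simp

text \<open>Convexity of \<open>exp\<close> between 0 and \<open>ln t\<close>. With t = (|X|/K)^p
  and r = q/p it compares the moments of orders q and p pointwise.\<close>

lemma weighted_am_gm:
  fixes t r :: real
  assumes "t \<ge> 0" "0 < r" "r \<le> 1"
  shows "t powr r \<le> 1 - r + r * t"
proof (cases "t = 0 \<or> r = 1")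
  case False
  then have "t > 0" "r < 1" using assms by auto
  have "exp ((1 - r) * 0 + r * ln t) \<le> (1 - r) * exp 0 + r * exp (ln t)"
    using convex_onD[OF exp_convex, of r 0 "ln t"] assms by simp
  then show ?thesis using \<open>t > 0\<close> by (simp add: powr_def)
qed (use assms in auto)

lemma (in prob_space) Lp_le_lyapunov:
  assumes X: "Lp_le M p X K" and q: "0 < q" "q \<le> p"
  shows "Lp_le M q X K"
proof (rule Lp_leI[where g = "\<lambda>\<omega>. K powr q * (1 - q / p + q / p * (\<bar>X \<omega>\<bar> powr p / K powr p))"])
  have [simp]: "K > 0" "K \<ge> 0" "K \<noteq> 0"
    using Lp_leD(1)[OF X] by auto
  show "K > 0" "X \<in> borel_measurable M" using X by (auto simp: Lp_le_def)
  show "integrable M (\<lambda>\<omega>. K powr q * (1 - q / p + q / p * (\<bar>X \<omega>\<bar> powr p / K powr p)))"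
    using X by (auto simp: Lp_le_def)
  fix \<omega>
  have "\<bar>X \<omega>\<bar> powr q = K powr q * ((\<bar>X \<omega>\<bar> / K) powr p) powr (q / p)"
    using q by (simp add: powr_powr powr_divide)
  also have "\<dots> \<le> K powr q * (1 - q / p + q / p * (\<bar>X \<omega>\<bar> / K) powr p)"
    using q by (intro mult_left_mono weighted_am_gm) auto
  finally show "\<bar>X \<omega>\<bar> powr q \<le> K powr q * (1 - q / p + q / p * (\<bar>X \<omega>\<bar> powr p / K powr p))"
    by (simp add: powr_divide)
next
  have [simp]: "K > 0" "K \<ge> 0" "K \<noteq> 0"
    using Lp_leD(1)[OF X] by auto
  have "(\<integral>\<omega>. K powr q * (1 - q / p + q / p * (\<bar>X \<omega>\<bar> powr p / K powr p)) \<partial>M)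
      = K powr q * (1 - q / p + q / p * ((\<integral>\<omega>. \<bar>X \<omega>\<bar> powr p \<partial>M) / K powr p))"
    using Lp_leD(3)[OF X] by (simp add: prob_space)
  also have "\<dots> \<le> K powr q * (1 - q / p + q / p * 1)"
    using Lp_leD(4)[OF X] q by (intro mult_left_mono add_left_mono) auto
  finally show "(\<integral>\<omega>. K powr q * (1 - q / p + q / p * (\<bar>X \<omega>\<bar> powr p / K powr p)) \<partial>M) \<le> K powr q"
    by simp
qed

lemma (in prob_space) Lp_le_integral:
  assumes X: "Lp_le M p X K" and p: "p \<ge> 1"
  shows "integrable M X" "\<bar>\<integral>\<omega>. X \<omega> \<partial>M\<bar> \<le> K"
proof -
  have 1: "Lp_le M 1 X K" using Lp_le_lyapunov[OF X] p by simp
  have "integrable M (\<lambda>\<omega>. \<bar>X \<omega>\<bar>)" using Lp_leD(3)[OF 1] by simp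
  then show "integrable M X" using Lp_leD(2)[OF 1] integrable_abs_cancel by blast
  have "\<bar>\<integral>\<omega>. X \<omega> \<partial>M\<bar> \<le> (\<integral>\<omega>. \<bar>X \<omega>\<bar> \<partial>M)"
    using integral_norm_bound[of M X] by simp
  also have "\<dots> \<le> K" using Lp_leD(1,4)[OF 1] by simp
  finally show "\<bar>\<integral>\<omega>. X \<omega> \<partial>M\<bar> \<le> K" .
qed

lemma (in prob_space) Lp_le_const: "\<bar>c\<bar> \<le> K \<Longrightarrow> K > 0 \<Longrightarrow> p \<ge> 0 \<Longrightarrow> Lp_le M p (\<lambda>_. c) K"
  by (auto simp: Lp_le_def prob_space intro: powr_mono2)

lemma (in prob_space) Lp_le_center:
  assumes X: "Lp_le M p X K" and p: "p \<ge> 1"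
  shows "Lp_le M p (\<lambda>\<omega>. X \<omega> - (\<integral>\<omega>. X \<omega> \<partial>M)) (2 * K)"
  using Lp_le_diff[OF p X Lp_le_const[OF Lp_le_integral(2)[OF X p] Lp_leD(1)[OF X], of p]] p by simp

text \<open>Cauchy-Schwarz as ab \<le> (a^2 + b^2)/2 for the p-th powers of |X|/K and |Y|/L, so that
  integrability of the product comes with the bound.\<close>

lemma Lp_le_mult:
  assumes X: "Lp_le M (2 * p) X K" and Y: "Lp_le M (2 * p) Y L"
  shows "Lp_le M p (\<lambda>\<omega>. X \<omega> * Y \<omega>) (K * L)"
proof (rule Lp_leI[where g = "\<lambda>\<omega>. (K * L) powr p *
      ((\<bar>X \<omega>\<bar> powr (2 * p) / K powr (2 * p) + \<bar>Y \<omega>\<bar> powr (2 * p) / L powr (2 * p)) / 2)"])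
  have [simp]: "K > 0" "L > 0" "K \<ge> 0" "L \<ge> 0" "K \<noteq> 0" "L \<noteq> 0"
    using Lp_leD(1)[OF X] Lp_leD(1)[OF Y] by auto
  show "K * L > 0" by simp
  show "(\<lambda>\<omega>. X \<omega> * Y \<omega>) \<in> borel_measurable M" using X Y by (auto simp: Lp_le_def)
  show "integrable M (\<lambda>\<omega>. (K * L) powr p *
      ((\<bar>X \<omega>\<bar> powr (2 * p) / K powr (2 * p) + \<bar>Y \<omega>\<bar> powr (2 * p) / L powr (2 * p)) / 2))"
    using X Y by (auto simp: Lp_le_def)
  fix \<omega>
  have sq: "z powr (2 * p) = (z powr p)\<^sup>2" if "z \<ge> 0" for z :: real
    using that by (simp add: power2_eq_square powr_add[symmetric])
  have "\<bar>X \<omega> * Y \<omega>\<bar> powr p = (K * L) powr p * ((\<bar>X \<omega>\<bar> powr p / K powr p) * (\<bar>Y \<omega>\<bar> powr p / L powr p))"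
    by (simp add: abs_mult powr_mult)
  also have "\<dots> \<le> (K * L) powr p * (((\<bar>X \<omega>\<bar> powr p / K powr p)\<^sup>2 + (\<bar>Y \<omega>\<bar> powr p / L powr p)\<^sup>2) / 2)"
    using sum_squares_bound[of "\<bar>X \<omega>\<bar> powr p / K powr p" "\<bar>Y \<omega>\<bar> powr p / L powr p"]
    by (intro mult_left_mono) (auto simp: mult_ac)
  finally show "\<bar>X \<omega> * Y \<omega>\<bar> powr p \<le> (K * L) powr p *
      ((\<bar>X \<omega>\<bar> powr (2 * p) / K powr (2 * p) + \<bar>Y \<omega>\<bar> powr (2 * p) / L powr (2 * p)) / 2)"
    by (simp add: sq power_divide)
next
  have [simp]: "K > 0" "L > 0" "K \<ge> 0" "L \<ge> 0" "K \<noteq> 0" "L \<noteq> 0"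
    using Lp_leD(1)[OF X] Lp_leD(1)[OF Y] by auto
  have "(\<integral>\<omega>. (K * L) powr p *
      ((\<bar>X \<omega>\<bar> powr (2 * p) / K powr (2 * p) + \<bar>Y \<omega>\<bar> powr (2 * p) / L powr (2 * p)) / 2) \<partial>M)
    = (K * L) powr p * (((\<integral>\<omega>. \<bar>X \<omega>\<bar> powr (2 * p) \<partial>M) / K powr (2 * p) +
        (\<integral>\<omega>. \<bar>Y \<omega>\<bar> powr (2 * p) \<partial>M) / L powr (2 * p)) / 2)"
    using Lp_leD(3)[OF X] Lp_leD(3)[OF Y] by simp
  also have "\<dots> \<le> (K * L) powr p * ((1 + 1) / 2)"
    using Lp_leD(4)[OF X] Lp_leD(4)[OF Y]
    by (intro mult_left_mono divide_right_mono add_mono) auto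
  finally show "(\<integral>\<omega>. (K * L) powr p *
      ((\<bar>X \<omega>\<bar> powr (2 * p) / K powr (2 * p) + \<bar>Y \<omega>\<bar> powr (2 * p) / L powr (2 * p)) / 2) \<partial>M)
      \<le> (K * L) powr p" by simp
qed

lemma (in prob_space) Lp_le_Markov:
  assumes X: "Lp_le M p X K" and p: "p > 0" and c: "c > 0"
  shows "prob {\<omega> \<in> space M. \<bar>X \<omega>\<bar> > c} \<le> (K / c) powr p"
proof -
  note [measurable] = Lp_leD(2)[OF X]
  have "prob {\<omega> \<in> space M. \<bar>X \<omega>\<bar> > c} \<le> prob {\<omega> \<in> space M. \<bar>X \<omega>\<bar> powr p \<ge> c powr p}"
    using p c by (intro finite_measure_mono) (auto intro: powr_mono2)
  also have "\<dots> \<le> (\<integral>\<omega>. \<bar>X \<omega>\<bar> powr p \<partial>M) / c powr p"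
    using Lp_leD(3)[OF X] c by (intro integral_Markov_inequality_measure[where A = "space M"]) auto
  also have "\<dots> \<le> K powr p / c powr p"
    using Lp_leD(4)[OF X] c by (intro divide_right_mono) auto
  also have "\<dots> = (K / c) powr p" using c Lp_leD(1)[OF X] by (simp add: powr_divide)
  finally show ?thesis .
qed

subsection \<open>Sums of independent and of \<open>m\<close>-dependent variables\<close>

text \<open>A Taylor bound for |x + y|^p around x that keeps the linear term exact: x |x|^(p-2) is
  the derivative of |x|^p / p. Under the integral this term vanishes when y is centred and
  independent of x.\<close>

definition second_order_const :: "real \<Rightarrow> real \<Rightarrow> bool" where
  "second_order_const p C \<longleftrightarrow> C \<ge> 1 \<and> (\<forall>x y :: real. \<bar>x + y\<bar> powr p \<le>
     \<bar>x\<bar> powr p + p * (x * \<bar>x\<bar> powr (p - 2)) * y + C * (\<bar>x\<bar> powr (p - 2) * y\<^sup>2 + \<bar>y\<bar> powr p))"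

text \<open>Two regimes. If |x| \<le> 2|y|, all terms are controlled by |y|^p. Otherwise z = y/x
  satisfies |z| \<le> 1/2, and (1 + z)^p \<le> exp(pz) is expanded to second order.\<close>

lemma second_order_const_exists:
  assumes p: "p \<ge> 2"
  shows "\<exists>C. second_order_const p C"
proof -
  \<comment> \<open>The first two summands bound |x + y|^p and the linear term when |x| \<le> 2|y|;
    the third bounds the Taylor remainder, whose intermediate point is at most p.\<close>
  define C where "C = 3 powr p + p * 2 powr (p - 1) + exp p * p\<^sup>2"
  have C1: "C \<ge> 3 powr p + p * 2 powr (p - 1)" "C \<ge> exp p * p\<^sup>2"
    using p by (auto simp: C_def)
  have C0: "C \<ge> 1"
    using C1(1) p ge_one_powr_ge_zero[of 3 p] by (smt (verit) mult_nonneg_nonneg powr_ge_zero)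
  have "\<bar>x + y\<bar> powr p \<le>
     \<bar>x\<bar> powr p + p * (x * \<bar>x\<bar> powr (p - 2)) * y + C * (\<bar>x\<bar> powr (p - 2) * y\<^sup>2 + \<bar>y\<bar> powr p)"
    (is "?l \<le> ?r") for x y :: real
  proof (cases "\<bar>x\<bar> \<le> 2 * \<bar>y\<bar>")
    case True
    have "?l \<le> (3 * \<bar>y\<bar>) powr p" using True p by (intro powr_mono2) auto
    then have 1: "?l \<le> 3 powr p * \<bar>y\<bar> powr p" by (simp add: powr_mult)
    have "\<bar>p * (x * \<bar>x\<bar> powr (p - 2)) * y\<bar> = p * \<bar>x\<bar> powr (p - 1) * \<bar>y\<bar>"
    proof (cases "x = 0")
      case False
      then have "\<bar>x\<bar> * \<bar>x\<bar> powr (p - 2) = \<bar>x\<bar> powr (p - 1)"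
        using powr_add[of "\<bar>x\<bar>" 1 "p - 2"] by simp
      then show ?thesis using p by (simp add: abs_mult)
    qed simp
    also have "\<dots> \<le> p * (2 * \<bar>y\<bar>) powr (p - 1) * \<bar>y\<bar>"
      using True p by (intro mult_right_mono mult_left_mono powr_mono2) auto
    also have "\<dots> = p * 2 powr (p - 1) * \<bar>y\<bar> powr p"
    proof (cases "y = 0")
      case False
      then have "\<bar>y\<bar> powr (p - 1) * \<bar>y\<bar> = \<bar>y\<bar> powr p"
        using powr_add[of "\<bar>y\<bar>" "p - 1" 1] by simp
      then show ?thesis by (simp add: powr_mult)
    qed simp
    finally have 2: "\<bar>p * (x * \<bar>x\<bar> powr (p - 2)) * y\<bar> \<le> p * 2 powr (p - 1) * \<bar>y\<bar> powr p" .
    have "(3 powr p + p * 2 powr (p - 1)) * \<bar>y\<bar> powr p \<le> C * \<bar>y\<bar> powr p"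
      using C1 by (intro mult_right_mono) auto
    also have "\<dots> \<le> C * (\<bar>x\<bar> powr (p - 2) * y\<^sup>2 + \<bar>y\<bar> powr p)"
      using C0 by (intro mult_left_mono) auto
    finally have 3: "(3 powr p + p * 2 powr (p - 1)) * \<bar>y\<bar> powr p
      \<le> C * (\<bar>x\<bar> powr (p - 2) * y\<^sup>2 + \<bar>y\<bar> powr p)" .
    have "0 \<le> \<bar>x\<bar> powr p" by simp
    moreover have "(3 powr p + p * 2 powr (p - 1)) * \<bar>y\<bar> powr p = 3 powr p * \<bar>y\<bar> powr p + p * 2 powr (p - 1) * \<bar>y\<bar> powr p"
      by (rule distrib_right)
    ultimately show ?thesis using 1 2 3 by linarith
  next
    case False
    then have x: "x \<noteq> 0" by auto
    define z where "z = y / x"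
    have y: "y = x * z" using x by (simp add: z_def)
    have z: "\<bar>z\<bar> \<le> 1 / 2" using False x by (simp add: z_def field_simps)
    obtain t where t: "\<bar>t\<bar> \<le> \<bar>p * z\<bar>" "exp (p * z) = (\<Sum>m<2. (p * z) ^ m / fact m) + exp t / fact 2 * (p * z)\<^sup>2"
      using Maclaurin_exp_le[of "p * z" 2] by auto
    have "\<bar>p * z\<bar> \<le> p" using z p mult_mono[of p p "\<bar>z\<bar>" 1] by (simp add: abs_mult)
    then have "exp t \<le> exp p" using t(1) by simp
    have "(1 + z) powr p = exp (p * ln (1 + z))" using z by (simp add: powr_def)
    also have "\<dots> \<le> exp (p * z)" using z p ln_add_one_self_le_self2[of z] by simp
    also have "\<dots> = 1 + p * z + exp t / 2 * (p * z)\<^sup>2" using t(2) by (simp add: numeral_2_eq_2)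
    also have "\<dots> \<le> 1 + p * z + exp p * (p * z)\<^sup>2"
    proof (intro add_left_mono mult_right_mono)
      show "exp t / 2 \<le> exp p" using \<open>exp t \<le> exp p\<close> exp_gt_zero[of t] by linarith
    qed simp
    also have "\<dots> \<le> 1 + p * z + C * z\<^sup>2"
      using C1(2) by (simp add: power_mult_distrib mult_right_mono mult.assoc[symmetric])
    finally have "\<bar>x\<bar> powr p * (1 + z) powr p \<le> \<bar>x\<bar> powr p * (1 + p * z + C * z\<^sup>2)"
      by (intro mult_left_mono) auto
    moreover have "?l = \<bar>x\<bar> powr p * (1 + z) powr p"
    proof -
      have "x + y = x * (1 + z)" by (simp add: y algebra_simps)
      then show ?thesis using z by (simp add: abs_mult powr_mult)
    qed
    moreover have "\<bar>x\<bar> powr p = \<bar>x\<bar> powr (p - 2) * x\<^sup>2"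
      using x powr_add[of "\<bar>x\<bar>" "p - 2" 2] by simp
    ultimately have "?l \<le> \<bar>x\<bar> powr p + p * (x * \<bar>x\<bar> powr (p - 2)) * y + C * (\<bar>x\<bar> powr (p - 2) * y\<^sup>2)"
      by (simp add: y algebra_simps power2_eq_square)
    moreover have "0 \<le> C * \<bar>y\<bar> powr p" using C0 by simp
    ultimately show ?thesis by (simp add: distrib_left)
  qed
  then show ?thesis using C0 by (auto simp: second_order_const_def)
qed

text \<open>Integrating the second-order bound leaves L^p + C (K^2 L^(p-2) + K^p), the linear term
  being zero by independence and \<open>Y0\<close>. Since K \<le> L, this is at most L^(p-2) (L^2 +
  2CK^2), hence at most (L^2 + 2CK^2)^(p/2). In this form the squares of the bounds add up when the
  lemma is iterated.\<close>

lemma (in prob_space) Lp_le_add_indep: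
  assumes p: "p \<ge> 2" and C: "second_order_const p C" and ind: "indep_var borel Y borel X"
    and X: "Lp_le M p X L" and Y: "Lp_le M p Y K" and KL: "K \<le> L" and Y0: "(\<integral>\<omega>. Y \<omega> \<partial>M) = 0"
  shows "Lp_le M p (\<lambda>\<omega>. X \<omega> + Y \<omega>) (sqrt (L\<^sup>2 + 2 * C * K\<^sup>2))"
proof -
  have C1: "C \<ge> 1" using C by (auto simp: second_order_const_def)
  have [measurable]: "X \<in> borel_measurable M" "Y \<in> borel_measurable M"
    using X Y by (auto simp: Lp_le_def)
  have K: "K > 0" and L: "L > 0" using X Y by (auto simp: Lp_le_def)
  have Xq: "integrable M (\<lambda>\<omega>. \<bar>X \<omega>\<bar> powr (p - 2))" "(\<integral>\<omega>. \<bar>X \<omega>\<bar> powr (p - 2) \<partial>M) \<le> L powr (p - 2)"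
  proof -
    have "integrable M (\<lambda>\<omega>. \<bar>X \<omega>\<bar> powr (p - 2)) \<and> (\<integral>\<omega>. \<bar>X \<omega>\<bar> powr (p - 2) \<partial>M) \<le> L powr (p - 2)"
    proof (cases "p = 2")
      \<comment> \<open>Exponent 0 lies outside \<open>Lp_le_lyapunov\<close>. As
        \<open>0 powr 0 = 0\<close>, the integrand is at most 1 but need not equal 1.\<close>
      case True
      have i: "integrable M (\<lambda>\<omega>. \<bar>X \<omega>\<bar> powr 0)"
        by (rule integrable_const_bound[where B = 1]) auto
      have "(\<integral>\<omega>. \<bar>X \<omega>\<bar> powr 0 \<partial>M) \<le> (\<integral>\<omega>. 1 \<partial>M)"
        by (rule integral_mono[OF i]) auto
      then show ?thesis using True i L by (simp add: prob_space)
    next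
      case False
      then show ?thesis
        using Lp_leD(3,4)[OF Lp_le_lyapunov[OF X, of "p - 2"]] p by simp
    qed
    then show "integrable M (\<lambda>\<omega>. \<bar>X \<omega>\<bar> powr (p - 2))" "(\<integral>\<omega>. \<bar>X \<omega>\<bar> powr (p - 2) \<partial>M) \<le> L powr (p - 2)"
      by auto
  qed
  have X1: "integrable M (\<lambda>\<omega>. X \<omega> * \<bar>X \<omega>\<bar> powr (p - 2))"
  proof -
    have "integrable M (\<lambda>\<omega>. \<bar>X \<omega>\<bar> powr (p - 1))"
      using Lp_leD(3)[OF Lp_le_lyapunov[OF X, of "p - 1"]] p by simp
    moreover have "\<bar>X \<omega> * \<bar>X \<omega>\<bar> powr (p - 2)\<bar> = \<bar>X \<omega>\<bar> powr (p - 1)" for \<omega>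
      using powr_add[of "\<bar>X \<omega>\<bar>" 1 "p - 2"] by (cases "X \<omega> = 0") (auto simp: abs_mult)
    ultimately show ?thesis
      by (intro Bochner_Integration.integrable_bound[where g = "\<lambda>\<omega>. X \<omega> * \<bar>X \<omega>\<bar> powr (p - 2)"]) auto
  qed
  have Y2: "integrable M (\<lambda>\<omega>. (Y \<omega>)\<^sup>2)" "(\<integral>\<omega>. (Y \<omega>)\<^sup>2 \<partial>M) \<le> K\<^sup>2"
    using Lp_leD(3,4)[OF Lp_le_lyapunov[OF Y, of 2]] p K by simp_all
  have Y1: "integrable M Y" using Lp_le_integral(1)[OF Y] p by simp
  note Xp = Lp_leD(3,4)[OF X] and Yp = Lp_leD(3,4)[OF Y]
  have i1: "indep_var borel Y borel (\<lambda>\<omega>. X \<omega> * \<bar>X \<omega>\<bar> powr (p - 2))"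
    using indep_var_compose[OF ind, of "\<lambda>y. y" borel "\<lambda>x. x * \<bar>x\<bar> powr (p - 2)" borel] by (simp add: comp_def)
  have i2: "indep_var borel (\<lambda>\<omega>. (Y \<omega>)\<^sup>2) borel (\<lambda>\<omega>. \<bar>X \<omega>\<bar> powr (p - 2))"
    using indep_var_compose[OF ind, of "\<lambda>y. y\<^sup>2" borel "\<lambda>x. \<bar>x\<bar> powr (p - 2)" borel] by (simp add: comp_def)
  let ?g = "\<lambda>\<omega>. \<bar>X \<omega>\<bar> powr p + p * (Y \<omega> * (X \<omega> * \<bar>X \<omega>\<bar> powr (p - 2)))
      + C * ((Y \<omega>)\<^sup>2 * \<bar>X \<omega>\<bar> powr (p - 2) + \<bar>Y \<omega>\<bar> powr p)"
  note int = Xp(1) Yp(1) indep_var_integrable[OF i1 Y1 X1] indep_var_integrable[OF i2 Y2(1) Xq(1)]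
  have "L\<^sup>2 + 2 * C * K\<^sup>2 > 0" using L C1 by (simp add: add_pos_nonneg)
  show ?thesis
  proof (rule Lp_leI[where g = ?g])
    show "sqrt (L\<^sup>2 + 2 * C * K\<^sup>2) > 0" by (simp add: \<open>L\<^sup>2 + 2 * C * K\<^sup>2 > 0\<close>)
    show "integrable M ?g" using int by auto
    show "\<bar>X \<omega> + Y \<omega>\<bar> powr p \<le> ?g \<omega>" for \<omega>
      using C[unfolded second_order_const_def, THEN conjunct2, rule_format, of "X \<omega>" "Y \<omega>"]
      by (simp only: mult_ac)
    have "(\<integral>\<omega>. ?g \<omega> \<partial>M) = (\<integral>\<omega>. \<bar>X \<omega>\<bar> powr p \<partial>M)
       + C * ((\<integral>\<omega>. (Y \<omega>)\<^sup>2 \<partial>M) * (\<integral>\<omega>. \<bar>X \<omega>\<bar> powr (p - 2) \<partial>M) + (\<integral>\<omega>. \<bar>Y \<omega>\<bar> powr p \<partial>M))"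
      using int indep_var_lebesgue_integral[OF i1 Y1 X1] indep_var_lebesgue_integral[OF i2 Y2(1) Xq(1)]
      by (simp add: Y0)
    also have "\<dots> \<le> L powr p + C * (K\<^sup>2 * L powr (p - 2) + K powr p)"
      using Xp Xq Y2 Yp C1 by (intro add_mono mult_left_mono mult_mono) auto
    also have "K powr p \<le> K\<^sup>2 * L powr (p - 2)"
      using powr_add[of K 2 "p - 2"] K KL p by (auto intro!: mult_left_mono powr_mono2)
    also have "L powr p + C * (K\<^sup>2 * L powr (p - 2) + K\<^sup>2 * L powr (p - 2))
        = L powr (p - 2) * (L\<^sup>2 + 2 * C * K\<^sup>2)"
      using powr_add[of L "p - 2" 2] L by (simp add: algebra_simps)
    also have "\<dots> \<le> sqrt (L\<^sup>2 + 2 * C * K\<^sup>2) powr (p - 2) * (L\<^sup>2 + 2 * C * K\<^sup>2)"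
      using p L C1 by (intro mult_right_mono powr_mono2) (auto intro!: real_le_rsqrt)
    also have "\<dots> = sqrt (L\<^sup>2 + 2 * C * K\<^sup>2) powr p"
      using powr_add[of "sqrt (L\<^sup>2 + 2 * C * K\<^sup>2)" "p - 2" 2] \<open>L\<^sup>2 + 2 * C * K\<^sup>2 > 0\<close> by simp
    finally show "(\<integral>\<omega>. ?g \<omega> \<partial>M) \<le> sqrt (L\<^sup>2 + 2 * C * K\<^sup>2) powr p" using C1 by simp
  qed simp
qed

text \<open>Each new summand adds 2CK^2 to the squared bound, which gives the square-root growth.
  The requirement K \<le> L of the previous lemma holds because the accumulated bound already
  contains the factor sqrt(2C) \<ge> 1.\<close>

lemma (in prob_space) Lp_le_sum_indep:
  assumes p: "p \<ge> 2" and C: "second_order_const p C" and "finite I" "I \<noteq> {}"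
    and "indep_vars (\<lambda>_. borel) X I" and "\<And>i. i \<in> I \<Longrightarrow> Lp_le M p (X i) K"
    and "\<And>i. i \<in> I \<Longrightarrow> (\<integral>\<omega>. X i \<omega> \<partial>M) = 0"
  shows "Lp_le M p (\<lambda>\<omega>. \<Sum>i\<in>I. X i \<omega>) (sqrt (2 * C * card I) * K)"
  using assms(3-7)
proof (induction I rule: finite_ne_induct)
  have C1: "C \<ge> 1" using C by (auto simp: second_order_const_def)
  {
    case (singleton i)
    have "1 * K \<le> sqrt (2 * C) * K"
      using C1 Lp_leD(1)[OF singleton(2)] by (intro mult_right_mono) auto
    then show ?case using singleton p by (auto intro: Lp_le_mono)
  next
    case (insert i I)
    have K: "K > 0" using Lp_leD(1)[OF insert.prems(2)] by auto
    have n: "real (card I) \<ge> 1" using insert by (simp add: Suc_leI card_gt_0_iff)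
    have "2 * C * card I \<ge> 1 * 1" using C1 n by (intro mult_mono) auto
    then have KL: "K \<le> sqrt (2 * C * card I) * K"
      using K by simp
    have X: "Lp_le M p (\<lambda>\<omega>. \<Sum>i\<in>I. X i \<omega>) (sqrt (2 * C * card I) * K)"
      using insert.prems by (intro insert.IH) (auto intro: indep_vars_subset)
    have ind: "indep_var borel (X i) borel (\<lambda>\<omega>. \<Sum>i\<in>I. X i \<omega>)"
      using insert by (intro indep_vars_sum) auto
    have "(sqrt (2 * C * card I) * K)\<^sup>2 + 2 * C * K\<^sup>2 = 2 * C * card (insert i I) * K\<^sup>2"
      using insert C1 by (simp add: power_mult_distrib algebra_simps)
    then have "sqrt ((sqrt (2 * C * card I) * K)\<^sup>2 + 2 * C * K\<^sup>2) = sqrt (2 * C * card (insert i I)) * K"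
      using K by (simp add: real_sqrt_mult)
    then show ?case
      using Lp_le_add_indep[OF p C ind X insert.prems(2) KL insert.prems(3)] insert
      by (simp add: add.commute)
  }
qed

text \<open>Division by m maps the class injectively into an integer interval with at most n/m + 1
  points; m \<le> n turns the 1 into another n/m.\<close>

lemma card_residue_class:
  fixes s m r :: int and n :: nat
  assumes m: "m \<ge> 1" "m \<le> int n"
  shows "real (card {t\<in>{s<..s + int n}. t mod m = r}) \<le> 2 * n / m"
proof -
  let ?J = "{t\<in>{s<..s + int n}. t mod m = r}" and ?B = "{(s - r) div m<..(s + int n - r) div m}"
  have "inj_on (\<lambda>t. (t - r) div m) ?J"
  proof (rule inj_onI)
    fix t t' assume a: "t \<in> ?J" "t' \<in> ?J" "(t - r) div m = (t' - r) div m"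
    then have "m dvd t - r" "m dvd t' - r" by (metis (mono_tags, lifting) dvd_minus_mod mem_Collect_eq)+
    then show "t = t'" using a(3) by (metis diff_add_cancel dvd_div_mult_self)
  qed
  moreover have "(\<lambda>t. (t - r) div m) ` ?J \<subseteq> ?B"
  proof safe
    fix t assume t: "t \<in> {s<..s + int n}" "r = t mod m"
    then have "m dvd t - r" by auto
    then obtain k where k: "t - r = m * k" by auto
    show "(t - t mod m) div m \<in> {(s - t mod m) div m<..(s + int n - t mod m) div m}"
    proof -
      have "(s - r) div m < k"
      proof -
        have "s - r < m * k" using k t by auto
        moreover have "m * ((s - r) div m) \<le> s - r"
          using m by (simp add: minus_mod_eq_mult_div[symmetric])
        ultimately have "m * ((s - r) div m) < m * k" by linarith
        then show ?thesis using m by simp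
      qed
      moreover have "k \<le> (s + int n - r) div m"
      proof -
        have "m * k div m \<le> (s + int n - r) div m" using k t m by (intro zdiv_mono1) auto
        then show ?thesis using m by simp
      qed
      ultimately show ?thesis using k t m by auto
    qed
  qed
  ultimately have "card ?J \<le> card ?B" by (intro card_inj_on_le) auto
  also have "\<dots> = nat ((s + int n - r) div m - (s - r) div m)" by simp
  finally have "real (card ?J) \<le> real_of_int ((s + int n - r) div m) - real_of_int ((s - r) div m)"
    if "(s + int n - r) div m \<ge> (s - r) div m" using that by linarith
  moreover have "(s + int n - r) div m \<ge> (s - r) div m" using m by (intro zdiv_mono1) auto
  moreover have "real_of_int ((s + int n - r) div m) \<le> real_of_int (s + int n - r) / m"
    using floor_divide_of_int_eq[of "s + int n - r" m, where ?'a = real] by linarith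
  moreover have "real_of_int ((s - r) div m) \<ge> real_of_int (s - r) / m - 1"
    using floor_divide_of_int_eq[of "s - r" m, where ?'a = real] by linarith
  ultimately have "real (card ?J) \<le> real_of_int (s + int n - r) / m - real_of_int (s - r) / m + 1"
    by linarith
  also have "\<dots> = n / m + 1" using m by (simp add: field_simps)
  also have "1 \<le> n / m" using m by simp
  finally show ?thesis by simp
qed

abbreviation window :: "(int \<Rightarrow> 'a \<Rightarrow> 's) \<Rightarrow> int \<Rightarrow> int \<Rightarrow> 'a \<Rightarrow> int \<Rightarrow> 's" where
  "window \<eta> t l \<omega> \<equiv> \<lambda>s\<in>{t - l<..t}. \<eta> s \<omega>"

text \<open>Times in one residue class modulo m are at least m apart, so their windows are disjoint
  and the summands independent. A class contributes a multiple of sqrt(n/m), and there are at most m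
  classes; the triangle inequality over them gives m sqrt(n/m) = sqrt(nm).\<close>

lemma (in prob_space) Lp_le_sum_window:
  fixes \<eta> :: "int \<Rightarrow> 'a \<Rightarrow> 's" and s m :: int and n :: nat
  assumes p: "p \<ge> 2" and C: "second_order_const p C"
    and ind: "indep_vars (\<lambda>_. S) \<eta> UNIV" and m: "m \<ge> 1" "m \<le> int n"
    and h: "\<And>t. h t \<in> PiM {t - m<..t} (\<lambda>_. S) \<rightarrow>\<^sub>M borel"
    and X: "\<And>t. Lp_le M p (\<lambda>\<omega>. h t (window \<eta> t m \<omega>)) K"
    and X0: "\<And>t. (\<integral>\<omega>. h t (window \<eta> t m \<omega>) \<partial>M) = 0"
  shows "Lp_le M p (\<lambda>\<omega>. \<Sum>t\<in>{s<..s + int n}. h t (window \<eta> t m \<omega>)) (2 * sqrt (C * n * m) * K)"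
proof -
  let ?X = "\<lambda>t \<omega>. h t (window \<eta> t m \<omega>)" and ?I = "{s<..s + int n}"
  let ?J = "\<lambda>r. {t\<in>?I. t mod m = r}"
  have C1: "C \<ge> 1" using C by (auto simp: second_order_const_def)
  have K: "K > 0" using Lp_leD(1)[OF X] .
  \<comment> \<open>Only residues that occur, so that every class is nonempty.\<close>
  define R where "R = (\<lambda>t. t mod m) ` ?I"
  have R: "finite R" "R \<noteq> {}" "R \<subseteq> {0..<m}" using m by (auto simp: R_def)
  have cR: "real (card R) \<le> m" using card_mono[OF _ R(3)] m by simp
  have fiber: "Lp_le M p (\<lambda>\<omega>. \<Sum>t\<in>?J r. ?X t \<omega>) (2 * sqrt (C * n / m) * K)" if "r \<in> R" for r
  proof -
    have ne: "?J r \<noteq> {}" using that by (auto simp: R_def)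
    have "disjoint_family_on (\<lambda>t. {t - m<..t}) (?J r)"
    unfolding disjoint_family_on_def
    proof (intro ballI impI)
      fix t t' assume a: "t \<in> ?J r" "t' \<in> ?J r" "t \<noteq> t'"
      then have "t mod m = t' mod m" by auto
      then have "m dvd t - t'" by (simp only: mod_eq_dvd_iff)
      then have "m \<le> \<bar>t - t'\<bar>" using a m dvd_imp_le_int[of "t - t'" m] by auto
      then show "{t - m<..t} \<inter> {t' - m<..t'} = {}" by auto
    qed
    from indep_vars_restrict[OF ind, of "?J r" "\<lambda>t. {t - m<..t}", OF _ this]
    have "indep_vars (\<lambda>_. borel) ?X (?J r)"
      using h by (intro indep_vars_compose2[where X = "\<lambda>t. window \<eta> t m" and Y = h]) auto
    moreover have "finite (?J r)" by (rule finite_subset[of _ ?I]) auto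
    ultimately have "Lp_le M p (\<lambda>\<omega>. \<Sum>t\<in>?J r. ?X t \<omega>) (sqrt (2 * C * card (?J r)) * K)"
      using ne X X0 by (intro Lp_le_sum_indep[OF p C]) blast+
    moreover have "sqrt (2 * C * card (?J r)) * K \<le> 2 * sqrt (C * n / m) * K"
    proof (rule mult_right_mono)
      have "2 * C * card (?J r) \<le> 2 * C * (2 * n / m)"
        using card_residue_class[OF m, of s r] C1 by (intro mult_left_mono) auto
      also have "\<dots> = 2\<^sup>2 * (C * n / m)" by simp
      finally have "sqrt (2 * C * card (?J r)) \<le> sqrt (2\<^sup>2 * (C * n / m))" by (intro real_sqrt_le_mono)
      then show "sqrt (2 * C * card (?J r)) \<le> 2 * sqrt (C * n / m)"
        by (simp only: real_sqrt_mult real_sqrt_abs)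
    qed (use K in auto)
    ultimately show ?thesis using p by (auto intro: Lp_le_mono)
  qed
  have "Lp_le M p (\<lambda>\<omega>. \<Sum>r\<in>R. \<Sum>t\<in>?J r. ?X t \<omega>) (\<Sum>r\<in>R. 2 * sqrt (C * n / m) * K)"
    using p R fiber by (intro Lp_le_sum) auto
  moreover have "(\<Sum>r\<in>R. 2 * sqrt (C * n / m) * K) \<le> 2 * sqrt (C * n * m) * K"
  proof -
    have "(\<Sum>r\<in>R. 2 * sqrt (C * n / m) * K) = card R * (2 * sqrt (C * n / m) * K)" by simp
    also have "\<dots> \<le> m * (2 * sqrt (C * n / m) * K)"
      using cR K C1 m by (intro mult_right_mono) auto
    also have "\<dots> = 2 * (m * sqrt (C * n / m)) * K" by simp
    also have "m * sqrt (C * n / m) = sqrt (m\<^sup>2 * (C * n / m))"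
      using m by (simp only: real_sqrt_mult real_sqrt_abs) simp
    also have "m\<^sup>2 * (C * n / m) = C * n * m" using m by (simp add: power2_eq_square)
    finally show ?thesis .
  qed
  moreover have "(\<Sum>r\<in>R. \<Sum>t\<in>?J r. ?X t \<omega>) = (\<Sum>t\<in>?I. ?X t \<omega>)" for \<omega>
    unfolding R_def by (rule sum.image_gen[symmetric]) auto
  ultimately show ?thesis using p by (auto intro: Lp_le_mono)
qed

subsection \<open>Processes approximable by functions of finite windows of the innovations\<close>

text \<open>The coupling condition with the function g and the copies forgotten: stable under
  centring and products, and free of stationarity. A single c bounds both the variable and its
  approximation error, which keeps the product rule short.\<close>

definition approximable ::
  "'a measure \<Rightarrow> 's measure \<Rightarrow> (int \<Rightarrow> 'a \<Rightarrow> 's) \<Rightarrow> real \<Rightarrow> real \<Rightarrow> real \<Rightarrow> (int \<Rightarrow> 'a \<Rightarrow> real) \<Rightarrow> bool" where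
  "approximable M S \<eta> p c a x \<longleftrightarrow> (\<forall>t. Lp_le M p (x t) c) \<and>
     (\<forall>t. \<forall>l\<ge>1. \<exists>h \<in> PiM {t - l<..t} (\<lambda>_. S) \<rightarrow>\<^sub>M borel.
        Lp_le M p (\<lambda>\<omega>. x t \<omega> - h (window \<eta> t l \<omega>)) (c * real_of_int l powr (- a)))"

lemma approximableD:
  assumes "approximable M S \<eta> p c a x"
  shows "Lp_le M p (x t) c"
    and "l \<ge> 1 \<Longrightarrow> \<exists>h \<in> PiM {t - l<..t} (\<lambda>_. S) \<rightarrow>\<^sub>M borel.
        Lp_le M p (\<lambda>\<omega>. x t \<omega> - h (window \<eta> t l \<omega>)) (c * real_of_int l powr (- a))"
  using assms by (auto simp: approximable_def)

lemma approximable_mono: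
  assumes x: "approximable M S \<eta> p c a x" and "c \<le> c'" "a' \<le> a" "p \<ge> 0"
  shows "approximable M S \<eta> p c' a' x"
  unfolding approximable_def
proof (intro conjI allI impI)
  have c: "c > 0" using Lp_leD(1)[OF approximableD(1)[OF x]] .
  show "Lp_le M p (x t) c'" for t
    using Lp_le_mono[OF approximableD(1)[OF x]] assms by auto
  fix t l :: int assume l: "l \<ge> 1"
  then have "c * real_of_int l powr (- a) \<le> c' * real_of_int l powr (- a')"
    using c assms by (intro mult_mono powr_mono) auto
  then show "\<exists>h \<in> PiM {t - l<..t} (\<lambda>_. S) \<rightarrow>\<^sub>M borel.
        Lp_le M p (\<lambda>\<omega>. x t \<omega> - h (window \<eta> t l \<omega>)) (c' * real_of_int l powr (- a'))"
    using approximableD(2)[OF x l, of t] assms by (auto intro: Lp_le_mono)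
qed

lemma (in prob_space) approximable_lyapunov:
  assumes "approximable M S \<eta> p c a x" "0 < q" "q \<le> p"
  shows "approximable M S \<eta> q c a x"
  using assms(1) Lp_le_lyapunov[OF _ assms(2,3)] unfolding approximable_def by meson

lemma (in prob_space) approximable_center:
  assumes x: "approximable M S \<eta> p c a x" and p: "p \<ge> 1"
  shows "approximable M S \<eta> p (2 * c) a (\<lambda>t \<omega>. x t \<omega> - (\<integral>\<omega>. x t \<omega> \<partial>M))"
  unfolding approximable_def
proof (intro conjI allI impI)
  have c: "c > 0" using Lp_leD(1)[OF approximableD(1)[OF x]] .
  show "Lp_le M p (\<lambda>\<omega>. x t \<omega> - (\<integral>\<omega>. x t \<omega> \<partial>M)) (2 * c)" for t
    by (rule Lp_le_center[OF approximableD(1)[OF x] p])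
  fix t l :: int assume l: "l \<ge> 1"
  from approximableD(2)[OF x l, of t] obtain h where h: "h \<in> PiM {t - l<..t} (\<lambda>_. S) \<rightarrow>\<^sub>M borel"
    "Lp_le M p (\<lambda>\<omega>. x t \<omega> - h (window \<eta> t l \<omega>)) (c * real_of_int l powr (- a))" by auto
  have "Lp_le M p (\<lambda>\<omega>. x t \<omega> - h (window \<eta> t l \<omega>)) (2 * c * real_of_int l powr (- a))"
    using p c by (intro Lp_le_mono[OF h(2)]) auto
  then show "\<exists>h \<in> PiM {t - l<..t} (\<lambda>_. S) \<rightarrow>\<^sub>M borel.
        Lp_le M p (\<lambda>\<omega>. x t \<omega> - (\<integral>\<omega>. x t \<omega> \<partial>M) - h (window \<eta> t l \<omega>)) (2 * c * real_of_int l powr (- a))"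
    using h(1) by (intro bexI[where x = "\<lambda>v. h v - (\<integral>\<omega>. x t \<omega> \<partial>M)"]) auto
qed

text \<open>With approximants h of x and k of y, xy - hk = x (y - k) + (x - h) k. As the error of k
  is at most d, k itself is bounded by 2d; the two products contribute 1 and 2, whence the constant
  3.\<close>

lemma approximable_mult:
  assumes x: "approximable M S \<eta> (2 * p) c a x" and y: "approximable M S \<eta> (2 * p) d a y"
    and p: "p \<ge> 1" and a: "a \<ge> 0"
  shows "approximable M S \<eta> p (3 * c * d) a (\<lambda>t \<omega>. x t \<omega> * y t \<omega>)"
  unfolding approximable_def
proof (intro conjI allI impI)
  have c: "c > 0" and d: "d > 0"
    using Lp_leD(1)[OF approximableD(1)[OF x]] Lp_leD(1)[OF approximableD(1)[OF y]] by auto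
  show "Lp_le M p (\<lambda>\<omega>. x t \<omega> * y t \<omega>) (3 * c * d)" for t
    using p c d by (intro Lp_le_mono[OF Lp_le_mult[OF approximableD(1)[OF x] approximableD(1)[OF y]]]) auto
  fix t l :: int assume l: "l \<ge> 1"
  let ?r = "real_of_int l powr (- a)"
  have r1: "?r \<le> 1" using l a powr_mono[of "- a" 0 "real_of_int l"] by simp
  from approximableD(2)[OF x l, of t] obtain h where h: "h \<in> PiM {t - l<..t} (\<lambda>_. S) \<rightarrow>\<^sub>M borel"
    "Lp_le M (2 * p) (\<lambda>\<omega>. x t \<omega> - h (window \<eta> t l \<omega>)) (c * ?r)" by auto
  from approximableD(2)[OF y l, of t] obtain k where k: "k \<in> PiM {t - l<..t} (\<lambda>_. S) \<rightarrow>\<^sub>M borel"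
    "Lp_le M (2 * p) (\<lambda>\<omega>. y t \<omega> - k (window \<eta> t l \<omega>)) (d * ?r)" by auto
  let ?v = "window \<eta> t l"
  have "Lp_le M (2 * p) (\<lambda>\<omega>. y t \<omega> - (y t \<omega> - k (?v \<omega>))) (d + d * ?r)"
    using p by (intro Lp_le_diff approximableD(1)[OF y] k(2)) auto
  then have k2: "Lp_le M (2 * p) (\<lambda>\<omega>. k (?v \<omega>)) (2 * d)"
    using r1 d p by (auto intro!: Lp_le_mono[where K = "d + d * ?r"])
  have "Lp_le M p (\<lambda>\<omega>. x t \<omega> * (y t \<omega> - k (?v \<omega>)) + (x t \<omega> - h (?v \<omega>)) * k (?v \<omega>))
      (c * (d * ?r) + (c * ?r) * (2 * d))"
    by (intro Lp_le_add p Lp_le_mult approximableD(1)[OF x] k k2 h)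
  then have "Lp_le M p (\<lambda>\<omega>. x t \<omega> * y t \<omega> - h (?v \<omega>) * k (?v \<omega>)) (3 * c * d * ?r)"
    by (simp add: algebra_simps)
  then show "\<exists>h \<in> PiM {t - l<..t} (\<lambda>_. S) \<rightarrow>\<^sub>M borel.
        Lp_le M p (\<lambda>\<omega>. x t \<omega> * y t \<omega> - h (window \<eta> t l \<omega>)) (3 * c * d * ?r)"
    using h(1) k(1) by (intro bexI[where x = "\<lambda>v. h v * k v"]) auto
qed

text \<open>
  Telescope over windows of length \<open>2\<^sup>j\<close>: the \<open>j\<close>-th increment is \<open>2\<^bsup>j+1\<^esup>\<close>-dependent of size
  \<open>2\<^bsup>-ja\<^esup>\<close>, so its sum over \<open>n\<close> times is of order \<open>\<surd>n \<cdot> 2\<^bsup>j(1/2 - a)\<^esup>\<close>.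
\<close>
lemma (in prob_space) Lp_le_sum_approximable:
  fixes \<eta> :: "int \<Rightarrow> 'a \<Rightarrow> 's" and s :: int and n :: nat
  assumes p: "p \<ge> 2" and C: "second_order_const p C" and ind: "indep_vars (\<lambda>_. S) \<eta> UNIV"
    and x: "approximable M S \<eta> p c a x" and a: "a \<ge> 1" and x0: "\<And>t. (\<integral>\<omega>. x t \<omega> \<partial>M) = 0" and n: "n \<ge> 1"
  shows "Lp_le M p (\<lambda>\<omega>. \<Sum>t\<in>{s<..s + int n}. x t \<omega>) (60 * sqrt C * c * sqrt n)"
proof -
  let ?I = "{s<..s + int n}"
  let ?w = "\<lambda>t j. {t - 2 ^ j<..t::int}" and ?v = "\<lambda>t j. window \<eta> t (2 ^ j)"
  have C1: "C \<ge> 1" using C by (auto simp: second_order_const_def)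
  have c: "c > 0" using Lp_leD(1)[OF approximableD(1)[OF x]] .
  let ?P = "\<lambda>t j h. h \<in> PiM (?w t j) (\<lambda>_. S) \<rightarrow>\<^sub>M borel \<and>
        Lp_le M p (\<lambda>\<omega>. x t \<omega> - h (?v t j \<omega>)) (c * real_of_int (2 ^ j) powr (- a))"
  have ex: "\<exists>h. ?P t j h" for t j
    using approximableD(2)[OF x, of "2 ^ j" t] unfolding Bex_def by simp
  define h where "h = (\<lambda>t j. SOME h. ?P t j h)"
  have "?P t j (h t j)" for t j unfolding h_def by (rule someI_ex[OF ex])
  then have h: "\<And>t j. h t j \<in> PiM (?w t j) (\<lambda>_. S) \<rightarrow>\<^sub>M borel"
    "\<And>t j. Lp_le M p (\<lambda>\<omega>. x t \<omega> - h t j (?v t j \<omega>)) (c * real_of_int (2 ^ j) powr (- a))" by blast+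
  have h2: "Lp_le M p (\<lambda>\<omega>. x t \<omega> - h t j (?v t j \<omega>)) (c / 2 ^ j)" for t j
  proof (rule Lp_le_mono[OF h(2)])
    have "real_of_int (2 ^ j) powr (- a) \<le> real_of_int (2 ^ j) powr (- 1)"
      using a by (intro powr_mono) auto
    also have "\<dots> = 1 / 2 ^ j" by (simp add: powr_minus_divide)
    finally show "c * real_of_int (2 ^ j) powr (- a) \<le> c / 2 ^ j" using c by (simp add: field_simps)
  qed (use p in auto)
  define H where "H = (\<lambda>t j \<omega>. h t j (?v t j \<omega>))"
  define \<mu> where "\<mu> = (\<lambda>t j. \<integral>\<omega>. H t j \<omega> \<partial>M)"
  have xH: "Lp_le M p (\<lambda>\<omega>. x t \<omega> - H t j \<omega>) (c / 2 ^ j)" for t j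
    unfolding H_def by (rule h2)
  have HL: "Lp_le M p (H t j) (2 * c)" for t j
  proof -
    have "Lp_le M p (\<lambda>\<omega>. x t \<omega> - (x t \<omega> - H t j \<omega>)) (c + c / 2 ^ j)"
      using p by (intro Lp_le_diff approximableD(1)[OF x] xH) auto
    then have "Lp_le M p (\<lambda>\<omega>. H t j \<omega>) (c + c / 2 ^ j)" by simp
    moreover have "c / 2 ^ j \<le> c" using c by (simp add: divide_le_eq)
    ultimately show ?thesis using p by (auto intro: Lp_le_mono)
  qed
  have Hi: "integrable M (H t j)" for t j using Lp_le_integral(1)[OF HL] p by simp
  have xi: "integrable M (x t)" for t using Lp_le_integral(1)[OF approximableD(1)[OF x]] p by simp
  define r where "r = 1 / sqrt (2::real)"
  have r: "0 < r" "r < 3 / 4"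
  proof -
    have "4 / 3 < sqrt (2::real)" by (rule real_less_rsqrt) (simp add: power2_eq_square)
    then show "0 < r" "r < 3 / 4" by (auto simp: r_def field_simps)
  qed
  \<comment> \<open>Level 0 consists of functions of one innovation bounded by 4c, and
    \<open>Lp_le_sum_window\<close> doubles this to 8c. The increment from level j to j + 1 is
    bounded by 4c/2^j and has window length 2^(j+1), which gives 8c sqrt(Cn) times sqrt(2)
    r^j.\<close>
  define B where "B = (\<lambda>J. 8 * c * sqrt (C * n) * (1 + sqrt 2 * (\<Sum>j<J. r ^ j)))"
  \<comment> \<open>The restriction on J says that the window is no longer than the range of
    summation.\<close>
  have main: "Lp_le M p (\<lambda>\<omega>. \<Sum>t\<in>?I. H t J \<omega> - \<mu> t J) (B J)" if "2 ^ J \<le> n" for J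
    using that
  proof (induction J)
    case 0
    have "Lp_le M p (\<lambda>\<omega>. \<Sum>t\<in>?I. (\<lambda>v. h t 0 v - \<mu> t 0) (window \<eta> t 1 \<omega>)) (2 * sqrt (C * n * real_of_int 1) * (2 * (2 * c)))"
    proof (rule Lp_le_sum_window[OF p C ind])
      show "(1::int) \<le> int n" using n by simp
      show "(\<lambda>v. h t 0 v - \<mu> t 0) \<in> PiM {t - 1<..t} (\<lambda>_. S) \<rightarrow>\<^sub>M borel" for t
        using h(1)[of t 0] by simp
      show "Lp_le M p (\<lambda>\<omega>. h t 0 (window \<eta> t 1 \<omega>) - \<mu> t 0) (2 * (2 * c))" for t
        using Lp_le_center[OF HL[of t 0]] p unfolding \<mu>_def H_def by simp
      show "(\<integral>\<omega>. h t 0 (window \<eta> t 1 \<omega>) - \<mu> t 0 \<partial>M) = 0" for t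
        using Hi[of t 0] unfolding \<mu>_def H_def by (simp add: prob_space)
    qed simp
    then show ?case by (simp add: B_def H_def mult_ac)
  next
    case (Suc J)
    \<comment> \<open>The difference of consecutive centred approximants, read as one function on
      the longer window.\<close>
    define k where "k = (\<lambda>t v. h t (Suc J) v - \<mu> t (Suc J) - (h t J (restrict v (?w t J)) - \<mu> t J))"
    have keq: "k t (?v t (Suc J) \<omega>) = (H t (Suc J) \<omega> - \<mu> t (Suc J)) - (H t J \<omega> - \<mu> t J)" for t \<omega>
    proof -
      have "?w t J \<subseteq> ?w t (Suc J)" by auto
      then have "restrict (?v t (Suc J) \<omega>) (?w t J) = ?v t J \<omega>" by (auto simp: restrict_def fun_eq_iff)
      then show ?thesis by (simp only: k_def H_def)
    qed
    have "Lp_le M p (\<lambda>\<omega>. \<Sum>t\<in>?I. k t (?v t (Suc J) \<omega>))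
      (2 * sqrt (C * n * real_of_int (2 ^ Suc J)) * (2 * (c / 2 ^ J + c / 2 ^ J)))"
    proof (rule Lp_le_sum_window[OF p C ind])
      show "(1::int) \<le> 2 ^ Suc J" by (rule one_le_power) simp
      show "(2::int) ^ Suc J \<le> int n" using Suc.prems by (metis of_nat_le_iff of_nat_numeral of_nat_power)
      show "k t \<in> PiM (?w t (Suc J)) (\<lambda>_. S) \<rightarrow>\<^sub>M borel" for t
      proof -
        have "?w t J \<subseteq> ?w t (Suc J)" by auto
        then have "(\<lambda>v. restrict v (?w t J)) \<in> PiM (?w t (Suc J)) (\<lambda>_. S) \<rightarrow>\<^sub>M PiM (?w t J) (\<lambda>_. S)"
          by (rule measurable_restrict_subset)
        from measurable_compose[OF this h(1)] show ?thesis
          using h(1)[of t "Suc J"] unfolding k_def by measurable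
      qed
      show "Lp_le M p (\<lambda>\<omega>. k t (?v t (Suc J) \<omega>)) (2 * (c / 2 ^ J + c / 2 ^ J))" for t
      proof -
        have "c / 2 ^ Suc J \<le> c / 2 ^ J" using c by (simp add: field_simps)
        then have "Lp_le M p (\<lambda>\<omega>. x t \<omega> - H t (Suc J) \<omega>) (c / 2 ^ J)"
          using xH[of t "Suc J"] p by (auto intro: Lp_le_mono)
        then have "Lp_le M p (\<lambda>\<omega>. (x t \<omega> - H t J \<omega>) - (x t \<omega> - H t (Suc J) \<omega>)) (c / 2 ^ J + c / 2 ^ J)"
          using p by (intro Lp_le_diff xH) auto
        then have "Lp_le M p (\<lambda>\<omega>. H t (Suc J) \<omega> - H t J \<omega>) (c / 2 ^ J + c / 2 ^ J)"
          by simp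
        from Lp_le_center[OF this] show ?thesis
          using Hi p unfolding keq \<mu>_def by (simp add: algebra_simps)
      qed
      show "(\<integral>\<omega>. k t (?v t (Suc J) \<omega>) \<partial>M) = 0" for t
        unfolding keq using Hi by (simp add: \<mu>_def prob_space)
    qed
    from Lp_le_add[OF _ Suc.IH this] Suc.prems p
    have "Lp_le M p (\<lambda>\<omega>. \<Sum>t\<in>?I. H t (Suc J) \<omega> - \<mu> t (Suc J))
      (B J + 2 * sqrt (C * n * real_of_int (2 ^ Suc J)) * (2 * (c / 2 ^ J + c / 2 ^ J)))"
      unfolding keq by (simp add: sum.distrib[symmetric])
    moreover have "B J + 2 * sqrt (C * n * real_of_int (2 ^ Suc J)) * (2 * (c / 2 ^ J + c / 2 ^ J)) = B (Suc J)"
    proof -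
      have "sqrt (2 ^ J) / 2 ^ J = r ^ J"
      proof -
        have "sqrt (2 ^ J) / 2 ^ J = 1 / sqrt (2 ^ J)" by (simp add: real_div_sqrt field_simps)
        then show ?thesis by (simp add: r_def real_sqrt_power power_one_over)
      qed
      then have "B (Suc J) = B J + 8 * c * sqrt (C * n) * (sqrt 2 * (sqrt (2 ^ J) / 2 ^ J))"
        by (simp add: B_def algebra_simps)
      then show ?thesis by (simp add: real_sqrt_mult mult_ac)
    qed
    ultimately show ?case by simp
  qed
  \<comment> \<open>Telescoping stops at the largest power of two up to n. Each remaining term is
    bounded by 2c/2^J, so the plain triangle inequality costs at most 4c in total; with 56 from the
    telescoped part this makes 60.\<close>
  obtain J where J: "2 ^ J \<le> n" "n < 2 ^ (J + 1)" using ex_power_ivl1[of 2 n] n by auto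
  have rest: "Lp_le M p (\<lambda>\<omega>. \<Sum>t\<in>?I. x t \<omega> - (H t J \<omega> - \<mu> t J)) (\<Sum>t\<in>?I. 2 * (c / 2 ^ J))"
  proof (intro Lp_le_sum)
    fix t
    show "Lp_le M p (\<lambda>\<omega>. x t \<omega> - (H t J \<omega> - \<mu> t J)) (2 * (c / 2 ^ J))"
      using Lp_le_center[OF xH[of t J]] p Hi xi by (simp add: x0 \<mu>_def algebra_simps)
  qed (use p n in auto)
  have "Lp_le M p (\<lambda>\<omega>. \<Sum>t\<in>?I. x t \<omega>) (B J + (\<Sum>t\<in>?I. 2 * (c / 2 ^ J)))"
    using Lp_le_add[OF _ main[OF J(1)] rest] p by (simp add: sum.distrib[symmetric])
  moreover have "B J + (\<Sum>t\<in>?I. 2 * (c / 2 ^ J)) \<le> 60 * sqrt C * c * sqrt n"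
  proof -
    have "(\<Sum>j<J. r ^ j) \<le> 4"
    proof -
      have "(\<Sum>j<J. r ^ j) = (1 - r ^ J) / (1 - r)" using r by (simp add: sum_gp_strict)
      also have "\<dots> \<le> 1 / (1 - r)" using r by (intro divide_right_mono) auto
      also have "\<dots> \<le> 4" using r by (simp add: field_simps)
      finally show ?thesis .
    qed
    moreover have "sqrt (2::real) \<le> 3 / 2" by (rule real_le_lsqrt) (auto simp: power2_eq_square)
    ultimately have "sqrt 2 * (\<Sum>j<J. r ^ j) \<le> 3 / 2 * 4"
      using r by (intro mult_mono) (auto intro: sum_nonneg)
    then have "B J \<le> 8 * c * sqrt (C * n) * (1 + 3 / 2 * 4)"
      unfolding B_def using c C1 by (intro mult_left_mono add_left_mono) auto
    then have 1: "B J \<le> 56 * sqrt C * c * sqrt n" by (simp add: real_sqrt_mult mult_ac)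
    have "real n < 2 ^ (J + 1)" using J(2) by (metis of_nat_less_iff of_nat_numeral of_nat_power)
    then have "real n / 2 ^ J \<le> 2" by (simp add: field_simps)
    then have "2 * c * (real n / 2 ^ J) \<le> 2 * c * 2" using c by (intro mult_left_mono) auto
    then have "(\<Sum>t\<in>?I. 2 * (c / 2 ^ J)) \<le> 4 * c" by (simp add: mult_ac)
    also have "4 * c * 1 \<le> 4 * c * (sqrt C * sqrt n)"
      using c C1 n mult_mono[of 1 "sqrt C" 1 "sqrt n"] by (intro mult_left_mono) auto
    finally show ?thesis using 1 by (simp add: mult_ac)
  qed
  ultimately show ?thesis using p by (auto intro: Lp_le_mono)
qed

subsection \<open>Bernoulli shifts\<close>

lemma measurable_seq:
  assumes "\<And>j. Y j \<in> M \<rightarrow>\<^sub>M S"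
  shows "(\<lambda>\<omega> j. Y j \<omega>) \<in> M \<rightarrow>\<^sub>M PiM UNIV (\<lambda>_. S)"
  using assms measurable_space[OF assms] by (intro measurable_PiM_single') auto

text \<open>Any injective selection of indices produces the same product law. With \<tau> j = t - j
  this is stationarity of the past of the innovations.\<close>

lemma (in prob_space) iid_family_distr_seq:
  fixes X :: "'i \<Rightarrow> 'a \<Rightarrow> 's" and \<tau> :: "nat \<Rightarrow> 'i"
  assumes iid: "iid_family M S X" and \<tau>: "inj \<tau>"
  shows "distr M (PiM UNIV (\<lambda>_. S)) (\<lambda>\<omega> j. X (\<tau> j) \<omega>) = PiM UNIV (\<lambda>_. distr M S (X k))"
proof -
  have ind: "indep_vars (\<lambda>_. S) X UNIV" and eq: "distr M S (X i) = distr M S (X k)" for i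
    using iid by (auto simp: iid_family_def)
  have rv [measurable]: "X i \<in> M \<rightarrow>\<^sub>M S" for i using ind by (auto simp: indep_vars_def)
  interpret D: prob_space "distr M S (X k)" by (rule prob_space_distr) simp
  let ?D = "distr M S (X k)"
  have s: "sets (PiM I (\<lambda>_. S)) = sets (PiM I (\<lambda>_. ?D))" for I :: "'j set"
    by (intro sets_PiM_cong) auto
  have "(\<lambda>i. distr M S (X i)) = (\<lambda>_. ?D)" using eq by (intro ext)
  then have 1: "distr M (PiM UNIV (\<lambda>_. S)) (\<lambda>\<omega> i. X i \<omega>) = PiM UNIV (\<lambda>_. ?D)"
    using indep_vars_iff_distr_eq_PiM[of UNIV X "\<lambda>_. S", OF _ rv] ind by (simp add: restrict_def)
  have "PiM UNIV (\<lambda>_. ?D) = distr (PiM UNIV (\<lambda>_. ?D)) (PiM UNIV (\<lambda>_. ?D)) (\<lambda>\<omega> n. \<omega> (\<tau> n))"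
    using distr_PiM_reindex[of UNIV "\<lambda>_. ?D" \<tau> UNIV] \<tau> D.prob_space_axioms by (simp add: restrict_def)
  also have "\<dots> = distr (distr M (PiM UNIV (\<lambda>_. S)) (\<lambda>\<omega> i. X i \<omega>)) (PiM UNIV (\<lambda>_. S)) (\<lambda>\<omega> n. \<omega> (\<tau> n))"
    unfolding 1 by (intro distr_cong) (auto simp: s)
  also have "\<dots> = distr M (PiM UNIV (\<lambda>_. S)) (\<lambda>\<omega> j. X (\<tau> j) \<omega>)"
    by (subst distr_distr) (auto simp: comp_def intro!: measurable_seq measurable_component_singleton)
  finally show ?thesis ..
qed

section \<open>Joint laws from independent \<sigma>-algebras\<close>

lemma space_generated_algebra [simp]: "space (generated_algebra M S X I) = space M"
  unfolding generated_algebra_def by (rule space_measure_of) auto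

lemma measurable_generated_algebra:
  assumes "X i \<in> M \<rightarrow>\<^sub>M S" "i \<in> I"
  shows "X i \<in> generated_algebra M S X I \<rightarrow>\<^sub>M S"
proof (rule measurableI)
  fix A assume "A \<in> sets S"
  then have "X i -` A \<inter> space M \<in> {X i -` A \<inter> space M | i A. i \<in> I \<and> A \<in> sets S}" using assms(2) by auto
  then have "X i -` A \<inter> space M \<in> sets (generated_algebra M S X I)"
    unfolding generated_algebra_def by (subst sets_measure_of) auto
  then show "X i -` A \<inter> space (generated_algebra M S X I) \<in> sets (generated_algebra M S X I)" by simp
qed (use measurable_space[OF assms(1)] in auto)

text \<open>Two rectangles have independent preimages, and this determines the joint law. The target
  spaces are arbitrary, so that below one component can be the identity map into a
  sub-\<sigma>-algebra.\<close>

lemma (in prob_space) distr_pair_indep_set: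
  assumes X [measurable]: "X \<in> M \<rightarrow>\<^sub>M N" and Y [measurable]: "Y \<in> M \<rightarrow>\<^sub>M L" and ind: "indep_set F G"
    and F: "\<And>A. A \<in> sets N \<Longrightarrow> X -` A \<inter> space M \<in> F" and G: "\<And>A. A \<in> sets L \<Longrightarrow> Y -` A \<inter> space M \<in> G"
  shows "distr M (N \<Otimes>\<^sub>M L) (\<lambda>\<omega>. (X \<omega>, Y \<omega>)) = distr M N X \<Otimes>\<^sub>M distr M L Y"
proof (rule pair_measure_eqI[symmetric])
  interpret N: prob_space "distr M N X" by (rule prob_space_distr) simp
  interpret L: prob_space "distr M L Y" by (rule prob_space_distr) simp
  show "sigma_finite_measure (distr M N X)" "sigma_finite_measure (distr M L Y)" by unfold_locales
  show "sets (distr M N X \<Otimes>\<^sub>M distr M L Y) = sets (distr M (N \<Otimes>\<^sub>M L) (\<lambda>\<omega>. (X \<omega>, Y \<omega>)))"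
    by (simp cong: sets_pair_measure_cong)
  fix A B assume "A \<in> sets (distr M N X)" "B \<in> sets (distr M L Y)"
  then have AB: "A \<in> sets N" "B \<in> sets L" by auto
  have "(\<lambda>\<omega>. (X \<omega>, Y \<omega>)) -` (A \<times> B) \<inter> space M = (X -` A \<inter> space M) \<inter> (Y -` B \<inter> space M)" by auto
  then show "emeasure (distr M N X) A * emeasure (distr M L Y) B
      = emeasure (distr M (N \<Otimes>\<^sub>M L) (\<lambda>\<omega>. (X \<omega>, Y \<omega>))) (A \<times> B)"
    using AB indep_setD[OF ind F[OF AB(1)] G[OF AB(2)]]
    by (simp add: emeasure_distr emeasure_eq_measure ennreal_mult[symmetric])
qed

lemma (in prob_space) independent_copies_distr_pair:
  fixes \<eta> :: "int \<Rightarrow> 'a \<Rightarrow> 's" and \<eta>s :: "int \<times> int \<times> int \<Rightarrow> 'a \<Rightarrow> 's"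
  assumes iid: "iid_family M S \<eta>" and cop: "independent_copies M S \<eta> \<eta>s" and "inj \<tau>" "inj \<sigma>"
  defines "P \<equiv> PiM (UNIV :: nat set) (\<lambda>_. distr M S (\<eta> 0))"
  shows "distr M (PiM UNIV (\<lambda>_. S) \<Otimes>\<^sub>M PiM UNIV (\<lambda>_. S)) (\<lambda>\<omega>. (\<lambda>j. \<eta> (\<tau> j) \<omega>, \<lambda>j. \<eta>s (\<sigma> j) \<omega>)) = P \<Otimes>\<^sub>M P"
proof -
  have iids: "iid_family M S \<eta>s" and eq: "distr M S (\<eta>s (\<sigma> 0)) = distr M S (\<eta> 0)"
    and ind: "indep_set (sets (generated_algebra M S \<eta> UNIV)) (sets (generated_algebra M S \<eta>s UNIV))"
    using cop unfolding independent_copies_def by blast+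
  have rv: "\<eta> i \<in> M \<rightarrow>\<^sub>M S" "\<eta>s k \<in> M \<rightarrow>\<^sub>M S" for i k
    using iid iids unfolding iid_family_def indep_vars_def by blast+
  let ?E = "\<lambda>\<omega> j. \<eta> (\<tau> j) \<omega>" and ?Z = "\<lambda>\<omega> j. \<eta>s (\<sigma> j) \<omega>" and ?S = "PiM (UNIV :: nat set) (\<lambda>_. S)"
  have E: "?E \<in> M \<rightarrow>\<^sub>M ?S" and Z: "?Z \<in> M \<rightarrow>\<^sub>M ?S" by (intro measurable_seq rv)+
  have "distr M (?S \<Otimes>\<^sub>M ?S) (\<lambda>\<omega>. (?E \<omega>, ?Z \<omega>)) = distr M ?S ?E \<Otimes>\<^sub>M distr M ?S ?Z"
  proof (rule distr_pair_indep_set[OF E Z ind])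
    show "?E -` A \<inter> space M \<in> sets (generated_algebra M S \<eta> UNIV)" if "A \<in> sets ?S" for A
      using measurable_sets[OF measurable_seq[OF measurable_generated_algebra[OF rv(1) UNIV_I]] that] by simp
    show "?Z -` A \<inter> space M \<in> sets (generated_algebra M S \<eta>s UNIV)" if "A \<in> sets ?S" for A
      using measurable_sets[OF measurable_seq[OF measurable_generated_algebra[OF rv(2) UNIV_I]] that] by simp
  qed
  moreover have "distr M ?S ?E = P" "distr M ?S ?Z = P"
    unfolding P_def using iid_family_distr_seq[OF iid \<open>inj \<tau>\<close>] iid_family_distr_seq[OF iids \<open>inj \<sigma>\<close>, of "\<sigma> 0"] eq
    by auto
  ultimately show ?thesis by simp
qed

text \<open>Every \<open>m t\<close> is the same function g of a sequence whose law does not depend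
  on t. This carries moments at time 0 to all times.\<close>

lemma (in prob_space) bernoulli_shift_distr_eq:
  assumes sh: "decomposable_bernoulli_shift M S \<eta> \<nu> c a m"
  shows "m t \<in> borel_measurable M" and "distr M borel (m t) = distr M borel (m t')"
proof -
  obtain g \<eta>s where g [measurable]: "g \<in> (\<Pi>\<^sub>M j\<in>(UNIV :: nat set). S) \<rightarrow>\<^sub>M borel"
    and m: "\<And>t \<omega>. \<omega> \<in> space M \<Longrightarrow> m t \<omega> = g (\<lambda>j. \<eta> (t - int j) \<omega>)" and iid: "iid_family M S \<eta>"
    using sh unfolding decomposable_bernoulli_shift_def by blast
  have rv: "\<eta> i \<in> M \<rightarrow>\<^sub>M S" for i using iid by (auto simp: iid_family_def indep_vars_def)
  have E [measurable]: "(\<lambda>\<omega> j. \<eta> (t - int j) \<omega>) \<in> M \<rightarrow>\<^sub>M (\<Pi>\<^sub>M j\<in>(UNIV :: nat set). S)" for t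
    by (intro measurable_seq rv)
  show meas: "m t \<in> borel_measurable M" for t
    using measurable_compose[OF E g] by (subst measurable_cong[OF m]) auto
  have inj: "inj (\<lambda>j::nat. t - int j)" for t by (auto simp: inj_on_def)
  have "distr M borel (m t) = distr (PiM (UNIV::nat set) (\<lambda>_. distr M S (\<eta> 0))) borel g" for t
  proof -
    have "distr M borel (m t) = distr M borel (\<lambda>\<omega>. g (\<lambda>j. \<eta> (t - int j) \<omega>))"
      by (intro distr_cong) (auto simp: m)
    also have "\<dots> = distr (distr M (PiM UNIV (\<lambda>_. S)) (\<lambda>\<omega> j. \<eta> (t - int j) \<omega>)) borel g"
      by (subst distr_distr) (auto simp: comp_def)
    finally show ?thesis by (simp only: iid_family_distr_seq[OF iid inj, where k = 0])
  qed
  then show "distr M borel (m t) = distr M borel (m t')" by simp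
qed

section \<open>Window approximation of a Bernoulli shift\<close>

lemma norm_diff_powr_le:
  fixes x y :: "'b::real_normed_vector"
  assumes "\<nu> \<ge> 0"
  shows "norm (x - y) powr \<nu> \<le> 2 powr \<nu> * (norm x powr \<nu> + norm y powr \<nu>)"
proof -
  have "norm (x - y) \<le> 2 * max (norm x) (norm y)" using norm_triangle_ineq4[of x y] by linarith
  then have "norm (x - y) powr \<nu> \<le> (2 * max (norm x) (norm y)) powr \<nu>" using assms by (intro powr_mono2) auto
  also have "\<dots> = 2 powr \<nu> * max (norm x) (norm y) powr \<nu>" by (simp add: powr_mult)
  also have "\<dots> \<le> 2 powr \<nu> * (norm x powr \<nu> + norm y powr \<nu>)" by (intro mult_left_mono) (auto simp: max_def)
  finally show ?thesis .
qed

lemma L_norm_leD: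
  assumes "L_norm M \<nu> X \<le> K" "\<nu> > 0"
  shows "(\<integral>\<omega>. norm (X \<omega>) powr \<nu> \<partial>M) \<le> K powr \<nu>"
proof -
  have "(\<integral>\<omega>. norm (X \<omega>) powr \<nu> \<partial>M) = L_norm M \<nu> X powr \<nu>"
    using assms(2) by (simp add: L_norm_def powr_powr)
  also have "\<dots> \<le> K powr \<nu>" using assms by (intro powr_mono2) (auto simp: L_norm_def)
  finally show ?thesis .
qed

text \<open>
  By Fubini's theorem, the independent copies in the coupled process can be frozen at a value for
  which the coupling bound survives; this leaves a function of the last \<open>l\<close> innovations only.
\<close>
lemma (in prob_space) bernoulli_shift_window:
  fixes m :: "int \<Rightarrow> 'a \<Rightarrow> 'b::euclidean_space"
  assumes sh: "decomposable_bernoulli_shift M S \<eta> \<nu> c a m" and \<nu>: "\<nu> > 0" and l: "l \<ge> 1"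
  shows "\<exists>h \<in> PiM {t - l<..t} (\<lambda>_. S) \<rightarrow>\<^sub>M borel.
    integrable M (\<lambda>\<omega>. norm (m t \<omega> - h (window \<eta> t l \<omega>)) powr \<nu>) \<and>
    (\<integral>\<omega>. norm (m t \<omega> - h (window \<eta> t l \<omega>)) powr \<nu> \<partial>M) \<le> (c * real_of_int l powr (- a)) powr \<nu>"
proof -
  let ?K = "(c * real_of_int l powr (- a)) powr \<nu>"
  let ?S = "\<Pi>\<^sub>M j\<in>(UNIV :: nat set). S"
  obtain g \<eta>s where g [measurable]: "g \<in> ?S \<rightarrow>\<^sub>M borel"
    and m: "\<And>t \<omega>. \<omega> \<in> space M \<Longrightarrow> m t \<omega> = g (\<lambda>j. \<eta> (t - int j) \<omega>)" and iid: "iid_family M S \<eta>"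
    and mi: "\<And>t. integrable M (\<lambda>\<omega>. norm (m t \<omega>) powr \<nu>)" and cop: "independent_copies M S \<eta> \<eta>s"
    and L: "\<And>t l. l \<ge> 1 \<Longrightarrow> L_norm M \<nu> (\<lambda>\<omega>. m t \<omega> - coupled g \<eta> \<eta>s t l \<omega>) \<le> c * real_of_int l powr (- a)"
    using sh unfolding decomposable_bernoulli_shift_def by blast
  have rv: "\<eta> i \<in> M \<rightarrow>\<^sub>M S" "\<eta>s k \<in> M \<rightarrow>\<^sub>M S" for i k
    using iid cop unfolding iid_family_def indep_vars_def independent_copies_def by blast+
  define n where "n = nat l"
  define E where "E = (\<lambda>\<omega> j. \<eta> (t - int j) \<omega>)"
  \<comment> \<open>\<open>comb_seq n\<close> reads its second argument from index 0 once the first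
    n entries are used up, hence the start at time \<open>t - l\<close>.\<close>
  define Z where "Z = (\<lambda>\<omega> j. \<eta>s (t - l - int j, t, l) \<omega>)"
  have EZ [measurable]: "E \<in> M \<rightarrow>\<^sub>M ?S" "Z \<in> M \<rightarrow>\<^sub>M ?S"
    unfolding E_def Z_def by (intro measurable_seq rv)+
  have coup: "coupled g \<eta> \<eta>s t l \<omega> = g (comb_seq n (E \<omega>) (Z \<omega>))" for \<omega>
  proof -
    have "(\<lambda>j. if int j < l then \<eta> (t - int j) \<omega> else \<eta>s (t - int j, t, l) \<omega>) = comb_seq n (E \<omega>) (Z \<omega>)"
      using l by (auto simp: comb_seq_def E_def Z_def n_def fun_eq_iff of_nat_diff nat_le_iff)
    then show ?thesis by (simp add: coupled_def)
  qed
  define D where "D = distr M S (\<eta> 0)"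
  have D: "prob_space D" unfolding D_def by (rule prob_space_distr) (rule rv)
  define P where "P = PiM (UNIV :: nat set) (\<lambda>_. D)"
  interpret SD: sequence_space D by (simp add: sequence_space_def product_prob_space_def product_prob_space_axioms_def
        product_sigma_finite_def D prob_space_imp_sigma_finite)
  interpret P: prob_space P unfolding P_def by (rule prob_space_PiM) (rule D)
  interpret PP: pair_sigma_finite P P by (rule pair_sigma_finite.intro) (rule P.sigma_finite_measure_axioms)+
  have setsP [measurable_cong]: "sets P = sets ?S" unfolding P_def D_def by (intro sets_PiM_cong) auto
  have inj: "inj (\<lambda>j::nat. t - int j)" "inj (\<lambda>j::nat. (t - l - int j, t, l))" by (auto simp: inj_on_def)
  have joint: "distr M (?S \<Otimes>\<^sub>M ?S) (\<lambda>\<omega>. (E \<omega>, Z \<omega>)) = P \<Otimes>\<^sub>M P"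
    using independent_copies_distr_pair[OF iid cop inj] unfolding E_def Z_def P_def D_def .
  have dE: "distr M ?S E = P"
    unfolding E_def P_def D_def by (rule iid_family_distr_seq[OF iid inj(1)])
  have comb [measurable]: "(\<lambda>(e, z). comb_seq n e z) \<in> ?S \<Otimes>\<^sub>M ?S \<rightarrow>\<^sub>M ?S"
    by (rule measurable_comb_seq)
  \<comment> \<open>Replacing the remote past by a copy leaves the law unchanged, so the coupled
    variable has a moment of order \<nu>. This makes the difference integrable, which is what turns
    the bound on \<open>L_norm\<close> into a genuine one.\<close>
  have dC: "distr M ?S (\<lambda>\<omega>. comb_seq n (E \<omega>) (Z \<omega>)) = P"
  proof -
    have "distr M ?S (\<lambda>\<omega>. comb_seq n (E \<omega>) (Z \<omega>)) = distr (P \<Otimes>\<^sub>M P) ?S (\<lambda>(e, z). comb_seq n e z)"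
      unfolding joint[symmetric] by (subst distr_distr) (auto simp: comp_def)
    also have "\<dots> = distr (P \<Otimes>\<^sub>M P) P (\<lambda>(e, z). comb_seq n e z)"
      by (rule distr_cong) (auto simp: setsP)
    also have "\<dots> = P" unfolding P_def by (rule SD.PiM_comb_seq)
    finally show ?thesis .
  qed
  have gi: "integrable P (\<lambda>e. norm (g e) powr \<nu>)"
  proof -
    have "integrable M (\<lambda>\<omega>. norm (g (E \<omega>)) powr \<nu>)"
      using mi[of t] by (subst (asm) Bochner_Integration.integrable_cong[OF refl, of M _ "\<lambda>\<omega>. norm (g (E \<omega>)) powr \<nu>"]) (auto simp: m E_def)
    then show ?thesis unfolding dE[symmetric] by (subst integrable_distr_eq) auto
  qed
  have ci: "integrable M (\<lambda>\<omega>. norm (g (comb_seq n (E \<omega>) (Z \<omega>))) powr \<nu>)"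
    using gi unfolding dC[symmetric] by (subst (asm) integrable_distr_eq) auto
  have [measurable]: "m t \<in> borel_measurable M" by (rule bernoulli_shift_distr_eq[OF sh])
  let ?\<Phi> = "\<lambda>e z. norm (g e - g (comb_seq n e z)) powr \<nu>"
  have \<Phi>i: "integrable M (\<lambda>\<omega>. ?\<Phi> (E \<omega>) (Z \<omega>))"
  proof (rule Bochner_Integration.integrable_bound)
    show "integrable M (\<lambda>\<omega>. 2 powr \<nu> * (norm (m t \<omega>) powr \<nu> + norm (g (comb_seq n (E \<omega>) (Z \<omega>))) powr \<nu>))"
      using mi ci by auto
    show "AE \<omega> in M. norm (?\<Phi> (E \<omega>) (Z \<omega>)) \<le>
        norm (2 powr \<nu> * (norm (m t \<omega>) powr \<nu> + norm (g (comb_seq n (E \<omega>) (Z \<omega>))) powr \<nu>))"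
      using \<nu> norm_diff_powr_le[of \<nu>] by (intro AE_I2) (simp add: m E_def)
  qed measurable
  have "(\<integral>\<omega>. ?\<Phi> (E \<omega>) (Z \<omega>) \<partial>M) = (\<integral>\<omega>. norm (m t \<omega> - coupled g \<eta> \<eta>s t l \<omega>) powr \<nu> \<partial>M)"
    by (intro Bochner_Integration.integral_cong) (auto simp: m coup E_def)
  also have "\<dots> \<le> ?K" using L_norm_leD[OF L[OF l] \<nu>] .
  finally have "(\<integral>\<^sup>+\<omega>. ennreal (?\<Phi> (E \<omega>) (Z \<omega>)) \<partial>M) \<le> ennreal ?K"
    using \<Phi>i by (subst nn_integral_eq_integral) (auto intro: ennreal_leI)
  moreover have "(\<integral>\<^sup>+\<omega>. ennreal (?\<Phi> (E \<omega>) (Z \<omega>)) \<partial>M) = (\<integral>\<^sup>+z. (\<integral>\<^sup>+e. ennreal (?\<Phi> e z) \<partial>P) \<partial>P)"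
  proof -
    have "(\<integral>\<^sup>+z. (\<integral>\<^sup>+e. ennreal (?\<Phi> e z) \<partial>P) \<partial>P) = (\<integral>\<^sup>+q. ennreal (?\<Phi> (fst q) (snd q)) \<partial>(P \<Otimes>\<^sub>M P))"
      by (subst PP.nn_integral_snd[symmetric]) (auto simp: case_prod_beta)
    also have "\<dots> = (\<integral>\<^sup>+\<omega>. ennreal (?\<Phi> (E \<omega>) (Z \<omega>)) \<partial>M)"
      unfolding joint[symmetric] by (subst nn_integral_distr) auto
    finally show ?thesis ..
  qed
  ultimately have le: "(\<integral>\<^sup>+z. (\<integral>\<^sup>+e. ennreal (?\<Phi> e z) \<partial>P) \<partial>P) \<le> ennreal ?K" by simp
  \<comment> \<open>The average over z is at most \<open>?K\<close>, so the inner integral cannot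
    exceed \<open>?K\<close> for every z.\<close>
  have "\<exists>z\<in>space P. (\<integral>\<^sup>+e. ennreal (?\<Phi> e z) \<partial>P) \<le> ennreal ?K"
  proof (rule ccontr)
    assume "\<not> ?thesis"
    then have gt: "ennreal ?K < (\<integral>\<^sup>+e. ennreal (?\<Phi> e z) \<partial>P)" if "z \<in> space P" for z
      using that by (auto simp: not_le)
    have "(\<integral>\<^sup>+z. ennreal ?K \<partial>P) < (\<integral>\<^sup>+z. (\<integral>\<^sup>+e. ennreal (?\<Phi> e z) \<partial>P) \<partial>P)"
    proof (rule nn_integral_less)
      show "(\<integral>\<^sup>+z. ennreal ?K \<partial>P) \<noteq> \<infinity>" by (simp add: P.emeasure_space_1)
      show "AE z in P. ennreal ?K \<le> (\<integral>\<^sup>+e. ennreal (?\<Phi> e z) \<partial>P)"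
        using gt by (intro AE_I2) (auto intro: less_imp_le)
      show "\<not> (AE z in P. (\<integral>\<^sup>+e. ennreal (?\<Phi> e z) \<partial>P) \<le> ennreal ?K)"
      proof
        assume "AE z in P. (\<integral>\<^sup>+e. ennreal (?\<Phi> e z) \<partial>P) \<le> ennreal ?K"
        then have "AE z in P. False" using AE_space by eventually_elim (use gt in \<open>auto simp: not_le[symmetric]\<close>)
        then show False by (simp add: P.AE_False)
      qed
    qed measurable
    then show False using le by (simp add: P.emeasure_space_1)
  qed
  then obtain z where z: "z \<in> space P" "(\<integral>\<^sup>+e. ennreal (?\<Phi> e z) \<partial>P) \<le> ennreal ?K" by blast
  have spP: "space P = (\<Pi>\<^sub>E j\<in>UNIV. space S)"
    by (simp add: P_def D_def space_PiM)
  have zm: "(\<lambda>_. z) \<in> M \<rightarrow>\<^sub>M ?S" using z(1) by (simp add: spP space_PiM)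
  define h where "h = (\<lambda>v. g (comb_seq n (\<lambda>j. v (t - int j)) z))"
  have h: "h \<in> PiM {t - l<..t} (\<lambda>_. S) \<rightarrow>\<^sub>M borel"
  proof -
    have "(\<lambda>v. comb_seq n (\<lambda>j. v (t - int j)) z) \<in> PiM {t - l<..t} (\<lambda>_. S) \<rightarrow>\<^sub>M ?S"
    proof (rule measurable_PiM_single')
      fix j :: nat
      show "(\<lambda>v. comb_seq n (\<lambda>j. v (t - int j)) z j) \<in> PiM {t - l<..t} (\<lambda>_. S) \<rightarrow>\<^sub>M S"
      proof (cases "j < n")
        case True
        then have "t - int j \<in> {t - l<..t}" by (auto simp: n_def)
        then show ?thesis using True by (simp add: comb_seq_def)
      next
        case False
        then show ?thesis using z(1) by (auto simp: comb_seq_def spP PiE_iff)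
      qed
    next
      show "(\<lambda>v j. comb_seq n (\<lambda>j. v (t - int j)) z j) \<in> space (PiM {t - l<..t} (\<lambda>_. S)) \<rightarrow> (\<Pi>\<^sub>E i\<in>UNIV. space S)"
        using z(1) by (auto simp: comb_seq_def spP PiE_iff space_PiM n_def)
    qed
    from measurable_compose[OF this g] show ?thesis by (simp add: h_def)
  qed
  have hE: "h (window \<eta> t l \<omega>) = g (comb_seq n (E \<omega>) z)" for \<omega>
  proof -
    have "comb_seq n (\<lambda>j. (window \<eta> t l \<omega>) (t - int j)) z = comb_seq n (E \<omega>) z"
      by (auto simp: comb_seq_def fun_eq_iff E_def n_def)
    then show ?thesis by (simp add: h_def)
  qed
  have [measurable]: "(\<lambda>\<omega>. h (window \<eta> t l \<omega>)) \<in> borel_measurable M"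
    using rv h by (intro measurable_compose[OF _ h] measurable_restrict) auto
  have "(\<integral>\<^sup>+\<omega>. ennreal (norm (m t \<omega> - h (window \<eta> t l \<omega>)) powr \<nu>) \<partial>M) = (\<integral>\<^sup>+\<omega>. ennreal (?\<Phi> (E \<omega>) z) \<partial>M)"
    unfolding hE by (intro nn_integral_cong) (auto simp: m E_def)
  also have "\<dots> = (\<integral>\<^sup>+e. ennreal (?\<Phi> e z) \<partial>P)"
  proof -
    have "(\<lambda>e. comb_seq n e z) \<in> ?S \<rightarrow>\<^sub>M ?S"
      using measurable_compose[OF measurable_Pair[OF measurable_ident_sets[OF refl] measurable_const] comb] z(1)
      by (simp add: spP space_PiM)
    then show ?thesis unfolding dE[symmetric] by (subst nn_integral_distr) auto
  qed
  finally have fin: "(\<integral>\<^sup>+\<omega>. ennreal (norm (m t \<omega> - h (window \<eta> t l \<omega>)) powr \<nu>) \<partial>M) \<le> ennreal ?K"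
    using z(2) by simp
  have "integrable M (\<lambda>\<omega>. norm (m t \<omega> - h (window \<eta> t l \<omega>)) powr \<nu>)"
    using fin by (intro integrableI_bounded) (auto simp: le_less_trans[OF _ ennreal_less_top])
  moreover from this have "(\<integral>\<omega>. norm (m t \<omega> - h (window \<eta> t l \<omega>)) powr \<nu> \<partial>M) \<le> ?K"
    using fin by (subst (asm) nn_integral_eq_integral) auto
  ultimately show ?thesis using h by blast
qed

text \<open>\<open>\<phi>\<close> will be the identity for the errors and a coordinate for the
  factors. By stationarity the moment bound at time 0 suffices, and B is a parameter so that one
  value can serve all errors.\<close>

lemma (in prob_space) approximable_bernoulli_shift:
  fixes m :: "int \<Rightarrow> 'a \<Rightarrow> 'b::euclidean_space" and \<phi> :: "'b \<Rightarrow> real"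
  assumes sh: "decomposable_bernoulli_shift M S \<eta> \<nu> c a m" and \<nu>: "\<nu> > 0"
    and B: "L_norm M \<nu> (m 0) \<le> B" "B > 0"
    and [measurable]: "\<phi> \<in> borel_measurable borel"
    and \<phi>: "\<And>v w. \<phi> (v - w) = \<phi> v - \<phi> w" "\<And>v. \<bar>\<phi> v\<bar> \<le> norm v"
  shows "approximable M S \<eta> \<nu> (max c B) a (\<lambda>t \<omega>. \<phi> (m t \<omega>))"
  unfolding approximable_def
proof (intro conjI allI impI)
  have c: "c > 0" using sh by (simp add: decomposable_bernoulli_shift_def)
  have mm [measurable]: "m t \<in> borel_measurable M" for t by (rule bernoulli_shift_distr_eq[OF sh])
  have mi: "integrable M (\<lambda>\<omega>. norm (m t \<omega>) powr \<nu>)" for t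
    using sh by (auto simp: decomposable_bernoulli_shift_def)
  fix t
  have "Lp_le M \<nu> (\<lambda>\<omega>. \<phi> (m t \<omega>)) B"
  proof (rule Lp_leI)
    have "(\<integral>\<omega>. norm (m t \<omega>) powr \<nu> \<partial>M) = (\<integral>x. norm x powr \<nu> \<partial>distr M borel (m t))"
      by (subst integral_distr) auto
    also have "\<dots> = (\<integral>x. norm x powr \<nu> \<partial>distr M borel (m 0))"
      by (simp only: bernoulli_shift_distr_eq(2)[OF sh, of t 0])
    also have "\<dots> = (\<integral>\<omega>. norm (m 0 \<omega>) powr \<nu> \<partial>M)" by (subst integral_distr) auto
    also have "\<dots> \<le> B powr \<nu>" by (rule L_norm_leD[OF B(1) \<nu>])
    finally show "(\<integral>\<omega>. norm (m t \<omega>) powr \<nu> \<partial>M) \<le> B powr \<nu>" .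
    show "\<bar>\<phi> (m t \<omega>)\<bar> powr \<nu> \<le> norm (m t \<omega>) powr \<nu>" for \<omega>
      using \<phi>(2) \<nu> by (intro powr_mono2) auto
  qed (use B mi in auto)
  then show "Lp_le M \<nu> (\<lambda>\<omega>. \<phi> (m t \<omega>)) (max c B)" using \<nu> by (auto intro: Lp_le_mono)
  fix l :: int assume l: "l \<ge> 1"
  obtain h where h: "h \<in> PiM {t - l<..t} (\<lambda>_. S) \<rightarrow>\<^sub>M borel"
    "integrable M (\<lambda>\<omega>. norm (m t \<omega> - h (window \<eta> t l \<omega>)) powr \<nu>)"
    "(\<integral>\<omega>. norm (m t \<omega> - h (window \<eta> t l \<omega>)) powr \<nu> \<partial>M) \<le> (c * real_of_int l powr (- a)) powr \<nu>"
    using bernoulli_shift_window[OF sh \<nu> l, of t] by blast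
  have rv: "\<eta> i \<in> M \<rightarrow>\<^sub>M S" for i
    using sh by (auto simp: decomposable_bernoulli_shift_def iid_family_def indep_vars_def)
  have [measurable]: "(\<lambda>\<omega>. h (window \<eta> t l \<omega>)) \<in> borel_measurable M"
    using rv by (intro measurable_compose[OF _ h(1)] measurable_restrict) auto
  have "Lp_le M \<nu> (\<lambda>\<omega>. \<phi> (m t \<omega>) - \<phi> (h (window \<eta> t l \<omega>))) (c * real_of_int l powr (- a))"
  proof (rule Lp_leI[OF _ _ h(2) _ h(3)])
    show "c * real_of_int l powr (- a) > 0" using c l by simp
    show "\<bar>\<phi> (m t \<omega>) - \<phi> (h (window \<eta> t l \<omega>))\<bar> powr \<nu>
        \<le> norm (m t \<omega> - h (window \<eta> t l \<omega>)) powr \<nu>" for \<omega>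
      using \<phi>(2)[of "m t \<omega> - h (window \<eta> t l \<omega>)"] \<nu> by (intro powr_mono2) (auto simp: \<phi>(1))
  qed measurable
  then have "Lp_le M \<nu> (\<lambda>\<omega>. \<phi> (m t \<omega>) - \<phi> (h (window \<eta> t l \<omega>))) (max c B * real_of_int l powr (- a))"
    using \<nu> by (elim Lp_le_mono) (auto intro!: mult_right_mono)
  then show "\<exists>h \<in> PiM {t - l<..t} (\<lambda>_. S) \<rightarrow>\<^sub>M borel.
        Lp_le M \<nu> (\<lambda>\<omega>. \<phi> (m t \<omega>) - h (window \<eta> t l \<omega>)) (max c B * real_of_int l powr (- a))"
    using h(1) by (intro bexI[where x = "\<lambda>v. \<phi> (h v)"]) auto
qed

subsection \<open>A uniform law of large numbers with rate\<close>

text \<open>Clearing the binary digits of T from the lowest upwards leads from T down to 0 or 2^k.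
  Clearing a digit changes s by one dyadic block or by nothing, and a last block of length 2^k may
  remain: at most k + 1 blocks.\<close>

lemma dyadic_chaining:
  fixes s :: "nat \<Rightarrow> real" and \<theta> :: real
  assumes s0: "s 0 = 0"
    and step: "\<And>j b. j \<le> k \<Longrightarrow> (b + 1) * 2 ^ j \<le> 2 ^ k \<Longrightarrow> \<bar>s ((b + 1) * 2 ^ j) - s (b * 2 ^ j)\<bar> \<le> \<theta>"
    and T: "T \<le> 2 ^ k"
  shows "\<bar>s T\<bar> \<le> (real k + 1) * \<theta>"
proof -
  have \<theta>: "\<theta> \<ge> 0" using step[of k 0] by simp
  have approx: "\<bar>s T - s (T div 2 ^ j * 2 ^ j)\<bar> \<le> real j * \<theta>" if "j \<le> k" for j
    using that
  proof (induction j)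
    case (Suc j)
    define q where "q = T div 2 ^ j"
    have q2: "T div 2 ^ Suc j = q div 2" by (simp only: q_def power_Suc2 div_mult2_eq)
    have qT: "q * 2 ^ j \<le> T" by (simp add: q_def)
    have "\<bar>s (q * 2 ^ j) - s (q div 2 * 2 ^ Suc j)\<bar> \<le> \<theta>"
    \<comment> \<open>The parity of q is the j-th binary digit of T; only an odd q leaves a block to
      be crossed.\<close>
    proof (cases "even q")
      case True
      then have "q div 2 * 2 ^ Suc j = q * 2 ^ j" by auto
      then show ?thesis using \<theta> by (simp only: diff_self abs_zero)
    next
      case False
      then obtain b where b: "q = 2 * b + 1" by (auto elim: oddE)
      have "q div 2 * 2 ^ Suc j = (2 * b) * 2 ^ j" using b by simp
      moreover have "(2 * b + 1) * 2 ^ j \<le> 2 ^ k" using qT T b by (metis order.trans)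
      ultimately show ?thesis using step[of j "2 * b"] Suc.prems b by (simp only: Suc_leD)
    qed
    moreover have "\<bar>s T - s (q * 2 ^ j)\<bar> \<le> real j * \<theta>" using Suc by (simp add: q_def)
    ultimately have "\<bar>s T - s (q div 2 * 2 ^ Suc j)\<bar> \<le> real j * \<theta> + \<theta>" by linarith
    then show ?case by (simp only: q2) (simp add: algebra_simps)
  qed simp
  have "\<bar>s (T div 2 ^ k * 2 ^ k)\<bar> \<le> \<theta>"
  proof (cases "T = 2 ^ k")
    case True
    then show ?thesis using step[of k 0] s0 by simp
  next
    case False
    then show ?thesis using T s0 \<theta> by simp
  qed
  with approx[of k] show ?thesis by (simp add: algebra_simps)
qed

text \<open>The bad event at stage k is that a dyadic block inside (0, 2^k] of one of the first
  2^(k\<gamma>) series exceeds 2^(k\<theta>). For blocks of length 2^j Markov's inequality gives the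
  order 2^(jp/2 - kp\<theta>), and there are 2^(k-j) of them. Since p \<ge> 2, no level j costs more
  than the level j = k, so stage k costs a multiple of (k + 1) r^k.\<close>

lemma (in prob_space) AE_partial_sums_dyadic:
  fixes x :: "nat \<Rightarrow> int \<Rightarrow> 'a \<Rightarrow> real" and p \<gamma> \<theta> :: real
  assumes p: "p \<ge> 2" and \<gamma>: "\<gamma> \<ge> 0" "\<gamma> + p / 2 < p * \<theta>"
    and L: "\<And>i s n. i \<ge> 1 \<Longrightarrow> n \<ge> 1 \<Longrightarrow> Lp_le M p (\<lambda>\<omega>. \<Sum>t\<in>{s<..s + int n}. x i t \<omega>) (D * sqrt (real n))"
  shows "AE \<omega> in M. \<forall>\<^sub>F k in sequentially. \<forall>i\<ge>1. real i \<le> 2 powr (k * \<gamma>) \<longrightarrow>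
    (\<forall>T\<le>2 ^ k. \<bar>\<Sum>t = 1..int T. x i t \<omega>\<bar> \<le> (real k + 1) * 2 powr (k * \<theta>))"
proof -
  have D: "D > 0" using Lp_leD(1)[OF L[of 1 1]] by simp
  let ?S = "\<lambda>i j b \<omega>. \<Sum>t\<in>{int (b * 2 ^ j)<..int (b * 2 ^ j) + int (2 ^ j)}. x i t \<omega>"
  define N where "N = (\<lambda>k::nat. nat \<lfloor>2 powr (k * \<gamma>)\<rfloor>)"
  define E where "E = (\<lambda>k i j b. {\<omega> \<in> space M. \<bar>?S i j b \<omega>\<bar> > 2 powr (real k * \<theta>)})"
  define A where "A = (\<lambda>k. \<Union>i\<in>{1..N k}. \<Union>j\<in>{..k}. \<Union>b\<in>{..<2 ^ (k - j)}. E k i j b)"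
  \<comment> \<open>The hypothesis relating \<gamma>, p and \<theta> says precisely that r <
    1.\<close>
  define r where "r = 2 powr (\<gamma> + p / 2 - p * \<theta>)"
  have r: "0 < r" "r < 1" using \<gamma> powr_less_mono[of "\<gamma> + p / 2 - p * \<theta>" 0 2] by (auto simp: r_def)
  have SL: "Lp_le M p (?S i j b) (D * sqrt (2 ^ j))" if "i \<ge> 1" for i j b
    using L[OF that, of "2 ^ j" "int (b * 2 ^ j)"] by simp
  have ev: "E k i j b \<in> events" if "i \<ge> 1" for i j b k
    unfolding E_def using Lp_leD(2)[OF SL[OF that]] by measurable
  have Aev: "A k \<in> events" for k unfolding A_def by (intro sets.finite_UN ev) auto
  have PA: "prob (A k) \<le> D powr p * ((real k + 1) * r ^ k)" for k
  proof -
    have single: "prob (E k i j b) \<le> D powr p * (2 powr (j * (p / 2) - k * (p * \<theta>)))"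
      if "i \<ge> 1" for i j b
    proof -
      have "prob (E k i j b) \<le> (D * sqrt (2 ^ j) / 2 powr (k * \<theta>)) powr p"
        unfolding E_def using p by (intro Lp_le_Markov[OF SL[OF that]]) auto
      also have "sqrt (2 ^ j) = 2 powr (j / 2)"
        by (simp add: powr_half_sqrt[symmetric] powr_realpow[symmetric] powr_powr)
      also have "(D * 2 powr (j / 2) / 2 powr (k * \<theta>)) powr p = D powr p * (2 powr (j * (p / 2) - k * (p * \<theta>)))"
        using D by (simp add: powr_divide powr_mult powr_powr powr_diff mult_ac)
      finally show ?thesis .
    qed
    have level: "prob (\<Union>b\<in>{..<2 ^ (k - j)}. E k i j b)
        \<le> D powr p * 2 powr (k * (p / 2) - k * (p * \<theta>))" if "i \<ge> 1" "j \<le> k" for i j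
    proof -
      have "prob (\<Union>b\<in>{..<2 ^ (k - j)}. E k i j b)
          \<le> (\<Sum>b<(2::nat) ^ (k - j). prob (E k i j b))"
        by (rule finite_measure_subadditive_finite) (use ev[OF that(1)] in auto)
      also have "\<dots> \<le> (\<Sum>b<(2::nat) ^ (k - j). D powr p * (2 powr (j * (p / 2) - k * (p * \<theta>))))"
        using single[OF that(1)] by (intro sum_mono) auto
      also have "\<dots> = 2 powr real (k - j) * (D powr p * (2 powr (j * (p / 2) - k * (p * \<theta>))))"
        by (simp add: powr_realpow)
      also have "\<dots> = D powr p * 2 powr (real (k - j) + (j * (p / 2) - k * (p * \<theta>)))"
        by (simp add: powr_add)
      also have "\<dots> \<le> D powr p * 2 powr (k * (p / 2) - k * (p * \<theta>))"
      proof (intro mult_left_mono powr_mono)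
        have "real (k - j) * 1 \<le> real (k - j) * (p / 2)" using p by (intro mult_left_mono) auto
        then show "real (k - j) + (j * (p / 2) - k * (p * \<theta>)) \<le> k * (p / 2) - k * (p * \<theta>)"
          using that by (simp add: of_nat_diff algebra_simps)
      qed auto
      finally show ?thesis .
    qed
    have idx: "prob (\<Union>j\<in>{..k}. \<Union>b\<in>{..<2 ^ (k - j)}. E k i j b)
        \<le> (real k + 1) * (D powr p * 2 powr (k * (p / 2) - k * (p * \<theta>)))" if "i \<ge> 1" for i
    proof -
      have "prob (\<Union>j\<in>{..k}. \<Union>b\<in>{..<2 ^ (k - j)}. E k i j b)
        \<le> (\<Sum>j\<le>k. prob (\<Union>b\<in>{..<2 ^ (k - j)}. E k i j b))"
        by (rule finite_measure_subadditive_finite) (use ev[OF that] in \<open>auto intro!: sets.finite_UN\<close>)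
      also have "\<dots> \<le> (\<Sum>j\<le>k. D powr p * 2 powr (k * (p / 2) - k * (p * \<theta>)))"
        using level[OF that] by (intro sum_mono) auto
      finally show ?thesis by (simp add: add.commute)
    qed
    have "prob (A k) \<le> (\<Sum>i=1..N k. prob (\<Union>j\<in>{..k}. \<Union>b\<in>{..<2 ^ (k - j)}.
        E k i j b))"
      unfolding A_def by (rule finite_measure_subadditive_finite) (use ev in \<open>auto intro!: sets.finite_UN\<close>)
    also have "\<dots> \<le> (\<Sum>i=1..N k. (real k + 1) * (D powr p * 2 powr (k * (p / 2) - k * (p * \<theta>))))"
      using idx by (intro sum_mono) auto
    also have "\<dots> = real (N k) * ((real k + 1) * (D powr p * 2 powr (k * (p / 2) - k * (p * \<theta>))))" by simp
    also have "\<dots> \<le> 2 powr (k * \<gamma>) * ((real k + 1) * (D powr p * 2 powr (k * (p / 2) - k * (p * \<theta>))))"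
      by (intro mult_right_mono) (auto simp: N_def)
    also have "\<dots> = D powr p * ((real k + 1) * 2 powr (k * \<gamma> + (k * (p / 2) - k * (p * \<theta>))))"
      by (simp add: powr_add)
    also have "2 powr (k * \<gamma> + (k * (p / 2) - k * (p * \<theta>))) = r ^ k"
      by (simp add: r_def powr_realpow[symmetric] powr_powr algebra_simps)
    finally show ?thesis .
  qed
  have "summable (\<lambda>k. D powr p * ((real k + 1) * r ^ k))"
    using geometric_deriv_sums[of r] r by (intro summable_mult) (auto simp: sums_iff add.commute)
  then have "summable (\<lambda>k. prob (A k))"
    by (rule summable_comparison_test[rotated]) (use PA in auto)
  then have "AE \<omega> in M. \<forall>\<^sub>F k in sequentially. \<omega> \<in> space M - A k"
    by (intro borel_cantelli_AE1 Aev) (auto simp: emeasure_eq_measure)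
  then show ?thesis
  proof (rule AE_mp, intro AE_I2 impI)
    fix \<omega> assume "\<forall>\<^sub>F k in sequentially. \<omega> \<in> space M - A k"
    then show "\<forall>\<^sub>F k in sequentially. \<forall>i\<ge>1. real i \<le> 2 powr (k * \<gamma>) \<longrightarrow>
      (\<forall>T\<le>2 ^ k. \<bar>\<Sum>t = 1..int T. x i t \<omega>\<bar> \<le> (real k + 1) * 2 powr (k * \<theta>))"
    proof (rule eventually_mono, intro allI impI)
      fix k i T :: nat
      assume \<omega>: "\<omega> \<in> space M - A k" and i: "i \<ge> 1" "real i \<le> 2 powr (k * \<gamma>)" and T: "T \<le> 2 ^ k"
      define s where "s = (\<lambda>n::nat. \<Sum>t = 1..int n. x i t \<omega>)"
      have "\<bar>s T\<bar> \<le> (real k + 1) * 2 powr (k * \<theta>)"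
      proof (rule dyadic_chaining[OF _ _ T])
        show "s 0 = 0" by (simp add: s_def)
        fix j b :: nat assume jb: "j \<le> k" "(b + 1) * 2 ^ j \<le> 2 ^ k"
        have "(b + 1) * 2 ^ j \<le> 2 ^ (k - j) * 2 ^ j"
          using jb by (simp add: power_add[symmetric])
        then have "b + 1 \<le> 2 ^ (k - j)" by (rule mult_right_le_imp_le) simp
        then have "b < 2 ^ (k - j)" by simp
        moreover have "i \<in> {1..N k}" using i by (auto simp: N_def le_nat_floor)
        ultimately have "\<not> \<bar>?S i j b \<omega>\<bar> > 2 powr (k * \<theta>)" using \<omega> jb(1) by (auto simp: A_def E_def)
        moreover have "s ((b + 1) * 2 ^ j) - s (b * 2 ^ j) = ?S i j b \<omega>"
        proof -
          have seg: "{1..int (u + v)} = {1..int u} \<union> {int u<..int u + int v}" for u v :: nat by auto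
          have "(b + 1) * 2 ^ j = b * 2 ^ j + 2 ^ j" by simp
          then have "s ((b + 1) * 2 ^ j) = s (b * 2 ^ j) + ?S i j b \<omega>"
            unfolding s_def by (simp only: seg) (rule sum.union_disjoint, auto)
          then show ?thesis by simp
        qed
        ultimately show "\<bar>s ((b + 1) * 2 ^ j) - s (b * 2 ^ j)\<bar> \<le> 2 powr (k * \<theta>)" by simp
      qed
      then show "\<bar>\<Sum>t = 1..int T. x i t \<omega>\<bar> \<le> (real k + 1) * 2 powr (k * \<theta>)" by (simp add: s_def)
    qed
  qed
qed

text \<open>The range of i grows like T^\<gamma>, the bound that (A4) will put on N. Pathwise
  statements thereby involve T alone and can be transported to any joint limit.\<close>

abbreviation uniform_rate :: "real \<Rightarrow> real \<Rightarrow> (nat \<Rightarrow> nat \<Rightarrow> real) \<Rightarrow> bool" where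
  "uniform_rate \<gamma> \<rho> X \<equiv> \<forall>\<^sub>F T in sequentially. \<forall>i\<ge>1. real i \<le> real T powr \<gamma> \<longrightarrow> \<bar>X T i\<bar> \<le> real T powr (- \<rho>)"

lemma (in prob_space) AE_time_mean_rate:
  fixes x :: "nat \<Rightarrow> int \<Rightarrow> 'a \<Rightarrow> real" and p \<gamma> \<rho> :: real
  assumes p: "p \<ge> 2" and \<gamma>: "\<gamma> \<ge> 0" "\<gamma> + p / 2 < p * (1 - \<rho>)"
    and ind: "indep_vars (\<lambda>_. S) \<eta> UNIV" and a: "a \<ge> 1"
    and x: "\<And>i. i \<ge> 1 \<Longrightarrow> approximable M S \<eta> p c a (x i)"
    and x0: "\<And>i t. i \<ge> 1 \<Longrightarrow> (\<integral>\<omega>. x i t \<omega> \<partial>M) = 0"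
  shows "AE \<omega> in M. uniform_rate \<gamma> \<rho> (\<lambda>T i. time_mean T (\<lambda>t. x i t \<omega>))"
proof -
  obtain C where C: "second_order_const p C" using second_order_const_exists[OF p] by blast
  define q where "q = (\<gamma> + p / 2) / p"
  define \<theta> where "\<theta> = (q + (1 - \<rho>)) / 2"
  have "q < 1 - \<rho>" using \<gamma>(2) p by (simp add: q_def pos_divide_less_eq mult.commute)
  then have \<theta>1: "q < \<theta>" "\<theta> < 1 - \<rho>" by (auto simp: \<theta>_def)
  then have \<theta>: "\<gamma> + p / 2 < p * \<theta>" using p by (simp add: q_def pos_divide_less_eq mult.commute)
  have \<rho>: "1 - \<rho> > 0"
  proof -
    have "p * (1 - \<rho>) > 0" using \<gamma> p by linarith
    then show ?thesis using p by (simp add: zero_less_mult_iff)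
  qed
  define \<delta> where "\<delta> = 1 - \<rho> - \<theta>"
  have \<delta>: "\<delta> > 0" using \<theta>1 by (simp add: \<delta>_def)
  have "(\<lambda>k::nat. (real k + 1) * 2 powr (- \<delta> * real k)) \<longlonglongrightarrow> 0" using \<delta> by real_asymp
  \<comment> \<open>The right-hand side compensates for T \<ge> 2^(k-1), which may fall short of 2^k
    by a factor 2.\<close>
  then have ev: "\<forall>\<^sub>F k in sequentially. (real k + 1) * 2 powr (- \<delta> * real k) < 2 powr (- (1 - \<rho>))"
    by (rule order_tendstoD) simp
  have "AE \<omega> in M. \<forall>\<^sub>F k in sequentially. \<forall>i\<ge>1. real i \<le> 2 powr (k * \<gamma>) \<longrightarrow>
    (\<forall>T\<le>2 ^ k. \<bar>\<Sum>t = 1..int T. x i t \<omega>\<bar> \<le> (real k + 1) * 2 powr (k * \<theta>))"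
    by (rule AE_partial_sums_dyadic[OF p \<gamma>(1) \<theta>]) (rule Lp_le_sum_approximable[OF p C ind x a x0])
  then show ?thesis
  proof (rule AE_mp, intro AE_I2 impI)
    fix \<omega> assume "\<forall>\<^sub>F k in sequentially. \<forall>i\<ge>1. real i \<le> 2 powr (k * \<gamma>) \<longrightarrow>
      (\<forall>T\<le>2 ^ k. \<bar>\<Sum>t = 1..int T. x i t \<omega>\<bar> \<le> (real k + 1) * 2 powr (k * \<theta>))"
    with ev have "\<forall>\<^sub>F k in sequentially. (real k + 1) * 2 powr (- \<delta> * real k) < 2 powr (- (1 - \<rho>)) \<and>
      (\<forall>i\<ge>1. real i \<le> 2 powr (k * \<gamma>) \<longrightarrow>
      (\<forall>T\<le>2 ^ k. \<bar>\<Sum>t = 1..int T. x i t \<omega>\<bar> \<le> (real k + 1) * 2 powr (k * \<theta>)))"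
      by (rule eventually_conj)
    then obtain k0 where k0: "\<And>k. k \<ge> k0 \<Longrightarrow> (real k + 1) * 2 powr (- \<delta> * real k) < 2 powr (- (1 - \<rho>))"
      "\<And>k i T. k \<ge> k0 \<Longrightarrow> i \<ge> 1 \<Longrightarrow> real i \<le> 2 powr (k * \<gamma>) \<Longrightarrow> T \<le> 2 ^ k \<Longrightarrow>
        \<bar>\<Sum>t = 1..int T. x i t \<omega>\<bar> \<le> (real k + 1) * 2 powr (k * \<theta>)"
      unfolding eventually_sequentially by blast
    show "uniform_rate \<gamma> \<rho> (\<lambda>T i. time_mean T (\<lambda>t. x i t \<omega>))"
      unfolding eventually_sequentially
    proof (intro exI allI impI)
      fix T i :: nat assume T: "T \<ge> 2 ^ k0" and i: "i \<ge> 1" "real i \<le> real T powr \<gamma>"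
      have T1: "T \<ge> 1" using T one_le_power[of "2::nat" k0] by linarith
      obtain m where m: "2 ^ m \<le> T" "T < 2 ^ (m + 1)" using ex_power_ivl1[of 2 T] T1 by auto
      define k where "k = m + 1"
      have Tk: "real T \<le> 2 powr k"
      proof -
        have "real T \<le> real (2 ^ k)" unfolding of_nat_le_iff using m(2) by (simp add: k_def)
        then show ?thesis by (simp add: powr_realpow)
      qed
      have Tk': "2 powr (real k - 1) \<le> real T"
        using m(1) by (simp add: k_def powr_realpow numeral_power_le_of_nat_cancel_iff)
      have "(2::nat) ^ k0 < 2 ^ k" using T m(2) by (simp add: k_def)
      then have kk: "k \<ge> k0" by (simp add: power_strict_increasing_iff less_imp_le)
      have "real T powr \<gamma> \<le> (2 powr k) powr \<gamma>" using Tk \<gamma> by (intro powr_mono2) auto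
      then have "real i \<le> 2 powr (k * \<gamma>)" using i by (simp add: powr_powr)
      then have S: "\<bar>\<Sum>t = 1..int T. x i t \<omega>\<bar> \<le> (real k + 1) * 2 powr (k * \<theta>)"
        using k0(2)[OF kk i(1)] m(2) by (simp add: k_def)
      have "(real k + 1) * 2 powr (k * \<theta>) = ((real k + 1) * 2 powr (- \<delta> * real k)) * 2 powr (k * (1 - \<rho>))"
        by (simp add: \<delta>_def powr_add[symmetric] mult.assoc algebra_simps)
      also have "\<dots> \<le> 2 powr (- (1 - \<rho>)) * 2 powr (k * (1 - \<rho>))"
        using k0(1)[OF kk] by (intro mult_right_mono) auto
      also have "\<dots> = (2 powr (real k - 1)) powr (1 - \<rho>)"
        by (simp add: powr_powr powr_add[symmetric] algebra_simps)
      also have "\<dots> \<le> real T powr (1 - \<rho>)" using Tk' \<rho> by (intro powr_mono2) auto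
      finally have "\<bar>\<Sum>t = 1..int T. x i t \<omega>\<bar> / real T \<le> real T powr (1 - \<rho>) / real T"
        using S by (intro divide_right_mono) auto
      also have "\<dots> = real T powr (- \<rho>)"
        using T1 by (simp add: powr_diff powr_minus field_simps)
      finally show "\<bar>time_mean T (\<lambda>t. x i t \<omega>)\<bar> \<le> real T powr (- \<rho>)"
        by (simp add: time_mean_def abs_mult)
    qed
  qed
qed

subsection \<open>The maximum of standard normal variables\<close>

abbreviation Phi :: "real \<Rightarrow> real" where
  "Phi \<equiv> cdf std_normal_distribution"

interpretation std_normal: real_distribution std_normal_distribution
  by (rule real_dist_normal_dist)

lemma Phi_has_derivative: "(Phi has_real_derivative std_normal_density t) (at t)"
proof -
  let ?\<phi> = std_normal_density
  have cont: "continuous_on A ?\<phi>" for A unfolding normal_density_def by (intro continuous_intros) auto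
  \<comment> \<open>Anchored at t - 1, so that the density is integrated over compact intervals and
    t is an interior point.\<close>
  have eq: "Phi y = Phi (t - 1) + integral {t - 1..y} ?\<phi>" if "y \<in> {t - 1..t + 1}" for y
  proof (cases "y = t - 1")
    case False
    then have y: "t - 1 < y" using that by auto
    have si: "set_integrable lborel {t - 1<..y} ?\<phi>"
      unfolding set_integrable_def by (intro integrable_mult_indicator) auto
    have "Phi y - Phi (t - 1) = measure std_normal_distribution {t - 1<..y}"
      by (rule std_normal.cdf_diff_eq[OF y])
    also have "\<dots> = (\<integral>x. indicator {t - 1<..y} x \<partial>std_normal_distribution)" by simp
    also have "\<dots> = (\<integral>x. ?\<phi> x *\<^sub>R indicator {t - 1<..y} x \<partial>lborel)"
      by (rule integral_density) auto
    also have "\<dots> = (LINT x:{t - 1<..y}|lborel. ?\<phi> x)"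
      unfolding set_lebesgue_integral_def by (simp add: mult.commute)
    also have "\<dots> = integral {t - 1<..y} ?\<phi>" by (rule set_borel_integral_eq_integral(2)[OF si])
    also have "\<dots> = integral {t - 1..y} ?\<phi>"
      by (rule integral_spike_set; rule negligible_subset[of "{t - 1}"]) auto
    finally show ?thesis by simp
  qed simp
  have "((\<lambda>y. Phi (t - 1) + integral {t - 1..y} ?\<phi>) has_real_derivative 0 + ?\<phi> t) (at t within {t - 1..t + 1})"
    by (intro DERIV_add DERIV_const integral_has_real_derivative cont) auto
  then have "((\<lambda>y. Phi (t - 1) + integral {t - 1..y} ?\<phi>) has_real_derivative ?\<phi> t) (at t within {t - 1..t + 1})"
    by simp
  then have "(Phi has_real_derivative ?\<phi> t) (at t within {t - 1..t + 1})"
  proof (rule has_field_derivative_transform_within[where d = 1])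
    show "Phi (t - 1) + integral {t - 1..x} ?\<phi> = Phi x" if "x \<in> {t - 1..t + 1}" for x
      by (rule eq[OF that, symmetric])
  qed auto
  moreover have "at t within {t - 1..t + 1} = at t" by (rule at_within_interior) auto
  ultimately show ?thesis by simp
qed

lemma std_normal_density_has_derivative:
  "(std_normal_density has_real_derivative - t * std_normal_density t) (at t)"
proof -
  have "((\<lambda>x. c * exp (- x\<^sup>2 / 2)) has_real_derivative - t * (c * exp (- t\<^sup>2 / 2))) (at t)" for c :: real
    by (auto intro!: derivative_eq_intros)
  from this[of "1 / sqrt (2 * pi)"] show ?thesis by (simp only: std_normal_density_def[abs_def])
qed

text \<open>Each difference of the two sides tends to 0 at infinity and is strictly decreasing,
  hence positive. The derivatives collapse to -\<phi>(x)/x^2 and -3\<phi>(x)/x^4.\<close>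

lemma Mills_ratio_bounds:
  assumes t: "t > 0"
  shows "1 - Phi t < std_normal_density t / t"
    and "std_normal_density t * (1 / t - 1 / t ^ 3) < 1 - Phi t"
proof -
  let ?\<phi> = std_normal_density
  have \<phi>: "?\<phi> x > 0" for x by (rule normal_density_pos) simp
  have Plim: "(Phi \<longlongrightarrow> 1) at_top" by (rule std_normal.cdf_lim_at_top_prob)
  have l1: "((\<lambda>x::real. ?\<phi> x / x) \<longlongrightarrow> 0) at_top"
    unfolding std_normal_density_def by real_asymp
  have l2: "((\<lambda>x::real. ?\<phi> x * (1 / x - 1 / x ^ 3)) \<longlongrightarrow> 0) at_top"
    unfolding std_normal_density_def by real_asymp
  have "0 < ?\<phi> t / t - (1 - Phi t)"
  proof (rule DERIV_neg_imp_decreasing_at_top[where f = "\<lambda>x. ?\<phi> x / x - (1 - Phi x)"])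
    fix x assume "x \<ge> t"
    then have x: "x > 0" using t by simp
    have d1: "((\<lambda>x. ?\<phi> x / x - (1 - Phi x)) has_real_derivative
        (- x * ?\<phi> x * x - ?\<phi> x * 1) / (x * x) - (0 - ?\<phi> x)) (at x)"
      by (intro DERIV_diff DERIV_divide DERIV_const DERIV_ident Phi_has_derivative
          std_normal_density_has_derivative) (use x in auto)
    have d2: "(- x * ?\<phi> x * x - ?\<phi> x * 1) / (x * x) - (0 - ?\<phi> x) = - (?\<phi> x / x\<^sup>2)"
      using x by (simp add: field_simps power2_eq_square)
    have d3: "- (?\<phi> x / x\<^sup>2) < 0" using \<phi>[of x] x by simp
    show "\<exists>y. DERIV (\<lambda>x. ?\<phi> x / x - (1 - Phi x)) x :> y \<and> y < 0"
      using d1[unfolded d2] d3 by blast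
  next
    show "((\<lambda>x. ?\<phi> x / x - (1 - Phi x)) \<longlongrightarrow> 0) at_top"
      using tendsto_diff[OF l1 tendsto_diff[OF tendsto_const[of 1] Plim]] by simp
  qed
  then show "1 - Phi t < ?\<phi> t / t" by simp
  have "0 < (1 - Phi t) - ?\<phi> t * (1 / t - 1 / t ^ 3)"
  proof (rule DERIV_neg_imp_decreasing_at_top[where f = "\<lambda>x. (1 - Phi x) - ?\<phi> x * (1 / x - 1 / x ^ 3)"])
    fix x assume "x \<ge> t"
    then have x: "x > 0" using t by simp
    have d: "((\<lambda>x. 1 / x - 1 / x ^ 3) has_real_derivative (- 1 / x\<^sup>2 + 3 / x ^ 4)) (at x)"
      using x by (auto intro!: derivative_eq_intros simp: field_simps power2_eq_square eval_nat_numeral)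
    have d1: "((\<lambda>x. (1 - Phi x) - ?\<phi> x * (1 / x - 1 / x ^ 3)) has_real_derivative
        (0 - ?\<phi> x) - (- x * ?\<phi> x * (1 / x - 1 / x ^ 3) + (- 1 / x\<^sup>2 + 3 / x ^ 4) * ?\<phi> x)) (at x)"
      by (intro DERIV_diff DERIV_mult DERIV_const Phi_has_derivative std_normal_density_has_derivative d)
    have d2: "(0 - ?\<phi> x) - (- x * ?\<phi> x * (1 / x - 1 / x ^ 3) + (- 1 / x\<^sup>2 + 3 / x ^ 4) * ?\<phi> x)
        = - (3 * ?\<phi> x / x ^ 4)"
      using x by (simp add: field_simps power2_eq_square eval_nat_numeral)
    have d3: "- (3 * ?\<phi> x / x ^ 4) < 0" using \<phi>[of x] x by simp
    show "\<exists>y. DERIV (\<lambda>x. (1 - Phi x) - ?\<phi> x * (1 / x - 1 / x ^ 3)) x :> y \<and> y < 0"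
      using d1[unfolded d2] d3 by blast
  next
    show "((\<lambda>x. (1 - Phi x) - ?\<phi> x * (1 / x - 1 / x ^ 3)) \<longlongrightarrow> 0) at_top"
      using tendsto_diff[OF tendsto_diff[OF tendsto_const[of 1] Plim] l2] by simp
  qed
  then show "?\<phi> t * (1 / t - 1 / t ^ 3) < 1 - Phi t" by simp
qed

lemma Mills_ratio_tendsto: "((\<lambda>t. (1 - Phi t) / (std_normal_density t / t)) \<longlongrightarrow> 1) at_top"
proof (rule tendsto_sandwich)
  have b: "1 - 1 / t\<^sup>2 \<le> (1 - Phi t) / (std_normal_density t / t) \<and> (1 - Phi t) / (std_normal_density t / t) \<le> 1"
    if t: "t > 0" for t
  proof
    have p: "std_normal_density t / t > 0" using t by (intro divide_pos_pos normal_density_pos) auto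
    have "(1 - 1 / t\<^sup>2) * (std_normal_density t / t) = std_normal_density t * (1 / t - 1 / t ^ 3)"
      using t by (simp add: field_simps power2_eq_square eval_nat_numeral)
    then show "1 - 1 / t\<^sup>2 \<le> (1 - Phi t) / (std_normal_density t / t)"
      using Mills_ratio_bounds(2)[OF t] by (subst pos_le_divide_eq[OF p]) simp
    show "(1 - Phi t) / (std_normal_density t / t) \<le> 1"
      using Mills_ratio_bounds(1)[OF t] by (subst pos_divide_le_eq[OF p]) simp
  qed
  show "\<forall>\<^sub>F t in at_top. 1 - 1 / t\<^sup>2 \<le> (1 - Phi t) / (std_normal_density t / t)"
    "\<forall>\<^sub>F t in at_top. (1 - Phi t) / (std_normal_density t / t) \<le> 1"
    by (rule eventually_mono[OF eventually_gt_at_top[of 0]], use b in blast)+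
  show "((\<lambda>t::real. 1 - 1 / t\<^sup>2) \<longlongrightarrow> 1) at_top" by real_asymp
qed simp

section \<open>The Gumbel norming\<close>

lemma b_norm_at_top: "filterlim b_norm at_top sequentially"
  unfolding b_norm_def by real_asymp

text \<open>The expression is the logarithm of N \<phi>(t)/t at t = a_N x + b_N. The correction in
  b_N makes b_N^2/2 equal to ln N minus half of ln ln N + ln(4\<pi>) up to o(1); the double
  logarithm then cancels against ln b_N, and the constants ln(4\<pi>)/2, ln(2)/2 and ln(2\<pi>)/2
  cancel each other. Since a_N b_N tends to 1, the shift by a_N x contributes x.\<close>

lemma threshold_exponent_tendsto:
  "(\<lambda>N. ln (real N) - (a_norm N * x + b_norm N)\<^sup>2 / 2 - ln (a_norm N * x + b_norm N) - ln (2 * pi) / 2)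
    \<longlonglongrightarrow> - x"
proof -
  define q where "q = (\<lambda>N::nat. ln (ln (real N)) + ln (4 * pi))"
  have "\<forall>\<^sub>F N in sequentially. ln (real N) - (b_norm N)\<^sup>2 / 2 - ln (ln (real N)) / 2
      = ln (4 * pi) / 2 - (q N)\<^sup>2 / (16 * ln (real N))"
    using eventually_ge_at_top[of 2]
  proof eventually_elim
    case (elim N)
    then have L: "ln (real N) > 0" by simp
    define s where "s = sqrt (2 * ln (real N))"
    have s: "s > 0" "s\<^sup>2 = 2 * ln (real N)" using L by (auto simp: s_def)
    have "b_norm N = s - q N / (2 * s)" by (simp add: b_norm_def q_def s_def)
    then have "(b_norm N)\<^sup>2 = s\<^sup>2 - q N + (q N)\<^sup>2 / (4 * s\<^sup>2)"
      using s(1) by (simp add: power2_diff power_divide power_mult_distrib)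
    then show ?case using L unfolding s(2) by (simp add: q_def field_simps)
  qed
  moreover have "(\<lambda>N. ln (4 * pi) / 2 - (q N)\<^sup>2 / (16 * ln (real N))) \<longlonglongrightarrow> ln (4 * pi) / 2"
    unfolding q_def by real_asymp
  ultimately have 1: "(\<lambda>N. ln (real N) - (b_norm N)\<^sup>2 / 2 - ln (ln (real N)) / 2) \<longlonglongrightarrow> ln (4 * pi) / 2"
    by (simp add: tendsto_cong)
  have 2: "(\<lambda>N. ln (b_norm N) - ln (ln (real N)) / 2) \<longlonglongrightarrow> ln 2 / 2"
    unfolding b_norm_def by real_asymp
  \<comment> \<open>a_N depends on N through b_N only, so the limit can be taken in the single
    variable b.\<close>
  have 3: "(\<lambda>N. (a_norm N * x + b_norm N)\<^sup>2 / 2 - (b_norm N)\<^sup>2 / 2) \<longlonglongrightarrow> x"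
  proof -
    have "((\<lambda>b::real. (b / (1 + b\<^sup>2) * x + b)\<^sup>2 / 2 - b\<^sup>2 / 2) \<longlongrightarrow> x) at_top" by real_asymp
    from filterlim_compose[OF this b_norm_at_top] show ?thesis by (simp add: a_norm_def)
  qed
  have 4: "(\<lambda>N. ln (a_norm N * x + b_norm N) - ln (b_norm N)) \<longlonglongrightarrow> 0"
  proof -
    have "((\<lambda>b::real. ln (b / (1 + b\<^sup>2) * x + b) - ln b) \<longlongrightarrow> 0) at_top" by real_asymp
    from filterlim_compose[OF this b_norm_at_top] show ?thesis by (simp add: a_norm_def)
  qed
  have "ln (4 * pi) = 2 * ln 2 + ln pi" "ln (2 * pi) = ln 2 + ln pi"
    using ln_mult[of 4 pi] ln_mult[of 2 pi] ln_realpow[of 2 2] by auto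
  then have lim: "ln (4 * pi) / 2 - ln 2 / 2 - x - 0 - ln (2 * pi) / 2 = - x" by (simp add: field_simps)
  from tendsto_diff[OF tendsto_diff[OF tendsto_diff[OF tendsto_diff[OF 1 2] 3] 4] tendsto_const[of "ln (2 * pi) / 2"]]
  show ?thesis unfolding lim by (simp add: algebra_simps)
qed

lemma threshold_at_top: "filterlim (\<lambda>N. a_norm N * x + b_norm N) at_top sequentially"
proof -
  have "filterlim (\<lambda>b::real. b / (1 + b\<^sup>2) * x + b) at_top at_top" by real_asymp
  from filterlim_compose[OF this b_norm_at_top] show ?thesis by (simp add: a_norm_def)
qed

lemma N_times_tail_tendsto: "(\<lambda>N. real N * (1 - Phi (a_norm N * x + b_norm N))) \<longlonglongrightarrow> exp (- x)"
proof -
  define t where "t = (\<lambda>N. a_norm N * x + b_norm N)"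
  have t: "filterlim t at_top sequentially" unfolding t_def by (rule threshold_at_top)
  have "(\<lambda>N. (1 - Phi (t N)) / (std_normal_density (t N) / t N) *
      exp (ln (real N) - (t N)\<^sup>2 / 2 - ln (t N) - ln (2 * pi) / 2)) \<longlonglongrightarrow> 1 * exp (- x)"
    by (intro tendsto_mult tendsto_exp filterlim_compose[OF Mills_ratio_tendsto t])
      (unfold t_def, rule threshold_exponent_tendsto)
  moreover have "\<forall>\<^sub>F N in sequentially. (1 - Phi (t N)) / (std_normal_density (t N) / t N) *
      exp (ln (real N) - (t N)\<^sup>2 / 2 - ln (t N) - ln (2 * pi) / 2) = real N * (1 - Phi (t N))"
    using eventually_gt_at_top[of 0] filterlim_at_top_dense[THEN iffD1, OF t, rule_format, of 0]
  proof eventually_elim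
    case (elim N)
    have "exp (ln (2 * pi) / 2) = sqrt (2 * pi)"
      by (simp add: ln_sqrt[symmetric])
    then have "exp (ln (real N) - (t N)\<^sup>2 / 2 - ln (t N) - ln (2 * pi) / 2)
        = real N / exp ((t N)\<^sup>2 / 2) / t N / sqrt (2 * pi)"
      using elim by (simp only: exp_diff exp_ln of_nat_0_less_iff)
    also have "\<dots> = real N * (std_normal_density (t N) / t N)"
      by (simp add: exp_minus std_normal_density_def field_simps)
    finally have "exp (ln (real N) - (t N)\<^sup>2 / 2 - ln (t N) - ln (2 * pi) / 2) = real N * (std_normal_density (t N) / t N)" .
    moreover have "std_normal_density (t N) \<noteq> 0" using normal_density_pos[of 1 0 "t N"] by linarith
    ultimately show ?case using elim by simp
  qed
  ultimately have "(\<lambda>N. real N * (1 - Phi (t N))) \<longlonglongrightarrow> exp (- x)" by (simp add: tendsto_cong)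
  then show ?thesis by (simp only: t_def)
qed

text \<open>N ln(1 - q) differs from -Nq by at most 2Nq^2 for small q, and Nq^2 = (Nq) q tends to
  0.\<close>

lemma power_one_minus_tendsto:
  fixes q :: "nat \<Rightarrow> real"
  assumes "(\<lambda>N. real N * q N) \<longlonglongrightarrow> c"
  shows "(\<lambda>N. (1 - q N) ^ N) \<longlonglongrightarrow> exp (- c)"
proof -
  have q0: "q \<longlonglongrightarrow> 0"
  proof -
    have "(\<lambda>N. (real N * q N) * (1 / real N)) \<longlonglongrightarrow> c * 0"
      by (intro tendsto_mult assms lim_1_over_n)
    moreover have "\<forall>\<^sub>F N in sequentially. (real N * q N) * (1 / real N) = q N"
      using eventually_gt_at_top[of 0] by eventually_elim simp
    ultimately show ?thesis by (simp add: tendsto_cong)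
  qed
  have small: "\<forall>\<^sub>F N in sequentially. \<bar>q N\<bar> \<le> 1 / 2"
    using order_tendstoD[OF tendsto_rabs[OF q0], of "1 / 2"] by (auto elim: eventually_mono)
  have "(\<lambda>N. real N * (ln (1 - q N) + q N)) \<longlonglongrightarrow> 0"
  proof (rule Lim_null_comparison)
    show "\<forall>\<^sub>F N in sequentially. norm (real N * (ln (1 - q N) + q N)) \<le> 2 * (\<bar>real N * q N\<bar> * \<bar>q N\<bar>)"
      using small
    proof eventually_elim
      case (elim N)
      have "\<bar>ln (1 - q N) + q N\<bar> \<le> 2 * (q N)\<^sup>2" using abs_ln_one_plus_x_minus_x_bound[of "- q N"] elim by simp
      then have "real N * \<bar>ln (1 - q N) + q N\<bar> \<le> real N * (2 * (q N)\<^sup>2)" by (intro mult_left_mono) auto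
      then show ?case by (simp add: abs_mult power2_eq_square mult_ac)
    qed
    have "(\<lambda>N. 2 * (\<bar>real N * q N\<bar> * \<bar>q N\<bar>)) \<longlonglongrightarrow> 2 * (\<bar>c\<bar> * \<bar>0\<bar>)"
      by (intro tendsto_intros assms q0)
    then show "(\<lambda>N. 2 * (\<bar>real N * q N\<bar> * \<bar>q N\<bar>)) \<longlonglongrightarrow> 0" by simp
  qed
  from tendsto_exp[OF tendsto_diff[OF this assms]]
  have "(\<lambda>N. exp (real N * ln (1 - q N))) \<longlonglongrightarrow> exp (- c)" by (simp add: algebra_simps)
  moreover have "\<forall>\<^sub>F N in sequentially. exp (real N * ln (1 - q N)) = (1 - q N) ^ N"
    using small
  proof eventually_elim
    case (elim N)
    then have "1 - q N > 0" by linarith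
    then show ?case by (simp add: exp_of_nat_mult)
  qed
  ultimately show ?thesis by (simp add: tendsto_cong)
qed

lemma Phi_power_tendsto: "(\<lambda>N. Phi (a_norm N * x + b_norm N) ^ N) \<longlonglongrightarrow> exp (- exp (- x))"
  using power_one_minus_tendsto[OF N_times_tail_tendsto[of x]] by simp

subsection \<open>Ordinary least squares along a path\<close>

lemma matrix_inv_left_right_det:
  fixes A :: "real^'n^'n"
  assumes "det A \<noteq> 0"
  shows "A ** matrix_inv A = mat 1" "matrix_inv A ** A = mat 1"
proof -
  have "\<exists>B. A ** B = mat 1 \<and> B ** A = mat 1"
    using assms by (simp add: invertible_det_nz[symmetric] invertible_def)
  then have "A ** matrix_inv A = mat 1 \<and> matrix_inv A ** A = mat 1"
    unfolding matrix_inv_def by (rule someI_ex)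
  then show "A ** matrix_inv A = mat 1" "matrix_inv A ** A = mat 1" by auto
qed

lemma outer_square_mult: "outer_square g *v v = (g \<bullet> v) *\<^sub>R g"
  by (simp add: vec_eq_iff outer_square_def matrix_vector_mult_def inner_vec_def sum_distrib_left mult_ac)

lemma sum_matrix_vector_mult: "(\<Sum>t\<in>I. A t) *v v = (\<Sum>t\<in>I. A t *v v)" for A :: "'i \<Rightarrow> real^'n^'m"
  by (induction I rule: infinite_finite_induct) (auto simp: matrix_vector_mult_add_rdistrib)

text \<open>b is the error of the slope and r the sample covariance of errors and factors; the
  normal equations read A b = T r. Coercivity with constant l gives l |b|^2 \<le> b . r \<le> |b|
  |r|, which bounds b by r.\<close>

lemma ols_decomposition:
  fixes f :: "int \<Rightarrow> real^'k" and y u :: "int \<Rightarrow> real"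
  assumes T: "T \<ge> 1" and y: "\<And>t. t \<in> {1..int T} \<Longrightarrow> y t = \<alpha> + \<beta> \<bullet> f t + u t" and l: "l > 0"
    and pd: "\<And>v. l * (norm v)\<^sup>2 \<le> time_mean T (\<lambda>t. ((f t - time_mean T f) \<bullet> v)\<^sup>2)"
  defines "r \<equiv> time_mean T (\<lambda>t. u t *\<^sub>R f t) - time_mean T u *\<^sub>R time_mean T f"
  obtains b where "l * norm b \<le> norm r" "0 \<le> b \<bullet> r"
    "ols_alpha T y f = \<alpha> + time_mean T u - b \<bullet> time_mean T f"
    "time_mean T (\<lambda>t. (ols_resid T y f t)\<^sup>2) = time_mean T (\<lambda>t. (u t)\<^sup>2) - (time_mean T u)\<^sup>2 - b \<bullet> r"
proof -
  let ?I = "{1..int T}" and ?fb = "time_mean T f" and ?ub = "time_mean T u"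
  define g where "g = (\<lambda>t. f t - ?fb)"
  define A where "A = (\<Sum>t\<in>?I. outer_square (g t))"
  have T0: "real T > 0" using T by simp
  have sum_mean: "(\<Sum>t\<in>?I. x t) = real T *\<^sub>R time_mean T x" for x :: "int \<Rightarrow> 'c::real_vector"
    using T0 by (simp add: time_mean_def)
  have g0: "(\<Sum>t\<in>?I. g t) = 0"
    by (simp add: g_def sum_subtractf sum_mean sum_constant_scaleR del: sum_constant)
  have Av: "A *v v = (\<Sum>t\<in>?I. (g t \<bullet> v) *\<^sub>R g t)" for v
    by (simp add: A_def sum_matrix_vector_mult outer_square_mult)
  have vAv: "v \<bullet> (A *v v) = real T * time_mean T (\<lambda>t. (g t \<bullet> v)\<^sup>2)" for v
    using sum_mean[of "\<lambda>t. (g t \<bullet> v)\<^sup>2"]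
    by (simp add: Av inner_sum_right power2_eq_square inner_commute[of v])
  have vAv_ge: "real T * (l * (norm v)\<^sup>2) \<le> v \<bullet> (A *v v)" for v
    unfolding vAv g_def using pd T0 by (intro mult_left_mono) auto
  \<comment> \<open>Coercivity excludes a kernel, so \<open>matrix_inv\<close> is a true inverse
    here and not its default value.\<close>
  have "inj ((*v) A)"
  proof (rule injI)
    fix v w assume "A *v v = A *v w"
    then have "A *v (v - w) = 0" by (simp add: matrix_vector_mult_diff_distrib)
    with vAv_ge[of "v - w"] have "real T * (l * (norm (v - w))\<^sup>2) \<le> 0" by simp
    then have "(norm (v - w))\<^sup>2 \<le> 0" using T0 l by (auto simp: mult_le_0_iff)
    then show "v = w" by simp
  qed
  then have det: "det A \<noteq> 0" by (simp add: inj_matrix_vector_mult invertible_det_nz[symmetric] invertible_left_inverse matrix_left_invertible_injective)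
  note inv = matrix_inv_left_right_det[OF det]
  define b where "b = matrix_inv A *v (\<Sum>t\<in>?I. u t *\<^sub>R g t)"
  have ug: "(\<Sum>t\<in>?I. u t *\<^sub>R g t) = real T *\<^sub>R r"
    using sum_mean[of "\<lambda>t. u t *\<^sub>R f t"] sum_mean[of u]
    by (simp add: g_def r_def scaleR_right_diff_distrib sum_subtractf scaleR_sum_left[symmetric])
  have Ab: "A *v b = real T *\<^sub>R r"
    by (simp add: b_def ug matrix_vector_mul_assoc inv)
  have br: "b \<bullet> r = time_mean T (\<lambda>t. (g t \<bullet> b)\<^sup>2)"
    using vAv[of b] T0 by (simp add: Ab)
  have slope: "ols_slope T y f = \<beta> + b"
  proof -
    have "(\<Sum>t\<in>?I. y t *\<^sub>R g t) = (\<Sum>t\<in>?I. (\<alpha> + \<beta> \<bullet> ?fb) *\<^sub>R g t + ((g t \<bullet> \<beta>) *\<^sub>R g t + u t *\<^sub>R g t))"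
      by (intro sum.cong refl) (simp add: y g_def inner_diff_left inner_commute[of \<beta>] algebra_simps)
    also have "\<dots> = A *v \<beta> + (\<Sum>t\<in>?I. u t *\<^sub>R g t)"
      using g0 by (simp add: sum.distrib scaleR_sum_right[symmetric] Av)
    finally have "matrix_inv A *v (\<Sum>t\<in>?I. y t *\<^sub>R g t) = (matrix_inv A ** A) *v \<beta> + b"
      by (simp add: matrix_vector_right_distrib b_def matrix_vector_mul_assoc)
    then have "matrix_inv A *v (\<Sum>t\<in>?I. y t *\<^sub>R g t) = \<beta> + b" by (simp add: inv)
    then show ?thesis unfolding ols_slope_def A_def g_def .
  qed
  have yb: "time_mean T y = \<alpha> + \<beta> \<bullet> ?fb + ?ub"
  proof -
    have "(\<Sum>t\<in>?I. y t) = real T * \<alpha> + \<beta> \<bullet> (\<Sum>t\<in>?I. f t) + (\<Sum>t\<in>?I. u t)"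
      by (simp add: y sum.distrib inner_sum_right)
    then show ?thesis using T0 by (simp add: time_mean_def distrib_left)
  qed
  have alpha: "ols_alpha T y f = \<alpha> + ?ub - b \<bullet> ?fb"
    by (simp add: ols_alpha_def slope yb inner_add_left)
  have resid: "ols_resid T y f t = u t - ?ub - g t \<bullet> b" if "t \<in> ?I" for t
    by (simp add: ols_resid_def alpha slope y[OF that] g_def inner_add_left inner_diff_left inner_commute[of b])
  \<comment> \<open>After summation the terms linear in g vanish. The square of g . b contributes T
    (b . r) and its product with u contributes -2T (b . r), leaving a single -T (b . r).\<close>
  have "(\<Sum>t\<in>?I. (ols_resid T y f t)\<^sup>2) = (\<Sum>t\<in>?I. (u t)\<^sup>2 + ?ub\<^sup>2 + (g t \<bullet> b)\<^sup>2
      - 2 * ?ub * u t - 2 * ((u t *\<^sub>R g t) \<bullet> b) + 2 * ?ub * (g t \<bullet> b))"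
    by (intro sum.cong refl) (simp add: resid power2_eq_square algebra_simps)
  also have "\<dots> = (\<Sum>t\<in>?I. (u t)\<^sup>2) + real T * ?ub\<^sup>2 + (\<Sum>t\<in>?I. (g t \<bullet> b)\<^sup>2)
      - 2 * ?ub * (\<Sum>t\<in>?I. u t) - 2 * ((\<Sum>t\<in>?I. u t *\<^sub>R g t) \<bullet> b) + 2 * ?ub * ((\<Sum>t\<in>?I. g t) \<bullet> b)"
    by (simp add: sum.distrib sum_subtractf sum_distrib_left inner_sum_left)
  also have "\<dots> = real T * time_mean T (\<lambda>t. (u t)\<^sup>2) - real T * ?ub\<^sup>2 - real T * (b \<bullet> r)"
    unfolding g0 ug using sum_mean[of u] sum_mean[of "\<lambda>t. (u t)\<^sup>2"] sum_mean[of "\<lambda>t. (g t \<bullet> b)\<^sup>2"]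
    by (simp add: br inner_commute[of r] power2_eq_square)
  finally have "time_mean T (\<lambda>t. (ols_resid T y f t)\<^sup>2) = time_mean T (\<lambda>t. (u t)\<^sup>2) - ?ub\<^sup>2 - b \<bullet> r"
    using T0 by (simp add: time_mean_def field_simps)
  moreover have "0 \<le> b \<bullet> r"
    unfolding br time_mean_def by (simp add: sum_nonneg)
  moreover have "l * norm b \<le> norm r"
  proof (cases "b = 0")
    case False
    have "l * (norm b)\<^sup>2 \<le> b \<bullet> r" unfolding br g_def by (rule pd)
    also have "\<dots> \<le> norm b * norm r" by (rule norm_cauchy_schwarz)
    finally have "norm b * (l * norm b) \<le> norm b * norm r" by (simp add: power2_eq_square mult_ac)
    then show ?thesis using False by simp
  qed simp
  ultimately show thesis by (intro that[of b] alpha)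
qed

text \<open>l is the minimum of the quadratic form on the unit sphere, attained by compactness;
  homogeneity does the rest.\<close>

lemma positive_definite_coercive:
  fixes A :: "real^'k^'k"
  assumes "positive_definite A"
  obtains l where "l > 0" "\<And>v. l * (norm v)\<^sup>2 \<le> v \<bullet> (A *v v)"
proof -
  let ?S = "sphere (0 :: real^'k) 1"
  have "continuous_on ?S (\<lambda>v. v \<bullet> (A *v v))"
    by (intro continuous_intros linear_continuous_on matrix_vector_mul_bounded_linear)
  moreover have "?S \<noteq> {}" by simp
  ultimately obtain v0 where v0: "v0 \<in> ?S" "\<And>v. v \<in> ?S \<Longrightarrow> v0 \<bullet> (A *v v0) \<le> v \<bullet> (A *v v)"
    using continuous_attains_inf[of ?S "\<lambda>v. v \<bullet> (A *v v)"] by auto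
  have "v0 \<noteq> 0" using v0(1) by auto
  then have pos: "v0 \<bullet> (A *v v0) > 0" using assms by (simp add: positive_definite_def)
  show thesis
  proof (rule that[OF pos])
    fix v :: "real^'k"
    show "(v0 \<bullet> (A *v v0)) * (norm v)\<^sup>2 \<le> v \<bullet> (A *v v)"
    proof (cases "v = 0")
      case False
      define w where "w = v /\<^sub>R norm v"
      have vw: "v = norm v *\<^sub>R w" using False by (simp add: w_def)
      have "v0 \<bullet> (A *v v0) \<le> w \<bullet> (A *v w)" using False by (intro v0(2)) (simp add: w_def)
      then have "(v0 \<bullet> (A *v v0)) * (norm v)\<^sup>2 \<le> (w \<bullet> (A *v w)) * (norm v)\<^sup>2" by (intro mult_right_mono) auto
      also have "\<dots> = (norm v *\<^sub>R w) \<bullet> (A *v (norm v *\<^sub>R w))"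
        by (simp add: matrix_vector_mult_scaleR power2_eq_square mult_ac)
      finally show ?thesis unfolding vw[symmetric] .
    qed simp
  qed
qed

lemma quadratic_form_diff_le:
  fixes A B :: "real^'k^'k"
  assumes "\<And>i j. \<bar>A $ i $ j - B $ i $ j\<bar> \<le> d"
  shows "\<bar>v \<bullet> (A *v v) - v \<bullet> (B *v v)\<bar> \<le> (real CARD('k))\<^sup>2 * d * (norm v)\<^sup>2"
proof -
  have "v \<bullet> (A *v v) - v \<bullet> (B *v v) = (\<Sum>i\<in>UNIV. \<Sum>j\<in>UNIV. (A $ i $ j - B $ i $ j) * (v $ i * v $ j))"
    by (simp add: inner_vec_def matrix_vector_mult_def sum_distrib_left sum_subtractf[symmetric] algebra_simps)
  also have "\<bar>\<dots>\<bar> \<le> (\<Sum>i\<in>(UNIV::'k set). \<Sum>j\<in>(UNIV::'k set). d * (norm v)\<^sup>2)"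
  proof (intro order.trans[OF sum_abs] sum_mono)
    fix i j
    have "\<bar>v $ i\<bar> * \<bar>v $ j\<bar> \<le> norm v * norm v" by (intro mult_mono component_le_norm_cart) auto
    then have "\<bar>v $ i * v $ j\<bar> \<le> (norm v)\<^sup>2" by (simp add: abs_mult power2_eq_square)
    then have "\<bar>A $ i $ j - B $ i $ j\<bar> * \<bar>v $ i * v $ j\<bar> \<le> d * (norm v)\<^sup>2"
      using assms[of i j] by (intro mult_mono) auto
    then show "\<bar>(A $ i $ j - B $ i $ j) * (v $ i * v $ j)\<bar> \<le> d * (norm v)\<^sup>2"
      by (simp only: abs_mult)
  qed
  also have "\<dots> = (real CARD('k))\<^sup>2 * d * (norm v)\<^sup>2" by (simp add: power2_eq_square)
  finally show ?thesis .
qed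

section \<open>Time means and the sample covariance matrix\<close>

lemma time_mean_add: "time_mean T (\<lambda>t. x t + y t) = time_mean T x + time_mean T y"
  by (simp add: time_mean_def sum.distrib scaleR_right_distrib)

lemma time_mean_diff: "time_mean T (\<lambda>t. x t - y t) = time_mean T x - time_mean T y"
  by (simp add: time_mean_def sum_subtractf scaleR_right_diff_distrib)

lemma time_mean_const: "T \<ge> 1 \<Longrightarrow> time_mean T (\<lambda>_. c) = c"
  by (simp add: time_mean_def sum_constant_scaleR del: sum_constant)

lemma time_mean_nth: "time_mean T x $ k = time_mean T (\<lambda>t. x t $ k)"
  by (simp add: time_mean_def)

lemma time_mean_sum: "time_mean T (\<lambda>t. \<Sum>i\<in>I. x i t) = (\<Sum>i\<in>I. time_mean T (x i))"
  by (simp add: time_mean_def scaleR_sum_right sum.swap[of _ I])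

lemma time_mean_mult_right: "time_mean T (\<lambda>t. x t * c) = time_mean T x * c" for x :: "int \<Rightarrow> real"
  by (simp add: time_mean_def sum_distrib_left mult_ac)

lemma time_mean_quadratic_form:
  fixes f :: "int \<Rightarrow> real^'k"
  assumes T: "T \<ge> 1"
  defines "Q \<equiv> \<chi> j k. time_mean T (\<lambda>t. f t $ j * f t $ k) - time_mean T f $ j * time_mean T f $ k"
  shows "time_mean T (\<lambda>t. ((f t - time_mean T f) \<bullet> v)\<^sup>2) = v \<bullet> (Q *v v)"
proof -
  let ?g = "\<lambda>t. f t - time_mean T f"
  have Q: "time_mean T (\<lambda>t. ?g t $ j * ?g t $ k) = Q $ j $ k" for j k
  proof -
    have "time_mean T (\<lambda>t. ?g t $ j * ?g t $ k) = time_mean T (\<lambda>t. f t $ j * f t $ k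
        - f t $ j * time_mean T f $ k - f t $ k * time_mean T f $ j + time_mean T f $ j * time_mean T f $ k)"
      by (simp add: algebra_simps)
    also have "\<dots> = Q $ j $ k"
      by (simp add: time_mean_add time_mean_diff time_mean_mult_right time_mean_const[OF T] time_mean_nth[symmetric] Q_def)
    finally show ?thesis .
  qed
  have "time_mean T (\<lambda>t. (?g t \<bullet> v)\<^sup>2) = time_mean T (\<lambda>t. \<Sum>j\<in>UNIV. \<Sum>k\<in>UNIV. (?g t $ j * ?g t $ k) * (v $ j * v $ k))"
    by (simp add: inner_vec_def power2_eq_square sum_product mult_ac)
  also have "\<dots> = (\<Sum>j\<in>UNIV. \<Sum>k\<in>UNIV. Q $ j $ k * (v $ j * v $ k))"
    by (simp only: time_mean_sum time_mean_mult_right Q)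
  also have "\<dots> = v \<bullet> (Q *v v)"
    by (simp add: inner_vec_def matrix_vector_mult_def sum_distrib_left mult_ac)
  finally show ?thesis .
qed

abbreviation ols_bounds :: "nat \<Rightarrow> real \<Rightarrow> (nat \<Rightarrow> int \<Rightarrow> real) \<Rightarrow> (int \<Rightarrow> real^'k) \<Rightarrow> (nat \<Rightarrow> real) \<Rightarrow>
    real \<Rightarrow> real \<Rightarrow> real \<Rightarrow> bool" where
  "ols_bounds T \<gamma> y f \<alpha> e lo hi \<equiv> \<forall>i\<ge>1. real i \<le> real T powr \<gamma> \<longrightarrow> \<bar>ols_alpha T (y i) f - \<alpha> i\<bar> \<le> e \<and>
    lo \<le> time_mean T (\<lambda>t. (ols_resid T (y i) f t)\<^sup>2) \<and> time_mean T (\<lambda>t. (ols_resid T (y i) f t)\<^sup>2) \<le> hi"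

text \<open>The deterministic half of the estimation argument. Sample second moments of f approach
  the population ones, so the sample covariance matrix is eventually coercive with l/2. The slope
  errors are then of order T^(-\<rho>), and so are the intercept errors; the mean squared residuals
  stay close to \<open>\<sigma> i\<close>, all uniformly in the admissible i.\<close>

lemma ols_path_bounds:
  fixes f :: "int \<Rightarrow> real^'k" and u y :: "nat \<Rightarrow> int \<Rightarrow> real" and m :: "'k \<Rightarrow> real" and R :: "'k \<Rightarrow> 'k \<Rightarrow> real"
  assumes y: "\<And>i t. i \<ge> 1 \<Longrightarrow> y i t = \<alpha> i + \<beta> i \<bullet> f t + u i t"
    and l: "l > 0" "\<And>v. l * (norm v)\<^sup>2 \<le> v \<bullet> ((\<chi> j k. R j k - m j * m k) *v v)"
    and \<rho>: "\<rho> > 0" and \<gamma>: "\<gamma> \<ge> 0" and s: "0 < s1" "\<And>i. i \<ge> 1 \<Longrightarrow> s1 \<le> \<sigma> i" "\<And>i. i \<ge> 1 \<Longrightarrow> \<sigma> i \<le> s2"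
    and u1: "uniform_rate \<gamma> \<rho> (\<lambda>T i. time_mean T (u i))"
    and uf: "\<And>k. uniform_rate \<gamma> \<rho> (\<lambda>T i. time_mean T (\<lambda>t. u i t * f t $ k))"
    and u2: "uniform_rate \<gamma> \<rho> (\<lambda>T i. time_mean T (\<lambda>t. (u i t)\<^sup>2) - \<sigma> i)"
    and f1: "\<And>k. \<forall>\<^sub>F T in sequentially. \<bar>time_mean T (\<lambda>t. f t $ k) - m k\<bar> \<le> real T powr (- \<rho>)"
    and f2: "\<And>j k. \<forall>\<^sub>F T in sequentially. \<bar>time_mean T (\<lambda>t. f t $ j * f t $ k) - R j k\<bar> \<le> real T powr (- \<rho>)"
  obtains C where "C > 0" "\<forall>\<^sub>F T in sequentially. ols_bounds T \<gamma> y f \<alpha> (C * real T powr (- \<rho>)) (s1 / 2) (s2 + 1)"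
proof -
  define K where "K = real CARD('k)"
  \<comment> \<open>Once T^(-\<rho>) < 1, this bounds every coordinate of the factor mean and also
    its norm.\<close>
  define B where "B = (\<Sum>k\<in>UNIV. \<bar>m k\<bar> + 1)"
  \<comment> \<open>The 1 is for the mean of the errors, the other term for the slope error 2(K +
    B)/l times the norm of the factor mean.\<close>
  define C where "C = 1 + 2 * (K + B) * B / l"
  have K: "K \<ge> 0" by (simp add: K_def)
  have mB: "\<bar>m k\<bar> + 1 \<le> B" for k
    unfolding B_def by (rule member_le_sum) auto
  have B: "B \<ge> 0" using mB[of undefined] abs_ge_zero[of "m undefined"] by linarith
  have C: "C > 0" using K B l by (simp add: C_def add_pos_nonneg)
  have e0: "(\<lambda>T::nat. real T powr (- \<rho>)) \<longlonglongrightarrow> 0" using \<rho> by real_asymp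
  have small: "\<forall>\<^sub>F T in sequentially. real T powr (- \<rho>) < d" if "d > 0" for d
    using order_tendstoD(2)[OF e0 that] .
  have s2': "(\<lambda>T::nat. real T powr (- \<rho>) + (real T powr (- \<rho>))\<^sup>2 + 2 * (K + B)\<^sup>2 / l * (real T powr (- \<rho>))\<^sup>2) \<longlonglongrightarrow> 0 + 0\<^sup>2 + 2 * (K + B)\<^sup>2 / l * 0\<^sup>2"
    by (intro tendsto_intros e0)
  \<comment> \<open>The three terms bound the deviations of the mean squared residual from
    \<open>\<sigma> i\<close>: the error of the second moment, the squared mean of u, and b .
    r.\<close>
  have small2: "\<forall>\<^sub>F T in sequentially. real T powr (- \<rho>) + (real T powr (- \<rho>))\<^sup>2 + 2 * (K + B)\<^sup>2 / l * (real T powr (- \<rho>))\<^sup>2 < s1 / 2"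
    by (rule order_tendstoD(2)[OF s2']) (use s in simp)
  have f1': "\<forall>\<^sub>F T in sequentially. \<forall>k. \<bar>time_mean T (\<lambda>t. f t $ k) - m k\<bar> \<le> real T powr (- \<rho>)"
    using f1 by (intro eventually_all_finite)
  have f2': "\<forall>\<^sub>F T in sequentially. \<forall>j k. \<bar>time_mean T (\<lambda>t. f t $ j * f t $ k) - R j k\<bar> \<le> real T powr (- \<rho>)"
    using f2 by (intro eventually_all_finite)
  have uf': "\<forall>\<^sub>F T in sequentially. \<forall>k. \<forall>i\<ge>1. real i \<le> real T powr \<gamma> \<longrightarrow>
        \<bar>time_mean T (\<lambda>t. u i t * f t $ k)\<bar> \<le> real T powr (- \<rho>)"
    using uf by (intro eventually_all_finite)
  \<comment> \<open>Below this threshold for T^(-\<rho>) the covariance error consumes at most half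
    of the coercivity constant.\<close>
  have d: "0 < l / 2 / (K\<^sup>2 * (1 + 2 * B) + 1)" using l K B by (intro divide_pos_pos add_nonneg_pos mult_nonneg_nonneg) auto
  have "\<forall>\<^sub>F T in sequentially. ols_bounds T \<gamma> y f \<alpha> (C * real T powr (- \<rho>)) (s1 / 2) (s2 + 1)"
    using eventually_ge_at_top[of 1] u1 uf' u2 f1' f2' small[OF d] small[of 1, OF zero_less_one] small2
  proof eventually_elim
    case (elim T)
    let ?fb = "time_mean T f" and ?e = "real T powr (- \<rho>)"
    define Q where "Q = (\<chi> j k. time_mean T (\<lambda>t. f t $ j * f t $ k) - ?fb $ j * ?fb $ k)"
    have fb: "\<bar>?fb $ k - m k\<bar> \<le> ?e" for k using elim(5) by (simp add: time_mean_nth)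
    have fbB: "\<bar>?fb $ k\<bar> \<le> B" for k using fb[of k] mB[of k] elim(8) by linarith
    have nfb: "norm ?fb \<le> B"
    proof -
      have "norm ?fb \<le> (\<Sum>k\<in>UNIV. \<bar>?fb $ k\<bar>)" by (rule norm_le_l1_cart)
      also have "\<dots> \<le> B" unfolding B_def
      proof (rule sum_mono)
        fix k show "\<bar>?fb $ k\<bar> \<le> \<bar>m k\<bar> + 1" using fb[of k] elim(8) by linarith
      qed
      finally show ?thesis .
    qed
    have Qd: "\<bar>Q $ j $ k - (\<chi> j k. R j k - m j * m k) $ j $ k\<bar> \<le> ?e * (1 + 2 * B)" for j k
    proof -
      have "\<bar>?fb $ j * ?fb $ k - m j * m k\<bar> = \<bar>?fb $ j * (?fb $ k - m k) + (?fb $ j - m j) * m k\<bar>"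
        by (simp add: algebra_simps)
      also have "\<dots> \<le> \<bar>?fb $ j\<bar> * \<bar>?fb $ k - m k\<bar> + \<bar>?fb $ j - m j\<bar> * \<bar>m k\<bar>"
        by (rule order.trans[OF abs_triangle_ineq]) (simp add: abs_mult)
      also have "\<dots> \<le> B * ?e + ?e * B"
        using fb fbB mB[of k] B by (intro add_mono mult_mono) auto
      finally have "\<bar>?fb $ j * ?fb $ k - m j * m k\<bar> \<le> 2 * (?e * B)" by (simp add: mult_ac)
      moreover have "\<bar>time_mean T (\<lambda>t. f t $ j * f t $ k) - R j k\<bar> \<le> ?e" using elim(6) by blast
      ultimately show ?thesis by (simp add: Q_def distrib_left mult_ac)
    qed
    have pd: "l / 2 * (norm v)\<^sup>2 \<le> time_mean T (\<lambda>t. ((f t - ?fb) \<bullet> v)\<^sup>2)" for v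
    proof -
      have "\<bar>v \<bullet> (Q *v v) - v \<bullet> ((\<chi> j k. R j k - m j * m k) *v v)\<bar> \<le> K\<^sup>2 * (?e * (1 + 2 * B)) * (norm v)\<^sup>2"
        unfolding K_def by (rule quadratic_form_diff_le) (rule Qd)
      moreover have "K\<^sup>2 * (?e * (1 + 2 * B)) * (norm v)\<^sup>2 \<le> l / 2 * (norm v)\<^sup>2"
      proof (rule mult_right_mono)
        have "?e * (K\<^sup>2 * (1 + 2 * B) + 1) < l / 2"
          using elim(7) K B by (subst (asm) pos_less_divide_eq) (auto intro!: add_nonneg_pos mult_nonneg_nonneg)
        moreover have "?e * (K\<^sup>2 * (1 + 2 * B) + 1) = K\<^sup>2 * (?e * (1 + 2 * B)) + ?e"
          by (simp add: algebra_simps)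
        ultimately show "K\<^sup>2 * (?e * (1 + 2 * B)) \<le> l / 2"
          using powr_ge_zero[of "real T" "- \<rho>"] by linarith
      qed simp
      moreover note l(2)[of v]
      ultimately have "l / 2 * (norm v)\<^sup>2 \<le> v \<bullet> (Q *v v)" by (simp add: abs_le_iff)
      then show ?thesis unfolding time_mean_quadratic_form[OF elim(1)] Q_def .
    qed
    show ?case
    proof (intro allI impI)
      fix i assume i: "i \<ge> 1" "real i \<le> real T powr \<gamma>"
      define r where "r = time_mean T (\<lambda>t. u i t *\<^sub>R f t) - time_mean T (u i) *\<^sub>R ?fb"
      obtain b where b: "l / 2 * norm b \<le> norm r" "0 \<le> b \<bullet> r"
        "ols_alpha T (y i) f = \<alpha> i + time_mean T (u i) - b \<bullet> ?fb"
        "time_mean T (\<lambda>t. (ols_resid T (y i) f t)\<^sup>2) = time_mean T (\<lambda>t. (u i t)\<^sup>2) - (time_mean T (u i))\<^sup>2 - b \<bullet> r"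
        unfolding r_def
      proof (rule ols_decomposition[where y = "y i" and u = "u i" and \<alpha> = "\<alpha> i" and \<beta> = "\<beta> i" and f = f and T = T and l = "l / 2"])
        show "T \<ge> 1" "l / 2 > 0" using elim(1) l(1) by auto
        show "y i t = \<alpha> i + \<beta> i \<bullet> f t + u i t" for t by (rule y[OF i(1)])
      qed (use pd in blast)+
      have ub: "\<bar>time_mean T (u i)\<bar> \<le> ?e" using elim(2) i by blast
      have "norm (time_mean T (\<lambda>t. u i t *\<^sub>R f t)) \<le> (\<Sum>k\<in>UNIV. \<bar>time_mean T (\<lambda>t. u i t *\<^sub>R f t) $ k\<bar>)"
        by (rule norm_le_l1_cart)
      also have "\<dots> \<le> (\<Sum>k\<in>(UNIV :: 'k set). ?e)"
        using elim(3) i by (intro sum_mono) (simp add: time_mean_nth)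
      finally have "norm (time_mean T (\<lambda>t. u i t *\<^sub>R f t)) \<le> K * ?e" by (simp add: K_def)
      moreover have "norm (time_mean T (u i) *\<^sub>R ?fb) \<le> ?e * B"
        using ub nfb by (simp add: mult_mono)
      ultimately have r: "norm r \<le> (K + B) * ?e"
        unfolding r_def using norm_triangle_ineq4[of "time_mean T (\<lambda>t. u i t *\<^sub>R f t)" "time_mean T (u i) *\<^sub>R ?fb"]
        by (simp add: algebra_simps)
      have nb: "norm b \<le> 2 * ((K + B) * ?e) / l"
        using b(1) r l(1) by (simp add: field_simps)
      have "\<bar>b \<bullet> ?fb\<bar> \<le> norm b * norm ?fb" by (rule Cauchy_Schwarz_ineq2)
      also have "\<dots> \<le> 2 * ((K + B) * ?e) / l * B" using nb nfb by (intro mult_mono) (auto intro: order.trans[OF norm_ge_zero])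
      finally have "\<bar>ols_alpha T (y i) f - \<alpha> i\<bar> \<le> ?e + 2 * ((K + B) * ?e) / l * B"
        unfolding b(3) using ub by linarith
      also have "\<dots> = C * ?e" by (simp add: C_def algebra_simps)
      finally have 1: "\<bar>ols_alpha T (y i) f - \<alpha> i\<bar> \<le> C * ?e" .
      have "b \<bullet> r \<le> norm b * norm r" by (rule norm_cauchy_schwarz)
      also have "\<dots> \<le> 2 * ((K + B) * ?e) / l * ((K + B) * ?e)" using nb r by (intro mult_mono) (auto intro: order.trans[OF norm_ge_zero])
      also have "2 * (q * e) / l * (q * e) = 2 * q\<^sup>2 / l * e\<^sup>2" for q e by (simp add: power2_eq_square mult_ac)
      finally have br: "b \<bullet> r \<le> 2 * (K + B)\<^sup>2 / l * ?e\<^sup>2" .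
      have "(time_mean T (u i))\<^sup>2 \<le> ?e\<^sup>2" using power_mono[OF ub, of 2] by simp
      moreover have "\<bar>time_mean T (\<lambda>t. (u i t)\<^sup>2) - \<sigma> i\<bar> \<le> ?e" using elim(4) i by blast
      moreover have "0 \<le> (time_mean T (u i))\<^sup>2" by simp
      ultimately show "\<bar>ols_alpha T (y i) f - \<alpha> i\<bar> \<le> C * ?e \<and> s1 / 2 \<le> time_mean T (\<lambda>t. (ols_resid T (y i) f t)\<^sup>2) \<and>
          time_mean T (\<lambda>t. (ols_resid T (y i) f t)\<^sup>2) \<le> s2 + 1"
        using 1 br b(2) elim(8,9) s(2,3)[OF i(1)] unfolding b(4) by linarith
    qed
  qed
  with C show thesis by (rule that)
qed

section \<open>Size of the scale estimate and of the perturbations\<close>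

lemma s_hat_bounds:
  assumes N: "N \<ge> 1" and T: "T \<ge> 1"
    and b: "\<And>i. i \<in> {1..N} \<Longrightarrow> lo \<le> time_mean T (\<lambda>t. (ols_resid T (y i) f t)\<^sup>2) \<and>
        time_mean T (\<lambda>t. (ols_resid T (y i) f t)\<^sup>2) \<le> hi"
  shows "sqrt lo \<le> s_hat N T y f" "s_hat N T y f \<le> sqrt hi"
proof -
  have eq: "1 / (real N * real T) * (\<Sum>i = 1..N. \<Sum>t = 1..int T. (ols_resid T (y i) f t)\<^sup>2)
      = (\<Sum>i = 1..N. time_mean T (\<lambda>t. (ols_resid T (y i) f t)\<^sup>2)) / real N"
    by (simp add: time_mean_def sum_distrib_left sum_divide_distrib mult.commute[of "real T"])
  have "real N * lo \<le> (\<Sum>i = 1..N. time_mean T (\<lambda>t. (ols_resid T (y i) f t)\<^sup>2))"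
    using sum_mono[of "{1..N}" "\<lambda>_. lo" "\<lambda>i. time_mean T (\<lambda>t. (ols_resid T (y i) f t)\<^sup>2)"] b by simp
  moreover have "(\<Sum>i = 1..N. time_mean T (\<lambda>t. (ols_resid T (y i) f t)\<^sup>2)) \<le> real N * hi"
    using sum_mono[of "{1..N}" "\<lambda>i. time_mean T (\<lambda>t. (ols_resid T (y i) f t)\<^sup>2)" "\<lambda>_. hi"] b by simp
  ultimately show "sqrt lo \<le> s_hat N T y f" "s_hat N T y f \<le> sqrt hi"
    unfolding s_hat_def eq using N by (auto simp: field_simps)
qed

text \<open>The scaling T^(1/\<nu>) cancels against the rate of the intercept and leaves
  T^(-\<delta>) to be raised to the power \<nu>/2.\<close>

lemma psi_upper:
  assumes "\<nu> > 0" "T \<ge> 1" "C \<ge> 0" "\<bar>ols_alpha T (y i) f\<bar> \<le> C * real T powr (- (1 / \<nu> + \<delta>))" "0 < s" "s \<le> s_hat N T y f"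
  shows "psi \<nu> N T y f i \<le> (C / s) powr (\<nu> / 2) * real T powr (- (\<delta> * \<nu> / 2))"
proof -
  have "\<bar>real T powr (1 / \<nu>) * ols_alpha T (y i) f / s_hat N T y f\<bar>
      = real T powr (1 / \<nu>) * \<bar>ols_alpha T (y i) f\<bar> / s_hat N T y f"
    using assms by (simp add: abs_mult)
  also have "\<dots> \<le> real T powr (1 / \<nu>) * (C * real T powr (- (1 / \<nu> + \<delta>))) / s"
    using assms by (intro frac_le mult_left_mono) auto
  also have "\<dots> = C / s * real T powr (- \<delta>)"
    using assms by (simp add: powr_add[symmetric] mult_ac powr_diff powr_minus field_simps)
  finally have "psi \<nu> N T y f i \<le> (C / s * real T powr (- \<delta>)) powr (\<nu> / 2)"
    unfolding psi_def using assms by (intro powr_mono2) auto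
  moreover have "(C / s * real T powr (- \<delta>)) powr (\<nu> / 2) = (C / s) powr (\<nu> / 2) * real T powr (- (\<delta> * \<nu> / 2))"
    by (simp only: powr_mult) (simp add: powr_powr)
  ultimately show ?thesis by simp
qed

text \<open>For an intercept bounded away from 0 the scaling survives: T^(1/\<nu>) to the power
  \<nu>/2 is the square root of T.\<close>

lemma psi_lower:
  assumes "\<nu> > 0" "T \<ge> 1" "c > 0" "c \<le> \<bar>ols_alpha T (y i) f\<bar>" "0 < s_hat N T y f" "s_hat N T y f \<le> s"
  shows "(c / s) powr (\<nu> / 2) * real T powr (1 / 2) \<le> psi \<nu> N T y f i"
proof -
  have "real T powr (1 / \<nu>) * c / s \<le> real T powr (1 / \<nu>) * \<bar>ols_alpha T (y i) f\<bar> / s_hat N T y f"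
    using assms by (intro frac_le mult_left_mono) auto
  also have "\<dots> = \<bar>real T powr (1 / \<nu>) * ols_alpha T (y i) f / s_hat N T y f\<bar>"
    using assms by (simp add: abs_mult)
  finally have "(real T powr (1 / \<nu>) * c / s) powr (\<nu> / 2) \<le> psi \<nu> N T y f i"
    unfolding psi_def using assms by (intro powr_mono2) auto
  moreover have "(real T powr (1 / \<nu>) * c / s) powr (\<nu> / 2) = (c / s) powr (\<nu> / 2) * real T powr (1 / 2)"
    using assms by (simp add: powr_mult powr_divide powr_powr)
  ultimately show ?thesis by simp
qed

subsection \<open>Measurability of the test statistic\<close>

lemma borel_measurable_det:
  fixes A :: "'a \<Rightarrow> real^'n^'n"
  assumes "\<And>i j. (\<lambda>\<omega>. A \<omega> $ i $ j) \<in> borel_measurable G"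
  shows "(\<lambda>\<omega>. det (A \<omega>)) \<in> borel_measurable G"
  unfolding det_def by (intro borel_measurable_sum borel_measurable_times borel_measurable_prod assms) auto

text \<open>
  Cramer's rule on the regular matrices; on the singular ones \<open>matrix_inv\<close> is a fixed matrix, the
  choice from the empty predicate.
\<close>
lemma borel_measurable_matrix_inv_mult:
  fixes A :: "'a \<Rightarrow> real^'n^'n" and v :: "'a \<Rightarrow> real^'n"
  assumes A: "\<And>i j. (\<lambda>\<omega>. A \<omega> $ i $ j) \<in> borel_measurable G"
    and v: "\<And>i. (\<lambda>\<omega>. v \<omega> $ i) \<in> borel_measurable G"
  shows "(\<lambda>\<omega>. (matrix_inv (A \<omega>) *v v \<omega>) $ k) \<in> borel_measurable G"
proof -
  define c :: "real^'n^'n" where "c = (SOME B. False)"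
  have eq: "(matrix_inv (A \<omega>) *v v \<omega>) $ k = (if det (A \<omega>) = 0 then (\<Sum>j\<in>UNIV. c $ k $ j * v \<omega> $ j)
      else det (\<chi> i j. if j = k then v \<omega> $ i else A \<omega> $ i $ j) / det (A \<omega>))" for \<omega>
  proof (cases "det (A \<omega>) = 0")
    case True
    then have "\<not> (\<exists>B. A \<omega> ** B = mat 1 \<and> B ** A \<omega> = mat 1)"
      by (simp add: invertible_def[symmetric] invertible_det_nz)
    then have "(\<lambda>B. A \<omega> ** B = mat 1 \<and> B ** A \<omega> = mat 1) = (\<lambda>_. False)" by auto
    then have "matrix_inv (A \<omega>) = c" unfolding matrix_inv_def c_def by simp
    then show ?thesis using True by (simp add: matrix_vector_mult_def)
  next
    case False
    have "A \<omega> *v (matrix_inv (A \<omega>) *v v \<omega>) = v \<omega>"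
      by (simp add: matrix_vector_mul_assoc matrix_inv_left_right_det(1)[OF False])
    then show ?thesis using False by (simp add: cramer[OF False])
  qed
  have "(\<lambda>\<omega>. det (\<chi> i j. if j = k then v \<omega> $ i else A \<omega> $ i $ j)) \<in> borel_measurable G"
  proof (rule borel_measurable_det)
    fix i j
    show "(\<lambda>\<omega>. (\<chi> i j. if j = k then v \<omega> $ i else A \<omega> $ i $ j) $ i $ j) \<in> borel_measurable G"
      using A[of i j] v[of i] by (cases "j = k") auto
  qed
  moreover note borel_measurable_det[OF A]
  ultimately show ?thesis unfolding eq using v by measurable
qed

text \<open>Measurability is assumed at the times 1 to T only, because G will be the
  \<sigma>-algebra of a finite sample. Vectors are handled coordinate by coordinate.\<close>

context
  fixes G :: "'a measure" and T :: nat and f :: "int \<Rightarrow> 'a \<Rightarrow> real^'k"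
  assumes f: "\<And>t. t \<in> {1..int T} \<Longrightarrow> f t \<in> borel_measurable G"
begin

lemma f_nth_measurable: "t \<in> {1..int T} \<Longrightarrow> (\<lambda>\<omega>. f t \<omega> $ k) \<in> borel_measurable G"
  using measurable_compose[OF f, of t "\<lambda>v. v $ k"]
  by (auto intro: borel_measurable_continuous_onI continuous_intros)

lemma time_mean_f_nth_measurable: "(\<lambda>\<omega>. time_mean T (\<lambda>t. f t \<omega>) $ k) \<in> borel_measurable G"
  unfolding time_mean_def using f_nth_measurable by auto

lemma ols_slope_nth_measurable:
  assumes y: "\<And>t. t \<in> {1..int T} \<Longrightarrow> y t \<in> borel_measurable G"
  shows "(\<lambda>\<omega>. ols_slope T (\<lambda>t. y t \<omega>) (\<lambda>t. f t \<omega>) $ k) \<in> borel_measurable G"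
  unfolding ols_slope_def
proof (rule borel_measurable_matrix_inv_mult)
  fix i j
  show "(\<lambda>\<omega>. (\<Sum>t = 1..int T. outer_square (f t \<omega> - time_mean T (\<lambda>t. f t \<omega>))) $ i $ j) \<in> borel_measurable G"
    unfolding outer_square_def using f_nth_measurable time_mean_f_nth_measurable by simp
  show "(\<lambda>\<omega>. (\<Sum>t = 1..int T. y t \<omega> *\<^sub>R (f t \<omega> - time_mean T (\<lambda>t. f t \<omega>))) $ i) \<in> borel_measurable G"
    using f_nth_measurable time_mean_f_nth_measurable y by simp
qed

lemma ols_alpha_measurable:
  assumes y: "\<And>t. t \<in> {1..int T} \<Longrightarrow> y t \<in> borel_measurable G"
  shows "(\<lambda>\<omega>. ols_alpha T (\<lambda>t. y t \<omega>) (\<lambda>t. f t \<omega>)) \<in> borel_measurable G"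
proof -
  have "(\<lambda>\<omega>. time_mean T (\<lambda>t. y t \<omega>)) \<in> borel_measurable G"
    unfolding time_mean_def using y by auto
  then show ?thesis
    unfolding ols_alpha_def inner_vec_def using ols_slope_nth_measurable[OF y] time_mean_f_nth_measurable by simp
qed

lemma ols_resid_measurable:
  assumes y: "\<And>t. t \<in> {1..int T} \<Longrightarrow> y t \<in> borel_measurable G" and t: "t \<in> {1..int T}"
  shows "(\<lambda>\<omega>. ols_resid T (\<lambda>t. y t \<omega>) (\<lambda>t. f t \<omega>) t) \<in> borel_measurable G"
  unfolding ols_resid_def inner_vec_def
  using ols_alpha_measurable[OF y] ols_slope_nth_measurable[OF y] y[OF t] f_nth_measurable[OF t] by simp

lemma psi_measurable:
  assumes y: "\<And>i t. i \<in> {1..N} \<Longrightarrow> t \<in> {1..int T} \<Longrightarrow> y i t \<in> borel_measurable G" and i: "i \<in> {1..N}"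
  shows "(\<lambda>\<omega>. psi \<nu> N T (\<lambda>i t. y i t \<omega>) (\<lambda>t. f t \<omega>) i) \<in> borel_measurable G"
proof -
  have "(\<lambda>\<omega>. s_hat N T (\<lambda>i t. y i t \<omega>) (\<lambda>t. f t \<omega>)) \<in> borel_measurable G"
    unfolding s_hat_def using ols_resid_measurable[OF y] by simp
  then show ?thesis unfolding psi_def using ols_alpha_measurable[OF y[OF i]] by simp
qed

end

subsection \<open>The conditional law of the statistic\<close>

lemma space_sample_algebra [simp]: "space (sample_algebra M u f N T) = space M"
  unfolding sample_algebra_def by (rule space_measure_of) auto

lemma measurable_sample_algebra:
  shows "i \<in> {1..N} \<Longrightarrow> t \<in> {1..int T} \<Longrightarrow> u i t \<in> borel_measurable (sample_algebra M u f N T)"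
    and "t \<in> {1..int T} \<Longrightarrow> f t \<in> borel_measurable (sample_algebra M u f N T)"
proof -
  let ?B = "{u i t -` A \<inter> space M | i t A. i \<in> {1..N} \<and> t \<in> {1..int T} \<and> A \<in> sets borel} \<union>
      {f t -` A \<inter> space M | t A. t \<in> {1..int T} \<and> A \<in> sets borel}"
  have sub: "?B \<subseteq> Pow (space M)" by auto
  have B: "b \<in> sets (sample_algebra M u f N T)" if "b \<in> ?B" for b
    unfolding sample_algebra_def sets_measure_of[OF sub] using that by (rule sigma_sets.Basic)
  show "u i t \<in> borel_measurable (sample_algebra M u f N T)" if "i \<in> {1..N}" "t \<in> {1..int T}"
    by (rule measurableI) (use that in \<open>auto intro!: B\<close>)
  show "f t \<in> borel_measurable (sample_algebra M u f N T)" if "t \<in> {1..int T}"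
    by (rule measurableI) (use that in \<open>auto intro!: B\<close>)
qed

lemma subalgebra_sample_algebra:
  assumes "\<And>i t. i \<in> {1..N} \<Longrightarrow> u i t \<in> borel_measurable M" "\<And>t. f t \<in> borel_measurable M"
  shows "subalgebra M (sample_algebra M u f N T)"
  unfolding subalgebra_def
proof
  show "sets (sample_algebra M u f N T) \<subseteq> sets M"
    unfolding sample_algebra_def
    by (subst sets_measure_of) (use assms in \<open>auto intro!: sets.sigma_sets_subset measurable_sets\<close>)
qed simp

lemma borel_measurable_Phi: "Phi \<in> borel_measurable borel"
  by (rule borel_measurable_mono) (auto simp: mono_def std_normal.cdf_nondecreasing)

text \<open>Independence makes the joint law of the normal vector and the sample a product measure.
  By Fubini's theorem the sample, hence every g, can be frozen; the inner integral is then the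
  measure of a box under a product of normal laws. Testing against all A in G identifies the
  conditional expectation.\<close>

lemma (in prob_space) cond_prob_all_le:
  fixes w g :: "nat \<Rightarrow> 'a \<Rightarrow> real"
  assumes G: "subalgebra M G"
    and g: "\<And>i. i \<in> {1..N} \<Longrightarrow> g i \<in> borel_measurable G"
    and w_indep: "indep_vars (\<lambda>_. borel) w {1..}"
    and w_normal: "\<And>i. i \<ge> 1 \<Longrightarrow> distributed M lborel (w i) (\<lambda>x. ennreal (std_normal_density x))"
    and ind: "indep_set (sets (generated_algebra M borel w {1..N})) (sets G)"
    and N: "N \<ge> 1"
  shows "AE \<omega> in M. real_cond_exp M G (indicator {\<omega> \<in> space M. \<forall>i\<in>{1..N}. g i \<omega> + w i \<omega> \<le> c}) \<omega>
      = (\<Prod>i = 1..N. Phi (c - g i \<omega>))"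
proof -
  let ?I = "{1..N}"
  let ?Q = "PiM ?I (\<lambda>_. borel :: real measure)"
  let ?P = "PiM ?I (\<lambda>_. std_normal_distribution)"
  let ?W = "\<lambda>\<omega>. \<lambda>i\<in>?I. w i \<omega>"
  interpret fm: finite_measure_subalgebra M G by unfold_locales (rule G)
  have spG: "space G = space M" and setsG: "sets G \<subseteq> events" using G by (auto simp: subalgebra_def)
  have wm: "w i \<in> borel_measurable M" if "i \<ge> 1" for i
    using w_normal[OF that] by (auto simp: distributed_def)
  have Wm [measurable]: "?W \<in> M \<rightarrow>\<^sub>M ?Q" by (intro measurable_restrict wm) auto
  \<comment> \<open>The identity map into the coarser G is a random element that carries the whole
    sample, so one pair describes everything relevant.\<close>
  have idm [measurable]: "(\<lambda>\<omega>. \<omega>) \<in> M \<rightarrow>\<^sub>M G" using setsG by (intro measurableI) (auto simp: spG)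
  have gM [measurable]: "g i \<in> borel_measurable M" if "i \<in> ?I" for i
    using measurable_from_subalg[OF G g[OF that]] .
  have dw: "distr M borel (w i) = std_normal_distribution" if "i \<ge> 1" for i
  proof -
    have "distr M borel (w i) = distr M lborel (w i)" by (rule distr_cong) auto
    then show ?thesis using w_normal[OF that] by (simp add: distributed_def)
  qed
  have dW: "distr M ?Q ?W = ?P"
  proof -
    have "indep_vars (\<lambda>_. borel) w ?I" using w_indep by (rule indep_vars_subset) auto
    then have "distr M ?Q ?W = PiM ?I (\<lambda>i. distr M borel (w i))"
      using indep_vars_iff_distr_eq_PiM'[of ?I w "\<lambda>_. borel"] N wm by auto
    also have "\<dots> = ?P" by (rule PiM_cong) (auto simp: dw)
    finally show ?thesis .
  qed
  have joint: "distr M (?Q \<Otimes>\<^sub>M G) (\<lambda>\<omega>. (?W \<omega>, \<omega>)) = ?P \<Otimes>\<^sub>M distr M G (\<lambda>\<omega>. \<omega>)"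
    unfolding dW[symmetric]
  proof (rule distr_pair_indep_set[OF Wm idm ind])
    have Wg: "?W \<in> generated_algebra M borel w ?I \<rightarrow>\<^sub>M ?Q"
      by (intro measurable_restrict measurable_generated_algebra wm) auto
    show "?W -` A \<inter> space M \<in> sets (generated_algebra M borel w ?I)" if "A \<in> sets ?Q" for A
      using measurable_sets[OF Wg that] by simp
    show "(\<lambda>\<omega>. \<omega>) -` A \<inter> space M \<in> sets G" if "A \<in> sets G" for A
      using that sets.sets_into_space[OF that] spG by (simp add: Int_absorb2)
  qed
  let ?MG = "distr M G (\<lambda>\<omega>. \<omega>)"
  interpret MG: prob_space ?MG by (rule prob_space_distr[OF idm])
  interpret P: prob_space ?P by (rule prob_space_PiM) (rule std_normal.prob_space_axioms)
  interpret PM: pair_prob_space ?P ?MG ..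
  interpret prod: product_prob_space "\<lambda>_. std_normal_distribution" ?I
    by unfold_locales
  let ?E = "{\<omega> \<in> space M. \<forall>i\<in>?I. g i \<omega> + w i \<omega> \<le> c}"
  have E: "?E \<in> events"
    using wm N by (intro sets.sets_Collect_finite_All') auto
  have Gprod: "(\<lambda>\<omega>. \<Prod>i = 1..N. Phi (c - g i \<omega>)) \<in> borel_measurable G"
    using g by (intro borel_measurable_prod measurable_compose[OF _ borel_measurable_Phi]) auto
  have bnd: "\<bar>\<Prod>i = 1..N. Phi (c - g i \<omega>)\<bar> \<le> 1" for \<omega>
    using std_normal.cdf_nonneg std_normal.cdf_bounded_prob by (auto simp: abs_prod intro!: prod_le_1)
  show ?thesis
  proof (rule fm.real_cond_exp_charact)
    show "integrable M (indicator ?E :: 'a \<Rightarrow> real)" using E by (simp add: integrable_indicator_iff emeasure_eq_measure)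
    show "(\<lambda>\<omega>. \<Prod>i = 1..N. Phi (c - g i \<omega>)) \<in> borel_measurable G" by (rule Gprod)
    show "integrable M (\<lambda>\<omega>. \<Prod>i = 1..N. Phi (c - g i \<omega>))"
      by (rule integrable_const_bound[where B = 1]) (use bnd measurable_from_subalg[OF G Gprod] in auto)
    fix A assume A: "A \<in> sets G"
    define F where "F = (\<lambda>v \<omega>. indicator A \<omega> * (if \<forall>i\<in>?I. v i \<le> c - g i \<omega> then 1 else 0 :: real))"
    have Fm: "(\<lambda>(v, \<omega>). F v \<omega>) \<in> borel_measurable (?Q \<Otimes>\<^sub>M G)"
    proof -
      have [measurable]: "A \<in> sets G" by fact
      have "{q \<in> space (?Q \<Otimes>\<^sub>M G). \<forall>i\<in>?I. fst q i \<le> c - g i (snd q)} \<in> sets (?Q \<Otimes>\<^sub>M G)"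
      proof (intro sets.sets_Collect_finite_All')
        fix i assume i: "i \<in> ?I"
        have "(\<lambda>q. fst q i) \<in> borel_measurable (?Q \<Otimes>\<^sub>M G)"
          using i by measurable
        moreover have "(\<lambda>q. c - g i (snd q)) \<in> borel_measurable (?Q \<Otimes>\<^sub>M G)"
          using measurable_compose[OF measurable_snd g[OF i]] by measurable
        ultimately show "{q \<in> space (?Q \<Otimes>\<^sub>M G). fst q i \<le> c - g i (snd q)} \<in> sets (?Q \<Otimes>\<^sub>M G)"
          by (rule borel_measurable_le)
      qed (use N in auto)
      then show ?thesis unfolding F_def case_prod_beta by measurable
    qed
    have "(LINT \<omega>:A|M. indicator ?E \<omega>) = (\<integral>\<omega>. F (?W \<omega>) \<omega> \<partial>M)"
      unfolding set_lebesgue_integral_def F_def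
      by (intro Bochner_Integration.integral_cong) (auto simp: indicator_def algebra_simps)
    also have "\<dots> = (\<integral>q. (\<lambda>(v, \<omega>). F v \<omega>) q \<partial>(?P \<Otimes>\<^sub>M ?MG))"
      unfolding joint[symmetric] using Fm measurable_Pair[OF Wm idm] by (subst integral_distr) auto
    also have "\<dots> = (\<integral>\<omega>. (\<integral>v. F v \<omega> \<partial>?P) \<partial>?MG)"
    proof (rule PM.integral_snd[symmetric])
      have "(\<lambda>(v, \<omega>). F v \<omega>) \<in> borel_measurable (?P \<Otimes>\<^sub>M ?MG)"
        using Fm by (simp add: measurable_cong_sets[OF sets_pair_measure_cong[OF sets_PiM_cong[OF refl] sets_distr] refl])
      then show "integrable (?P \<Otimes>\<^sub>M ?MG) (\<lambda>(v, \<omega>). F v \<omega>)"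
        by (intro PM.integrable_const_bound[where B = 1]) (auto simp: F_def indicator_def)
    qed
    also have "\<dots> = (\<integral>\<omega>. indicator A \<omega> * (\<Prod>i = 1..N. Phi (c - g i \<omega>)) \<partial>?MG)"
    proof (intro Bochner_Integration.integral_cong refl)
      fix \<omega>
      have "(\<integral>v. F v \<omega> \<partial>?P) = indicator A \<omega> * (\<integral>v. indicator {v \<in> space ?P. \<forall>i\<in>?I. v i \<in> {..c - g i \<omega>}} v \<partial>?P)"
        unfolding F_def
        by (subst Bochner_Integration.integral_mult_right_zero[symmetric])
          (intro Bochner_Integration.integral_cong, auto simp: indicator_def)
      also have "(\<integral>v. indicator {v \<in> space ?P. \<forall>i\<in>?I. v i \<in> {..c - g i \<omega>}} v \<partial>?P)
          = measure ?P {v \<in> space ?P. \<forall>i\<in>?I. v i \<in> {..c - g i \<omega>}}"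
        by (simp add: Int_absorb2 subset_eq)
      also have "\<dots> = (\<Prod>i = 1..N. Phi (c - g i \<omega>))"
        using prod.emeasure_PiM_Collect[of ?I "\<lambda>i. {..c - g i \<omega>}"]
        unfolding P.emeasure_eq_measure std_normal.emeasure_eq_measure
        by (simp add: prod_ennreal prod_nonneg cdf_def2)
      finally show "(\<integral>v. F v \<omega> \<partial>?P) = indicator A \<omega> * (\<Prod>i = 1..N. Phi (c - g i \<omega>))" .
    qed
    also have "\<dots> = (LINT \<omega>:A|M. \<Prod>i = 1..N. Phi (c - g i \<omega>))"
      unfolding set_lebesgue_integral_def using Gprod A by (subst integral_distr[OF idm]) auto
    finally show "(LINT \<omega>:A|M. indicator ?E \<omega>) = (LINT \<omega>:A|M. \<Prod>i = 1..N. Phi (c - g i \<omega>))" .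
  qed
qed

subsection \<open>Limits along the joint filter\<close>

lemma b_norm_le: "\<forall>\<^sub>F N in sequentially. b_norm N \<le> sqrt (2 * ln (real N))"
  unfolding b_norm_def by real_asymp

lemma a_norm_bounds:
  assumes "b_norm N \<ge> 1"
  shows "1 / (2 * b_norm N) \<le> a_norm N" "0 < a_norm N" "a_norm N \<le> 1"
proof -
  let ?b = "b_norm N"
  have p: "1 + ?b\<^sup>2 > 0" by (simp add: add_pos_nonneg)
  have "1 \<le> ?b\<^sup>2" using assms by (simp add: one_le_power)
  then show "1 / (2 * ?b) \<le> a_norm N"
    using assms p unfolding a_norm_def by (simp add: field_simps power2_eq_square)
  show "0 < a_norm N" using assms p by (simp add: a_norm_def)
  have "?b * 1 \<le> ?b * ?b" using assms by (intro mult_left_mono) auto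
  then have "?b \<le> 1 + ?b\<^sup>2" by (simp add: power2_eq_square)
  then show "a_norm N \<le> 1" using p by (simp add: a_norm_def)
qed

lemma prod_Phi_le_one: "(\<Prod>i\<in>I. Phi (h i)) \<le> 1"
  using std_normal.cdf_nonneg std_normal.cdf_bounded_prob by (intro prod_le_1) auto

text \<open>Nonnegative perturbations can only lower the factors, which gives the upper bound.
  Perturbations up to a_N d amount at most to replacing x by x - d, and d can be taken small by
  continuity of the Gumbel function.\<close>

lemma tendsto_prod_Phi_null:
  fixes \<psi> :: "nat \<Rightarrow> nat \<Rightarrow> nat \<Rightarrow> real" and F :: "(nat \<times> nat) filter"
  assumes N: "filterlim fst at_top F"
    and \<psi>: "\<And>d. d > 0 \<Longrightarrow> \<forall>\<^sub>F (N, T) in F. \<forall>i\<in>{1..N}. 0 \<le> \<psi> N T i \<and> \<psi> N T i \<le> a_norm N * d"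
  shows "((\<lambda>(N, T). \<Prod>i = 1..N. Phi (a_norm N * x + b_norm N - \<psi> N T i)) \<longlongrightarrow> exp (- exp (- x))) F"
proof (rule order_tendstoI)
  have lim: "((\<lambda>q. Phi (a_norm (fst q) * z + b_norm (fst q)) ^ fst q) \<longlongrightarrow> exp (- exp (- z))) F" for z
    using filterlim_compose[OF Phi_power_tendsto N] .
  {
    fix c assume c: "c > exp (- exp (- x))"
    show "\<forall>\<^sub>F q in F. (case q of (N, T) \<Rightarrow> \<Prod>i = 1..N. Phi (a_norm N * x + b_norm N - \<psi> N T i)) < c"
      using order_tendstoD(2)[OF lim c] \<psi>[of 1, OF zero_less_one]
    proof eventually_elim
      case (elim q)
      obtain N T where q: "q = (N, T)" by (cases q)
      have "(\<Prod>i = 1..N. Phi (a_norm N * x + b_norm N - \<psi> N T i)) \<le> (\<Prod>i = 1..N. Phi (a_norm N * x + b_norm N))"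
        using elim(2) unfolding q
        by (intro prod_mono conjI std_normal.cdf_nonneg std_normal.cdf_nondecreasing) auto
      then show ?case using elim(1) by (simp add: q)
    qed
  next
    fix c assume c: "c < exp (- exp (- x))"
    have "((\<lambda>d. exp (- exp (- (x - d)))) \<longlongrightarrow> exp (- exp (- (x - 0)))) (at_right 0)"
      by (intro tendsto_intros)
    then have "\<forall>\<^sub>F d in at_right 0. c < exp (- exp (- (x - d)))" using c by (intro order_tendstoD(1)) auto
    moreover have "\<forall>\<^sub>F d in at_right (0::real). d > 0" by (rule eventually_at_right_less)
    ultimately have "\<forall>\<^sub>F d in at_right (0::real). c < exp (- exp (- (x - d))) \<and> d > 0" by (rule eventually_conj)
    then obtain d where d: "c < exp (- exp (- (x - d)))" "d > 0"
      using eventually_happens[of _ "at_right (0::real)"] by auto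
    show "\<forall>\<^sub>F q in F. c < (case q of (N, T) \<Rightarrow> \<Prod>i = 1..N. Phi (a_norm N * x + b_norm N - \<psi> N T i))"
      using order_tendstoD(1)[OF lim d(1)] \<psi>[OF d(2)]
    proof eventually_elim
      case (elim q)
      obtain N T where q: "q = (N, T)" by (cases q)
      have "(\<Prod>i = 1..N. Phi (a_norm N * (x - d) + b_norm N)) \<le> (\<Prod>i = 1..N. Phi (a_norm N * x + b_norm N - \<psi> N T i))"
        using elim(2) unfolding q
        by (intro prod_mono conjI std_normal.cdf_nonneg std_normal.cdf_nondecreasing) (auto simp: algebra_simps)
      then show ?case using elim(1) by (simp add: q)
    qed
  }
qed

text \<open>All factors lie in [0,1], so the product is at most its j-th factor, which is present as
  soon as N \<ge> j.\<close>

lemma tendsto_prod_Phi_alt: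
  fixes \<psi> :: "nat \<Rightarrow> nat \<Rightarrow> nat \<Rightarrow> real" and F :: "(nat \<times> nat) filter"
  assumes N: "filterlim fst at_top F" and j: "j \<ge> 1"
    and \<psi>: "filterlim (\<lambda>(N, T). a_norm N * x + b_norm N - \<psi> N T j) at_bot F"
  shows "((\<lambda>(N, T). \<Prod>i = 1..N. Phi (a_norm N * x + b_norm N - \<psi> N T i)) \<longlongrightarrow> 0) F"
proof (rule Lim_null_comparison)
  show "((\<lambda>q. Phi ((\<lambda>(N, T). a_norm N * x + b_norm N - \<psi> N T j) q)) \<longlongrightarrow> 0) F"
    by (rule filterlim_compose[OF std_normal.cdf_lim_at_bot \<psi>])
  have "\<forall>\<^sub>F q in F. fst q \<ge> j" using N by (auto simp: filterlim_at_top)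
  then show "\<forall>\<^sub>F q in F. norm (case q of (N, T) \<Rightarrow> \<Prod>i = 1..N. Phi (a_norm N * x + b_norm N - \<psi> N T i))
      \<le> Phi ((\<lambda>(N, T). a_norm N * x + b_norm N - \<psi> N T j) q)"
  proof eventually_elim
    case (elim q)
    obtain N T where q: "q = (N, T)" by (cases q)
    let ?h = "\<lambda>i. a_norm N * x + b_norm N - \<psi> N T i"
    have "(\<Prod>i = 1..N. Phi (?h i)) = Phi (?h j) * (\<Prod>i\<in>{1..N} - {j}. Phi (?h i))"
      using elim j by (intro prod.remove) (auto simp: q)
    also have "\<dots> \<le> Phi (?h j) * 1"
      by (intro mult_left_mono prod_Phi_le_one std_normal.cdf_nonneg)
    finally show ?case using std_normal.cdf_nonneg by (simp add: q abs_prod)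
  qed
qed

section \<open>Growth of the norming constants against powers of T\<close>

lemma eventually_b_norm_bounds:
  fixes F :: "(nat \<times> nat) filter"
  assumes N: "filterlim fst at_top F" and T: "filterlim snd at_top F"
    and NT: "\<forall>\<^sub>F (N, T) in F. real N \<le> real T powr \<gamma>"
  shows "\<forall>\<^sub>F (N, T) in F. 1 \<le> b_norm N \<and> b_norm N \<le> sqrt (2 * (\<gamma> * ln (real T)))"
proof -
  have "\<forall>\<^sub>F q in F. b_norm (fst q) \<le> sqrt (2 * ln (real (fst q)))"
    by (rule eventually_compose_filterlim[OF b_norm_le N])
  moreover have "\<forall>\<^sub>F q in F. b_norm (fst q) \<ge> 1"
    by (rule eventually_compose_filterlim[OF _ N]) (use b_norm_at_top in \<open>auto simp: filterlim_at_top\<close>)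
  moreover have "\<forall>\<^sub>F q in F. fst q \<ge> 1 \<and> snd q \<ge> 1"
    using N T by (auto simp: filterlim_at_top intro: eventually_conj)
  ultimately show ?thesis using NT
  proof eventually_elim
    case (elim q)
    obtain N T where q: "q = (N, T)" by (cases q)
    have "ln (real N) \<le> ln (real T powr \<gamma>)" using elim(3,4) by (subst ln_le_cancel_iff) (auto simp: q)
    then have "ln (real N) \<le> \<gamma> * ln (real T)" using elim(3) by (simp add: ln_powr q)
    then show ?case using elim(1,2) by (auto simp: q elim!: order.trans)
  qed
qed

text \<open>a_N is at least 1/(2 b_N), and b_N is at most of order sqrt(ln T) because N is bounded
  by a power of T. Hence a_N decays more slowly than any negative power of T.\<close>

lemma eventually_psi_negligible:
  fixes F :: "(nat \<times> nat) filter" and \<kappa> :: real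
  assumes N: "filterlim fst at_top F" and T: "filterlim snd at_top F"
    and NT: "\<forall>\<^sub>F (N, T) in F. real N \<le> real T powr \<gamma>" and \<kappa>: "\<kappa> > 0" and d: "d > 0" and \<gamma>: "\<gamma> > 0"
  shows "\<forall>\<^sub>F (N, T) in F. D * real T powr (- \<kappa>) \<le> a_norm N * d"
proof -
  have "(\<lambda>T::nat. D * real T powr (- \<kappa>) * (2 * sqrt (2 * (\<gamma> * ln (real T))))) \<longlonglongrightarrow> 0"
    using \<kappa> \<gamma> by real_asymp
  then have "\<forall>\<^sub>F T in sequentially. D * real T powr (- \<kappa>) * (2 * sqrt (2 * (\<gamma> * ln (real T)))) < d"
    by (rule order_tendstoD) (rule d)
  then have 1: "\<forall>\<^sub>F q in F. D * real (snd q) powr (- \<kappa>) * (2 * sqrt (2 * (\<gamma> * ln (real (snd q))))) < d"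
    by (rule eventually_compose_filterlim[OF _ T])
  show ?thesis using eventually_b_norm_bounds[OF N T NT] 1
  proof eventually_elim
    case (elim q)
    obtain N T where q: "q = (N, T)" by (cases q)
    have "b_norm N \<ge> 1" "b_norm N \<le> sqrt (2 * (\<gamma> * ln (real T)))" using elim(1) by (auto simp: q)
    then have s: "sqrt (2 * (\<gamma> * ln (real T))) > 0" "b_norm N \<le> sqrt (2 * (\<gamma> * ln (real T)))" by linarith+
    have "D * real T powr (- \<kappa>) \<le> d / (2 * sqrt (2 * (\<gamma> * ln (real T))))"
      using elim(2) s(1) by (subst pos_le_divide_eq) (auto simp: q)
    also have "\<dots> \<le> d / (2 * b_norm N)"
      using s \<open>b_norm N \<ge> 1\<close> d by (intro divide_left_mono) auto
    also have "\<dots> = 1 / (2 * b_norm N) * d" by simp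
    also have "\<dots> \<le> a_norm N * d"
      using a_norm_bounds(1)[OF \<open>b_norm N \<ge> 1\<close>] d by (intro mult_right_mono) auto
    finally show ?case by (simp add: q)
  qed
qed

text \<open>The threshold itself grows at most like sqrt(ln T), whereas the perturbation is at least
  of order sqrt(T).\<close>

lemma filterlim_threshold_at_bot:
  fixes F :: "(nat \<times> nat) filter" and \<psi> :: "nat \<Rightarrow> nat \<Rightarrow> real"
  assumes N: "filterlim fst at_top F" and T: "filterlim snd at_top F"
    and NT: "\<forall>\<^sub>F (N, T) in F. real N \<le> real T powr \<gamma>" and \<gamma>: "\<gamma> > 0"
    and D: "D > 0" and \<psi>: "\<forall>\<^sub>F (N, T) in F. D * real T powr (1 / 2) \<le> \<psi> N T"
  shows "filterlim (\<lambda>(N, T). a_norm N * x + b_norm N - \<psi> N T) at_bot F"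
proof (rule filterlim_at_bot_mono)
  have "filterlim (\<lambda>T::nat. \<bar>x\<bar> + sqrt (2 * (\<gamma> * ln (real T))) - D * real T powr (1 / 2)) at_bot sequentially"
    using D \<gamma> by real_asymp
  from filterlim_compose[OF this T]
  show "filterlim (\<lambda>q. \<bar>x\<bar> + sqrt (2 * (\<gamma> * ln (real (snd q)))) - D * real (snd q) powr (1 / 2)) at_bot F" .
  show "\<forall>\<^sub>F q in F. (case q of (N, T) \<Rightarrow> a_norm N * x + b_norm N - \<psi> N T)
      \<le> \<bar>x\<bar> + sqrt (2 * (\<gamma> * ln (real (snd q)))) - D * real (snd q) powr (1 / 2)"
    using eventually_b_norm_bounds[OF N T NT] \<psi>
  proof eventually_elim
    case (elim q)
    obtain N T where q: "q = (N, T)" by (cases q)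
    have b: "1 \<le> b_norm N" "b_norm N \<le> sqrt (2 * (\<gamma> * ln (real T)))" using elim(1) by (auto simp: q)
    have  "a_norm N * x \<le> \<bar>x\<bar>"
    proof -
      have "a_norm N * x \<le> a_norm N * \<bar>x\<bar>"
        using a_norm_bounds(2)[OF b(1)] by (intro mult_left_mono) auto
      also have "\<dots> \<le> 1 * \<bar>x\<bar>"
        using a_norm_bounds(3)[OF b(1)] by (intro mult_right_mono) auto
      finally show ?thesis by simp
    qed
    then show ?case using elim(2) b(2) by (simp add: q)
  qed
qed

text \<open>A distribution function is squeezed between its values at rationals on either side of x.
  This lets one null set, obtained from countably many rationals, serve all real x.\<close>

lemma tendsto_mono_of_rat:
  fixes m :: "'i \<Rightarrow> real \<Rightarrow> real" and L :: "real \<Rightarrow> real"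
  assumes mono: "\<forall>\<^sub>F i in F. mono (m i)" and lim: "\<And>q. ((\<lambda>i. m i (of_rat q)) \<longlongrightarrow> L (of_rat q)) F"
    and cont: "isCont L x"
  shows "((\<lambda>i. m i x) \<longlongrightarrow> L x) F"
proof (rule order_tendstoI)
  have Lx: "(L \<longlongrightarrow> L x) (nhds x)" using cont by (simp add: isCont_def tendsto_at_iff_tendsto_nhds)
  {
    fix c assume "c < L x"
    from order_tendstoD(1)[OF Lx this] obtain e where e: "e > 0" "\<And>y. dist y x < e \<Longrightarrow> c < L y"
      unfolding eventually_nhds_metric by blast
    obtain q where q: "x - e < of_rat q" "of_rat q < x" using of_rat_dense[of "x - e" x] e(1) by auto
    have "c < L (of_rat q)" using q by (intro e(2)) (simp add: dist_real_def)
    from order_tendstoD(1)[OF lim this] mono show "\<forall>\<^sub>F i in F. c < m i x"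
      by eventually_elim (use q in \<open>auto dest: monoD[of _ "of_rat q" x]\<close>)
  next
    fix c assume "L x < c"
    from order_tendstoD(2)[OF Lx this] obtain e where e: "e > 0" "\<And>y. dist y x < e \<Longrightarrow> L y < c"
      unfolding eventually_nhds_metric by blast
    obtain q where q: "x < of_rat q" "of_rat q < x + e" using of_rat_dense[of x "x + e"] e(1) by auto
    have "L (of_rat q) < c" using q by (intro e(2)) (simp add: dist_real_def)
    from order_tendstoD(2)[OF lim this] mono show "\<forall>\<^sub>F i in F. m i x < c"
      by eventually_elim (use q in \<open>auto dest: monoD[of _ x "of_rat q"]\<close>)
  }
qed

subsection \<open>The estimators along almost every path\<close>

lemma (in prob_space) bernoulli_shift_integral_eq:
  fixes \<phi> :: "'b::euclidean_space \<Rightarrow> real"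
  assumes sh: "decomposable_bernoulli_shift M S \<eta> \<nu> c a m" and \<phi> [measurable]: "\<phi> \<in> borel_measurable borel"
  shows "(\<integral>\<omega>. \<phi> (m t \<omega>) \<partial>M) = (\<integral>\<omega>. \<phi> (m t' \<omega>) \<partial>M)"
proof -
  note [measurable] = bernoulli_shift_distr_eq(1)[OF sh]
  have "(\<integral>\<omega>. \<phi> (m t \<omega>) \<partial>M) = (\<integral>x. \<phi> x \<partial>distr M borel (m t))" by (subst integral_distr) auto
  also have "\<dots> = (\<integral>x. \<phi> x \<partial>distr M borel (m t'))" by (simp only: bernoulli_shift_distr_eq(2)[OF sh, of t t'])
  also have "\<dots> = (\<integral>\<omega>. \<phi> (m t' \<omega>) \<partial>M)" by (subst integral_distr) auto
  finally show ?thesis .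
qed

lemma borel_measurable_vec_nth: "(\<lambda>v::real^'k. v $ k) \<in> borel_measurable borel"
  by (intro borel_measurable_continuous_onI continuous_intros)

lemma (in prob_space) covariance_matrix_eq:
  fixes X :: "'a \<Rightarrow> real^'k"
  assumes X: "\<And>j. integrable M (\<lambda>\<omega>. X \<omega> $ j)" and XX: "\<And>j k. integrable M (\<lambda>\<omega>. X \<omega> $ j * X \<omega> $ k)"
  shows "covariance_matrix M X = (\<chi> j k. (\<integral>\<omega>. X \<omega> $ j * X \<omega> $ k \<partial>M) - (\<integral>\<omega>. X \<omega> $ j \<partial>M) * (\<integral>\<omega>. X \<omega> $ k \<partial>M))"
proof -
  have "(\<integral>\<omega>. (X \<omega> $ j - a) * (X \<omega> $ k - b) \<partial>M)
      = (\<integral>\<omega>. X \<omega> $ j * X \<omega> $ k \<partial>M) - (\<integral>\<omega>. X \<omega> $ j \<partial>M) * b - (\<integral>\<omega>. X \<omega> $ k \<partial>M) * a + a * b" for j k a b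
  proof -
    have "(\<integral>\<omega>. (X \<omega> $ j - a) * (X \<omega> $ k - b) \<partial>M)
        = (\<integral>\<omega>. X \<omega> $ j * X \<omega> $ k - X \<omega> $ j * b - X \<omega> $ k * a + a * b \<partial>M)"
      by (intro Bochner_Integration.integral_cong) (auto simp: algebra_simps)
    then show ?thesis using X XX by (simp add: prob_space)
  qed
  then show ?thesis by (simp add: covariance_matrix_def vec_eq_iff mult.commute)
qed

text \<open>Reads the vector integral in (A3) coordinatewise. Expanding along the axes with
  integrable coordinates rules out the default value of the Bochner integral.\<close>

lemma (in prob_space) integral_scaleR_vec_nth:
  fixes X :: "'a \<Rightarrow> real^'k" and Y :: "'a \<Rightarrow> real"
  assumes "\<And>k. integrable M (\<lambda>\<omega>. Y \<omega> * X \<omega> $ k)"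
  shows "(\<integral>\<omega>. Y \<omega> *\<^sub>R X \<omega> \<partial>M) $ k = (\<integral>\<omega>. Y \<omega> * X \<omega> $ k \<partial>M)"
proof -
  have "(\<integral>\<omega>. Y \<omega> *\<^sub>R X \<omega> \<partial>M) = (\<integral>\<omega>. (\<Sum>j\<in>UNIV. (Y \<omega> * X \<omega> $ j) *\<^sub>R axis j 1) \<partial>M)"
    by (intro Bochner_Integration.integral_cong refl) (simp add: vec_eq_iff axis_def if_distrib cong: if_cong)
  also have "\<dots> = (\<Sum>j\<in>UNIV. (\<integral>\<omega>. Y \<omega> * X \<omega> $ j \<partial>M) *\<^sub>R axis j 1)"
    using assms by simp
  finally show ?thesis by (simp add: axis_def if_distrib cong: if_cong)
qed

lemma (in prob_space) AE_time_mean_centered: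
  fixes x :: "nat \<Rightarrow> int \<Rightarrow> 'a \<Rightarrow> real" and p \<gamma> \<rho> :: real
  assumes p: "p \<ge> 2" and \<gamma>: "\<gamma> \<ge> 0" "\<gamma> + p / 2 < p * (1 - \<rho>)" and ind: "indep_vars (\<lambda>_. S) \<eta> UNIV"
    and x: "\<And>i. i \<ge> 1 \<Longrightarrow> approximable M S \<eta> p c 1 (x i)"
    and \<mu>: "\<And>i t. i \<ge> 1 \<Longrightarrow> (\<integral>\<omega>. x i t \<omega> \<partial>M) = \<mu> i"
  shows "AE \<omega> in M. uniform_rate \<gamma> \<rho> (\<lambda>T i. time_mean T (\<lambda>t. x i t \<omega>) - \<mu> i)"
proof -
  have int: "integrable M (x i t)" if "i \<ge> 1" for i t
    using Lp_le_integral(1)[OF approximableD(1)[OF x[OF that]]] p by simp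
  have "AE \<omega> in M. uniform_rate \<gamma> \<rho> (\<lambda>T i. time_mean T (\<lambda>t. x i t \<omega> - \<mu> i))"
  proof (rule AE_time_mean_rate[OF p \<gamma> ind order.refl])
    fix i :: nat assume i: "i \<ge> 1"
    show "approximable M S \<eta> p (2 * c) 1 (\<lambda>t \<omega>. x i t \<omega> - \<mu> i)"
      using approximable_center[OF x[OF i]] p \<mu>[OF i] by simp
    show "(\<integral>\<omega>. x i t \<omega> - \<mu> i \<partial>M) = 0" for t
      using int[OF i] \<mu>[OF i] by (simp add: prob_space)
  qed
  then show ?thesis
  proof (rule AE_mp, intro AE_I2 impI)
    fix \<omega> assume "uniform_rate \<gamma> \<rho> (\<lambda>T i. time_mean T (\<lambda>t. x i t \<omega> - \<mu> i))"
    with eventually_ge_at_top[of 1]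
    show "uniform_rate \<gamma> \<rho> (\<lambda>T i. time_mean T (\<lambda>t. x i t \<omega>) - \<mu> i)"
      by eventually_elim (simp add: time_mean_diff time_mean_const)
  qed
qed

lemma (in prob_space) AE_ols_path:
  fixes \<eta> :: "int \<Rightarrow> 'a \<Rightarrow> 's" and y u :: "nat \<Rightarrow> int \<Rightarrow> 'a \<Rightarrow> real" and f :: "int \<Rightarrow> 'a \<Rightarrow> real^'k"
    and \<nu> \<gamma> \<rho> :: real
  assumes model: "\<And>i t \<omega>. i \<ge> 1 \<Longrightarrow> \<omega> \<in> space M \<Longrightarrow> y i t \<omega> = \<alpha> i + \<beta> i \<bullet> f t \<omega> + u i t \<omega>"
    and nu: "\<nu> \<ge> 4"
    and u_shift: "\<And>i. i \<ge> 1 \<Longrightarrow> decomposable_bernoulli_shift M S \<eta> \<nu> c\<^sub>u a\<^sub>u (u i)"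
    and u_rate: "a\<^sub>u \<ge> 1"
    and u_bdd: "bdd_above ((\<lambda>i. L_norm M \<nu> (u i 0)) ` {1..})"
    and u_mean: "\<And>i t. i \<ge> 1 \<Longrightarrow> (\<integral>\<omega>. u i t \<omega> \<partial>M) = 0"
    and u_var: "(INF i\<in>{1..}. \<integral>\<omega>. (u i 0 \<omega>)\<^sup>2 \<partial>M) > 0"
    and f_shift: "decomposable_bernoulli_shift M S \<eta> \<nu> c\<^sub>f a\<^sub>f f"
    and f_rate: "a\<^sub>f \<ge> 1"
    and f_cov: "positive_definite (covariance_matrix M (f 0))"
    and fu: "\<And>i t. i \<ge> 1 \<Longrightarrow> (\<integral>\<omega>. u i t \<omega> *\<^sub>R f t \<omega> \<partial>M) = 0"
    and \<gamma>: "\<gamma> \<ge> 0" "\<gamma> + \<nu> / 4 < \<nu> / 2 * (1 - \<rho>)" and \<rho>: "\<rho> > 0"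
  obtains s1 s2 where "s1 > 0" "s2 > 0" "AE \<omega> in M. \<exists>C>0. \<forall>\<^sub>F T in sequentially. ols_bounds T \<gamma> (\<lambda>i t. y i t \<omega>) (\<lambda>t. f t \<omega>) \<alpha> (C * real T powr (- \<rho>)) s1 s2"
proof -
  define p where "p = \<nu> / 2"
  have p: "p \<ge> 2" "2 * p = \<nu>" "p \<le> \<nu>" using nu by (auto simp: p_def)
  have \<gamma>p: "\<gamma> + p / 2 < p * (1 - \<rho>)" using \<gamma>(2) by (simp add: p_def)
  have ind: "indep_vars (\<lambda>_. S) \<eta> UNIV"
    using f_shift by (auto simp: decomposable_bernoulli_shift_def iid_family_def)
  obtain B where B: "\<And>i. i \<ge> 1 \<Longrightarrow> L_norm M \<nu> (u i 0) \<le> B"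
    using u_bdd by (auto simp: bdd_above_def)
  \<comment> \<open>One constant for all errors and all factor coordinates, so that any two of them
    can be multiplied.\<close>
  define c where "c = max (max c\<^sub>u (max B 1)) (max c\<^sub>f (max (L_norm M \<nu> (f 0)) 1))"
  have c: "c > 0" by (simp add: c_def less_max_iff_disj)
  have u: "approximable M S \<eta> \<nu> c 1 (u i)" if i: "i \<ge> 1" for i
  proof (rule approximable_mono)
    show "approximable M S \<eta> \<nu> (max c\<^sub>u (max B 1)) a\<^sub>u (u i)"
      using approximable_bernoulli_shift[OF u_shift[OF i], of "max B 1" "\<lambda>x. x"] B[OF i] nu
      by (auto simp: less_max_iff_disj le_max_iff_disj)
  qed (use u_rate nu in \<open>auto simp: c_def\<close>)
  have f: "approximable M S \<eta> \<nu> c 1 (\<lambda>t \<omega>. f t \<omega> $ k)" for k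
  proof (rule approximable_mono)
    show "approximable M S \<eta> \<nu> (max c\<^sub>f (max (L_norm M \<nu> (f 0)) 1)) a\<^sub>f (\<lambda>t \<omega>. f t \<omega> $ k)"
      using approximable_bernoulli_shift[OF f_shift, of "max (L_norm M \<nu> (f 0)) 1" "\<lambda>v. v $ k"] nu
      by (auto simp: less_max_iff_disj component_le_norm_cart borel_measurable_vec_nth)
  qed (use f_rate nu in \<open>auto simp: c_def\<close>)
  have mult: "approximable M S \<eta> p (3 * c * c) 1 (\<lambda>t \<omega>. x t \<omega> * z t \<omega>)"
    if "approximable M S \<eta> \<nu> c 1 x" "approximable M S \<eta> \<nu> c 1 z" for x z
    using that p by (intro approximable_mult) auto
  note low = approximable_lyapunov[OF _ _ p(3)]
  have intL: "integrable M (x t)" if "approximable M S \<eta> p d 1 x" for x t d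
    using Lp_le_integral(1)[OF approximableD(1)[OF that]] p by simp
  define \<sigma> where "\<sigma> = (\<lambda>i. \<integral>\<omega>. (u i 0 \<omega>)\<^sup>2 \<partial>M)"
  define m where "m = (\<lambda>k. \<integral>\<omega>. f 0 \<omega> $ k \<partial>M)"
  define R where "R = (\<lambda>j k. \<integral>\<omega>. f 0 \<omega> $ j * f 0 \<omega> $ k \<partial>M)"
  have E1: "AE \<omega> in M. uniform_rate \<gamma> \<rho> (\<lambda>T i. time_mean T (\<lambda>t. u i t \<omega>) - 0)"
    by (rule AE_time_mean_centered[OF p(1) \<gamma>(1) \<gamma>p ind low[OF u] u_mean]) (use p in auto)
  have E2: "AE \<omega> in M. \<forall>k. uniform_rate \<gamma> \<rho> (\<lambda>T i. time_mean T (\<lambda>t. u i t \<omega> * f t \<omega> $ k) - 0)"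
  proof -
    have "(\<integral>\<omega>. u i t \<omega> * f t \<omega> $ k \<partial>M) = 0" if i: "i \<ge> 1" for i t k
      using integral_scaleR_vec_nth[of "u i t" "f t" k] intL[OF mult[OF u[OF i] f]] fu[OF i, of t] by simp
    then have "AE \<omega> in M. uniform_rate \<gamma> \<rho> (\<lambda>T i. time_mean T (\<lambda>t. u i t \<omega> * f t \<omega> $ k) - 0)" for k
      by (intro AE_time_mean_centered[OF p(1) \<gamma>(1) \<gamma>p ind mult[OF u f]]) auto
    then show ?thesis by (rule eventually_all_finite)
  qed
  have E3: "AE \<omega> in M. uniform_rate \<gamma> \<rho> (\<lambda>T i. time_mean T (\<lambda>t. u i t \<omega> * u i t \<omega>) - \<sigma> i)"
  proof (rule AE_time_mean_centered[OF p(1) \<gamma>(1) \<gamma>p ind mult[OF u u]])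
    show "(\<integral>\<omega>. u i t \<omega> * u i t \<omega> \<partial>M) = \<sigma> i" if "i \<ge> 1" for i t
      using bernoulli_shift_integral_eq[OF u_shift[OF that], of "\<lambda>x. x * x" t 0]
      by (simp add: \<sigma>_def power2_eq_square)
  qed
  have E4: "AE \<omega> in M. \<forall>k. uniform_rate \<gamma> \<rho> (\<lambda>T i. time_mean T (\<lambda>t. f t \<omega> $ k) - m k)"
  proof -
    have "AE \<omega> in M. uniform_rate \<gamma> \<rho> (\<lambda>T i. time_mean T (\<lambda>t. f t \<omega> $ k) - m k)" for k
    proof (rule AE_time_mean_centered[OF p(1) \<gamma>(1) \<gamma>p ind low[OF f]])
      show "(\<integral>\<omega>. f t \<omega> $ k \<partial>M) = m k" for t
        unfolding m_def by (rule bernoulli_shift_integral_eq[OF f_shift borel_measurable_vec_nth])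
    qed (use p in auto)
    then show ?thesis by (rule eventually_all_finite)
  qed
  have E5: "AE \<omega> in M. \<forall>j k. uniform_rate \<gamma> \<rho> (\<lambda>T i. time_mean T (\<lambda>t. f t \<omega> $ j * f t \<omega> $ k) - R j k)"
  proof -
    have "AE \<omega> in M. uniform_rate \<gamma> \<rho> (\<lambda>T i. time_mean T (\<lambda>t. f t \<omega> $ j * f t \<omega> $ k) - R j k)" for j k
    proof (rule AE_time_mean_centered[OF p(1) \<gamma>(1) \<gamma>p ind mult[OF f f]])
      show "(\<integral>\<omega>. f t \<omega> $ j * f t \<omega> $ k \<partial>M) = R j k" for t
        unfolding R_def
        by (rule bernoulli_shift_integral_eq[OF f_shift, of "\<lambda>v. v $ j * v $ k"])
          (intro borel_measurable_times borel_measurable_vec_nth)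
    qed
    then have "AE \<omega> in M. \<forall>k. uniform_rate \<gamma> \<rho> (\<lambda>T i. time_mean T (\<lambda>t. f t \<omega> $ j * f t \<omega> $ k) - R j k)" for j
      by (rule eventually_all_finite)
    then show ?thesis by (rule eventually_all_finite)
  qed
  define s1 where "s1 = (INF i\<in>{1..}. \<sigma> i)"
  have s1: "s1 > 0" using u_var by (simp add: s1_def \<sigma>_def)
  have s1\<sigma>: "s1 \<le> \<sigma> i" if "i \<ge> 1" for i
    unfolding s1_def by (rule cINF_lower) (use that in \<open>auto intro!: bdd_belowI2[where m = 0] simp: \<sigma>_def\<close>)
  have \<sigma>s2: "\<sigma> i \<le> c\<^sup>2" if "i \<ge> 1" for i
    using Lp_leD(4)[OF Lp_le_lyapunov[OF approximableD(1)[OF u[OF that], of 0], of 2]] nu c by (simp add: \<sigma>_def)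
  obtain l where l: "l > 0" "\<And>v. l * (norm v)\<^sup>2 \<le> v \<bullet> ((\<chi> j k. R j k - m j * m k) *v v)"
  proof -
    have "covariance_matrix M (f 0) = (\<chi> j k. R j k - m j * m k)"
      unfolding R_def m_def
      by (rule covariance_matrix_eq) (use intL[OF low[OF f]] intL[OF mult[OF f f]] p in auto)
    then show thesis using positive_definite_coercive[OF f_cov] that by metis
  qed
  \<comment> \<open>Factor moments are treated as families constant in i; the instance i = 1,
    admissible from T = 1 on, recovers the plain statement.\<close>
  have ev1: "\<forall>\<^sub>F T in sequentially. P T" if "\<forall>\<^sub>F T in sequentially. \<forall>i\<ge>(1::nat). real i \<le> real T powr \<gamma> \<longrightarrow> P T" for P
    using that eventually_ge_at_top[of 1]
  proof eventually_elim
    case (elim T)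
    then have "real 1 \<le> real T powr \<gamma>" using \<gamma>(1) by (simp add: ge_one_powr_ge_zero)
    with elim(1) show ?case by blast
  qed
  have "AE \<omega> in M. \<exists>C>0. \<forall>\<^sub>F T in sequentially. ols_bounds T \<gamma> (\<lambda>i t. y i t \<omega>) (\<lambda>t. f t \<omega>) \<alpha> (C * real T powr (- \<rho>)) (s1 / 2) (c\<^sup>2 + 1)"
    using E1 E2 E3 E4 E5 AE_space
  proof eventually_elim
    case (elim \<omega>)
    show ?case
    proof (rule ols_path_bounds[of "\<lambda>i t. y i t \<omega>" \<alpha> \<beta> "\<lambda>t. f t \<omega>" "\<lambda>i t. u i t \<omega>" l R m \<rho> \<gamma> s1 \<sigma> "c\<^sup>2"])
      show "y i t \<omega> = \<alpha> i + \<beta> i \<bullet> f t \<omega> + u i t \<omega>" if "i \<ge> 1" for i t by (rule model[OF that elim(6)])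
      show "uniform_rate \<gamma> \<rho> (\<lambda>T i. time_mean T (\<lambda>t. u i t \<omega>))"
        using elim(1) by simp
      show "uniform_rate \<gamma> \<rho> (\<lambda>T i. time_mean T (\<lambda>t. u i t \<omega> * f t \<omega> $ k))" for k
        using elim(2) by simp
      show "uniform_rate \<gamma> \<rho> (\<lambda>T i. time_mean T (\<lambda>t. (u i t \<omega>)\<^sup>2) - \<sigma> i)"
        using elim(3) by (simp only: power2_eq_square)
      show "\<forall>\<^sub>F T in sequentially. \<bar>time_mean T (\<lambda>t. f t \<omega> $ k) - m k\<bar> \<le> real T powr (- \<rho>)" for k
        by (rule ev1) (use elim(4) in blast)
      show "\<forall>\<^sub>F T in sequentially. \<bar>time_mean T (\<lambda>t. f t \<omega> $ j * f t \<omega> $ k) - R j k\<bar> \<le> real T powr (- \<rho>)" for j k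
        by (rule ev1) (use elim(5) in blast)
    qed (use l \<rho> \<gamma> s1 s1\<sigma> \<sigma>s2 in blast)+
  qed
  then show thesis using s1 c by (intro that[of "s1 / 2" "c\<^sup>2 + 1"]) (auto simp: add_pos_pos)
qed

text \<open>As a_N > 0, the event for the normalised maximum says that every perturbed normal
  variable stays below the threshold a_N x + b_N.\<close>

lemma (in prob_space) AE_cond_distr_Z_stat:
  fixes y u :: "nat \<Rightarrow> int \<Rightarrow> 'a \<Rightarrow> real" and f :: "int \<Rightarrow> 'a \<Rightarrow> real^'k" and w :: "nat \<Rightarrow> 'a \<Rightarrow> real"
  assumes model: "\<And>i t \<omega>. i \<ge> 1 \<Longrightarrow> \<omega> \<in> space M \<Longrightarrow> y i t \<omega> = \<alpha> i + \<beta> i \<bullet> f t \<omega> + u i t \<omega>"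
    and um: "\<And>i t. i \<ge> 1 \<Longrightarrow> u i t \<in> borel_measurable M" and fm: "\<And>t. f t \<in> borel_measurable M"
    and w_indep: "indep_vars (\<lambda>_. borel) w {1..}"
    and w_normal: "\<And>i. i \<ge> 1 \<Longrightarrow> distributed M lborel (w i) (\<lambda>x. ennreal (std_normal_density x))"
    and w_sample: "indep_set (sets (generated_algebra M borel w {1..N})) (sets (sample_algebra M u f N T))"
    and \<kappa>: "regular_cond_distr M (sample_algebra M u f N T)
          (\<lambda>\<omega>. (Z_stat \<nu> N T (\<lambda>i t. y i t \<omega>) (\<lambda>t. f t \<omega>) (\<lambda>i. w i \<omega>) - b_norm N) / a_norm N) \<kappa>"
    and N: "N \<ge> 1" and a: "a_norm N > 0"
  shows "AE \<omega> in M. measure (\<kappa> \<omega>) {..x} =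
    (\<Prod>i = 1..N. Phi (a_norm N * x + b_norm N - psi \<nu> N T (\<lambda>i t. y i t \<omega>) (\<lambda>t. f t \<omega>) i))"
proof -
  let ?G = "sample_algebra M u f N T"
  let ?Z = "\<lambda>\<omega>. (Z_stat \<nu> N T (\<lambda>i t. y i t \<omega>) (\<lambda>t. f t \<omega>) (\<lambda>i. w i \<omega>) - b_norm N) / a_norm N"
  let ?\<psi> = "\<lambda>i \<omega>. psi \<nu> N T (\<lambda>i t. y i t \<omega>) (\<lambda>t. f t \<omega>) i"
  \<comment> \<open>The coefficients are constants, so y is a function of the sample; the model
    equation holds on \<open>space M\<close>, which is enough.\<close>
  have yG: "y i t \<in> borel_measurable ?G" if "i \<in> {1..N}" "t \<in> {1..int T}" for i t
  proof -
    have "(\<lambda>\<omega>. \<alpha> i + \<beta> i \<bullet> f t \<omega> + u i t \<omega>) \<in> borel_measurable ?G"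
      using measurable_sample_algebra(1)[OF that, of u M f] measurable_sample_algebra(2)[OF that(2), of f M u N]
      by measurable
    then show ?thesis by (rule measurable_cong[THEN iffD2, rotated]) (use that model in auto)
  qed
  have "AE \<omega> in M. real_cond_exp M ?G (indicator {\<omega> \<in> space M. \<forall>i\<in>{1..N}. ?\<psi> i \<omega> + w i \<omega> \<le> a_norm N * x + b_norm N}) \<omega>
      = (\<Prod>i = 1..N. Phi (a_norm N * x + b_norm N - ?\<psi> i \<omega>))"
  proof (rule cond_prob_all_le[OF _ _ w_indep w_normal w_sample N])
    show "subalgebra M ?G" by (rule subalgebra_sample_algebra) (use um fm in auto)
    show "?\<psi> i \<in> borel_measurable ?G" if "i \<in> {1..N}" for i
      by (rule psi_measurable[OF measurable_sample_algebra(2) yG that])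
  qed
  moreover have "?Z -` {..x} \<inter> space M = {\<omega> \<in> space M. \<forall>i\<in>{1..N}. ?\<psi> i \<omega> + w i \<omega> \<le> a_norm N * x + b_norm N}"
  proof -
    have "?Z \<omega> \<le> x \<longleftrightarrow> (\<forall>i\<in>{1..N}. ?\<psi> i \<omega> + w i \<omega> \<le> a_norm N * x + b_norm N)" for \<omega>
    proof -
      have "?Z \<omega> \<le> x \<longleftrightarrow> Z_stat \<nu> N T (\<lambda>i t. y i t \<omega>) (\<lambda>t. f t \<omega>) (\<lambda>i. w i \<omega>) \<le> a_norm N * x + b_norm N"
        using a by (simp add: pos_divide_le_eq algebra_simps)
      also have "\<dots> \<longleftrightarrow> (\<forall>i\<in>{1..N}. ?\<psi> i \<omega> + w i \<omega> \<le> a_norm N * x + b_norm N)"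
        unfolding Z_stat_def using N by (subst Max_le_iff) auto
      finally show ?thesis .
    qed
    then show ?thesis by auto
  qed
  moreover have "AE \<omega> in M. measure (\<kappa> \<omega>) {..x} = real_cond_exp M ?G (indicator (?Z -` {..x} \<inter> space M)) \<omega>"
    using \<kappa> by (simp add: regular_cond_distr_def)
  ultimately show ?thesis by (auto elim: AE_mp)
qed

theorem theorem3p1:
  fixes M :: "'a measure" and S :: "'s measure" and \<eta> :: "int \<Rightarrow> 'a \<Rightarrow> 's"
    and y u :: "nat \<Rightarrow> int \<Rightarrow> 'a \<Rightarrow> real" and f :: "int \<Rightarrow> 'a \<Rightarrow> real^'k"
    and \<alpha> :: "nat \<Rightarrow> real" and \<beta> :: "nat \<Rightarrow> real^'k"
    and w :: "nat \<Rightarrow> 'a \<Rightarrow> real"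
    and \<nu> c\<^sub>u a\<^sub>u c\<^sub>f a\<^sub>f \<epsilon> :: real
    and F :: "(nat \<times> nat) filter"
    and \<kappa> :: "nat \<Rightarrow> nat \<Rightarrow> 'a \<Rightarrow> real measure"
  assumes "prob_space M"
    and model: "\<And>i t \<omega>. i \<ge> 1 \<Longrightarrow> \<omega> \<in> space M \<Longrightarrow> y i t \<omega> = \<alpha> i + \<beta> i \<bullet> f t \<omega> + u i t \<omega>"
    and nu: "\<nu> \<ge> 4"
    \<comment> \<open>(A1)\<close>
    and u_shift: "\<And>i. i \<ge> 1 \<Longrightarrow> decomposable_bernoulli_shift M S \<eta> \<nu> c\<^sub>u a\<^sub>u (u i)"
    and u_rate: "a\<^sub>u > (\<nu> - 1) / (\<nu> - 2)"
    and u_bdd: "\<And>t. bdd_above ((\<lambda>i. L_norm M \<nu> (u i t)) ` {1..})"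
    and u_mean: "\<And>i t. i \<ge> 1 \<Longrightarrow> (\<integral>\<omega>. u i t \<omega> \<partial>M) = 0"
    and u_var: "\<And>t. (INF i\<in>{1..}. \<integral>\<omega>. (u i t \<omega>)\<^sup>2 \<partial>M) > 0"
    \<comment> \<open>(A2)\<close>
    and f_shift: "decomposable_bernoulli_shift M S \<eta> \<nu> c\<^sub>f a\<^sub>f f"
    and f_rate: "a\<^sub>f > (\<nu> - 1) / (\<nu> - 2)"
    and f_cov: "\<And>t. positive_definite (covariance_matrix M (f t))"
    \<comment> \<open>(A3)\<close>
    and fu: "\<And>i t. i \<ge> 1 \<Longrightarrow> (\<integral>\<omega>. u i t \<omega> *\<^sub>R f t \<omega> \<partial>M) = 0"
    \<comment> \<open>the joint limit: \<open>F\<close> is any filter on pairs \<open>(N, T)\<close> with \<open>min {N, T} \<rightarrow> \<infinity>\<close>, subject to (A4)\<close>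
    and joint_limit: "filterlim (\<lambda>(N, T). min N T) at_top F"
    and eps: "\<epsilon> > 0"
    and A4: "(\<lambda>(N, T). real N) \<in> O[F](\<lambda>(N, T). real T powr (1/2 * (\<nu>/2 - 1) - \<epsilon>))"
    \<comment> \<open>the randomisation: i.i.d. standard normal, independent of the sample\<close>
    and w_indep: "prob_space.indep_vars M (\<lambda>_. borel) w {1..}"
    and w_normal: "\<And>i. i \<ge> 1 \<Longrightarrow> distributed M lborel (w i) (\<lambda>x. ennreal (std_normal_density x))"
    and w_sample: "\<And>N T. prob_space.indep_set M
                     (sets (generated_algebra M borel w {1..N})) (sets (sample_algebra M u f N T))"
    \<comment> \<open>\<open>\<kappa> N T\<close> is the law under \<open>P\<^sup>*\<close> of the normalised statistic\<close>
    and P_star: "\<And>N T. N \<ge> 1 \<Longrightarrow> T \<ge> 1 \<Longrightarrow>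
        regular_cond_distr M (sample_algebra M u f N T)
          (\<lambda>\<omega>. (Z_stat \<nu> N T (\<lambda>i t. y i t \<omega>) (\<lambda>t. f t \<omega>) (\<lambda>i. w i \<omega>) - b_norm N) / a_norm N)
          (\<kappa> N T)"
  shows "((\<forall>i\<ge>1. \<alpha> i = 0) \<longrightarrow>
            (AE \<omega> in M. \<forall>x. ((\<lambda>(N, T). measure (\<kappa> N T \<omega>) {..x}) \<longlongrightarrow> exp (- exp (- x))) F)) \<and>
         ((\<exists>i\<ge>1. \<alpha> i \<noteq> 0) \<longrightarrow>
            (AE \<omega> in M. \<forall>x. ((\<lambda>(N, T). measure (\<kappa> N T \<omega>) {..x}) \<longlongrightarrow> 0) F))"
proof -
  interpret prob_space M by fact
  \<comment> \<open>Being strictly below \<epsilon>, it leaves a growing power of T to absorb the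
    constant in (A4); the cap at 1/4 keeps \<gamma> positive for every \<nu> \<ge> 4.\<close>
  define \<epsilon>' where "\<epsilon>' = min \<epsilon> (1 / 2) / 2"
  define \<gamma> where "\<gamma> = 1/2 * (\<nu>/2 - 1) - \<epsilon>'"
  \<comment> \<open>With this choice the condition of the union bound becomes \<epsilon>'/2 <
    \<epsilon>'.\<close>
  define \<delta> where "\<delta> = \<epsilon>' / \<nu>"
  have \<epsilon>': "0 < \<epsilon>'" "\<epsilon>' < \<epsilon>" "\<epsilon>' \<le> 1 / 4" using eps by (auto simp: \<epsilon>'_def min_def)
  have \<gamma>: "\<gamma> > 0" using nu \<epsilon>' by (simp add: \<gamma>_def)
  have \<delta>: "\<delta> > 0" using nu \<epsilon>' by (simp add: \<delta>_def)
  have \<rho>: "1 / \<nu> + \<delta> > 0" "\<gamma> + \<nu> / 4 < \<nu> / 2 * (1 - (1 / \<nu> + \<delta>))"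
    using nu \<epsilon>' \<delta> by (auto simp: \<gamma>_def \<delta>_def add_pos_pos field_simps)
  have rate1: "(\<nu> - 1) / (\<nu> - 2) \<ge> 1" using nu by simp
  have um: "u i t \<in> borel_measurable M" if "i \<ge> 1" for i t
    by (rule bernoulli_shift_distr_eq(1)[OF u_shift[OF that]])
  have fm: "f t \<in> borel_measurable M" for t by (rule bernoulli_shift_distr_eq(1)[OF f_shift])
  have \<kappa>m: "\<kappa> N T \<in> sample_algebra M u f N T \<rightarrow>\<^sub>M prob_algebra borel" if "N \<ge> 1" "T \<ge> 1" for N T
    using P_star[OF that] by (simp add: regular_cond_distr_def)

  have "filterlim (\<lambda>q. min (fst q) (snd q)) at_top F" using joint_limit by (simp add: case_prod_beta')
  then have N_lim: "filterlim fst at_top F" and T_lim: "filterlim snd at_top F"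
    by (rule filterlim_at_top_mono; simp)+
  have NT: "\<forall>\<^sub>F (N, T) in F. real N \<le> real T powr \<gamma>"
  proof -
    obtain c where c: "c > 0" "\<forall>\<^sub>F q in F. norm (case q of (N, T) \<Rightarrow> real N)
        \<le> c * norm (case q of (N, T) \<Rightarrow> real T powr (1/2 * (\<nu>/2 - 1) - \<epsilon>))"
      using A4 by (elim landau_o.bigE)
    have "filterlim (\<lambda>T::nat. real T powr (\<epsilon> - \<epsilon>')) at_top sequentially" using \<epsilon>' by real_asymp
    then have "\<forall>\<^sub>F T in sequentially. c \<le> real T powr (\<epsilon> - \<epsilon>')" by (simp add: filterlim_at_top)
    then have "\<forall>\<^sub>F q in F. c \<le> real (snd q) powr (\<epsilon> - \<epsilon>')" by (rule eventually_compose_filterlim[OF _ T_lim])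
    with c(2) show ?thesis
    proof eventually_elim
      case (elim q)
      obtain N T where q: "q = (N, T)" by (cases q)
      have "real N \<le> c * real T powr (1/2 * (\<nu>/2 - 1) - \<epsilon>)" using elim(1) by (simp add: q)
      also have "\<dots> \<le> real T powr (\<epsilon> - \<epsilon>') * real T powr (1/2 * (\<nu>/2 - 1) - \<epsilon>)"
        using elim(2) by (intro mult_right_mono) (auto simp: q)
      also have "\<dots> = real T powr \<gamma>" by (simp add: powr_add[symmetric] \<gamma>_def)
      finally show ?case by (simp add: q)
    qed
  qed
  have N1T1: "\<forall>\<^sub>F q in F. fst q \<ge> 1 \<and> snd q \<ge> 1"
    using N_lim T_lim by (auto simp: filterlim_at_top intro: eventually_conj)
  \<comment> \<open>Only an eventual statement: division by 0 makes
    \<open>a_norm 1 = 0\<close>.\<close>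
  have aN: "\<forall>\<^sub>F q in F. a_norm (fst q) > 0"
  proof -
    have "\<forall>\<^sub>F N in sequentially. b_norm N \<ge> 1" using b_norm_at_top by (simp add: filterlim_at_top)
    then have "\<forall>\<^sub>F q in F. b_norm (fst q) \<ge> 1" by (rule eventually_compose_filterlim[OF _ N_lim])
    then show ?thesis by eventually_elim (rule a_norm_bounds)
  qed

  obtain s1 s2 where s: "s1 > 0" "s2 > 0" and path: "AE \<omega> in M. \<exists>C>0. \<forall>\<^sub>F T in sequentially. ols_bounds T \<gamma> (\<lambda>i t. y i t \<omega>) (\<lambda>t. f t \<omega>) \<alpha> (C * real T powr (- (1 / \<nu> + \<delta>))) s1 s2"
    by (rule AE_ols_path[OF model nu u_shift _ u_bdd u_mean u_var f_shift _ f_cov fu less_imp_le[OF \<gamma>] \<rho>(2) \<rho>(1)])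
      (use rate1 u_rate f_rate in auto)
  let ?\<psi> = "\<lambda>\<omega> N T i. psi \<nu> N T (\<lambda>i t. y i t \<omega>) (\<lambda>t. f t \<omega>) i"
  \<comment> \<open>Countably many triples (N, T, q), hence a single exceptional null set.\<close>
  have law: "AE \<omega> in M. \<forall>N T. \<forall>q::rat. N \<ge> 1 \<and> T \<ge> 1 \<and> a_norm N > 0 \<longrightarrow>
      measure (\<kappa> N T \<omega>) {..of_rat q} = (\<Prod>i = 1..N. Phi (a_norm N * of_rat q + b_norm N - ?\<psi> \<omega> N T i))"
  proof -
    have "AE \<omega> in M. N \<ge> 1 \<and> T \<ge> 1 \<and> a_norm N > 0 \<longrightarrow>
      measure (\<kappa> N T \<omega>) {..of_rat q} = (\<Prod>i = 1..N. Phi (a_norm N * of_rat q + b_norm N - ?\<psi> \<omega> N T i))"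
      for N T and q :: rat
    proof (cases "N \<ge> 1 \<and> T \<ge> 1 \<and> a_norm N > 0")
      case True
      then have "AE \<omega> in M. measure (\<kappa> N T \<omega>) {..of_rat q}
          = (\<Prod>i = 1..N. Phi (a_norm N * of_rat q + b_norm N - ?\<psi> \<omega> N T i))"
        by (intro AE_cond_distr_Z_stat[OF model um fm w_indep w_normal w_sample P_star]) auto
      then show ?thesis by eventually_elim simp
    qed auto
    then show ?thesis by (simp only: AE_all_countable) blast
  qed

  have main: "AE \<omega> in M.
      ((\<forall>i\<ge>1. \<alpha> i = 0) \<longrightarrow> (\<forall>x. ((\<lambda>(N, T). measure (\<kappa> N T \<omega>) {..x}) \<longlongrightarrow> exp (- exp (- x))) F)) \<and>
      ((\<exists>i\<ge>1. \<alpha> i \<noteq> 0) \<longrightarrow> (\<forall>x. ((\<lambda>(N, T). measure (\<kappa> N T \<omega>) {..x}) \<longlongrightarrow> 0) F))"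
    using path law AE_space
  proof eventually_elim
    case (elim \<omega>)
    let ?\<alpha> = "\<lambda>T i. ols_alpha T (\<lambda>t. y i t \<omega>) (\<lambda>t. f t \<omega>)"
    obtain C where C: "C > 0" and ev: "\<forall>\<^sub>F T in sequentially. \<forall>i\<ge>1. real i \<le> real T powr \<gamma> \<longrightarrow>
      \<bar>?\<alpha> T i - \<alpha> i\<bar> \<le> C * real T powr (- (1 / \<nu> + \<delta>)) \<and>
      s1 \<le> time_mean T (\<lambda>t. (ols_resid T (\<lambda>t. y i t \<omega>) (\<lambda>t. f t \<omega>) t)\<^sup>2) \<and>
      time_mean T (\<lambda>t. (ols_resid T (\<lambda>t. y i t \<omega>) (\<lambda>t. f t \<omega>) t)\<^sup>2) \<le> s2"
      using elim(1) by blast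
    \<comment> \<open>N \<le> T^\<gamma> brings all i up to N into the range of the uniform path
      bounds.\<close>
    have bounds: "\<forall>\<^sub>F (N, T) in F. N \<ge> 1 \<and> T \<ge> 1 \<and>
        (\<forall>i\<in>{1..N}. \<bar>?\<alpha> T i - \<alpha> i\<bar> \<le> C * real T powr (- (1 / \<nu> + \<delta>))) \<and>
        sqrt s1 \<le> s_hat N T (\<lambda>i t. y i t \<omega>) (\<lambda>t. f t \<omega>) \<and> s_hat N T (\<lambda>i t. y i t \<omega>) (\<lambda>t. f t \<omega>) \<le> sqrt s2"
      using eventually_compose_filterlim[OF ev T_lim] NT N1T1
    proof eventually_elim
      case (elim q)
      obtain N T where q: "q = (N, T)" by (cases q)
      have i: "i \<ge> 1 \<and> real i \<le> real T powr \<gamma>" if "i \<in> {1..N}" for i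
        using elim(2) that by (auto simp: q elim: order.trans[rotated])
      have "sqrt s1 \<le> s_hat N T (\<lambda>i t. y i t \<omega>) (\<lambda>t. f t \<omega>)" "s_hat N T (\<lambda>i t. y i t \<omega>) (\<lambda>t. f t \<omega>) \<le> sqrt s2"
        by (rule s_hat_bounds; use elim(1,3) i q in force)+
      then show ?case using elim(1,3) i by (simp add: q)
    qed
    \<comment> \<open>On this path the product formula for the conditional law is available at
      rational arguments only; monotonicity of each law and continuity of the limit fill in the
      others.\<close>
    have lift: "((\<lambda>(N, T). measure (\<kappa> N T \<omega>) {..x}) \<longlongrightarrow> L x) F"
      if lim: "\<And>x. ((\<lambda>(N, T). \<Prod>i = 1..N. Phi (a_norm N * x + b_norm N - ?\<psi> \<omega> N T i)) \<longlongrightarrow> L x) F"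
        and cont: "isCont L x" for L x
    proof -
      have "((\<lambda>q. (\<lambda>x. measure (\<kappa> (fst q) (snd q) \<omega>) {..x}) x) \<longlongrightarrow> L x) F"
      proof (rule tendsto_mono_of_rat[OF _ _ cont])
        show "\<forall>\<^sub>F q in F. mono (\<lambda>x. measure (\<kappa> (fst q) (snd q) \<omega>) {..x})"
          using N1T1
        proof eventually_elim
          case (elim q)
          have "\<kappa> (fst q) (snd q) \<omega> \<in> space (prob_algebra borel)"
            using measurable_space[OF \<kappa>m] elim \<open>\<omega> \<in> space M\<close> by simp
          then have "prob_space (\<kappa> (fst q) (snd q) \<omega>)" and sets: "sets (\<kappa> (fst q) (snd q) \<omega>) = sets borel"
            by (auto simp: space_prob_algebra)
          interpret K: prob_space "\<kappa> (fst q) (snd q) \<omega>" by fact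
          show ?case by (intro monoI K.finite_measure_mono) (auto simp: sets)
        qed
        fix q :: rat
        have "\<forall>\<^sub>F n in F. (case n of (N, T) \<Rightarrow> \<Prod>i = 1..N. Phi (a_norm N * of_rat q + b_norm N - ?\<psi> \<omega> N T i))
            = measure (\<kappa> (fst n) (snd n) \<omega>) {..of_rat q}"
          using N1T1 aN by eventually_elim (use elim(2) in \<open>simp add: case_prod_beta\<close>)
        with lim[of "of_rat q"] show "((\<lambda>n. measure (\<kappa> (fst n) (snd n) \<omega>) {..of_rat q}) \<longlongrightarrow> L (of_rat q)) F"
          by (rule Lim_transform_eventually)
      qed
      then show ?thesis by (simp add: case_prod_beta')
    qed
    show ?case
    proof (intro conjI impI allI)
      fix x assume H0: "\<forall>i\<ge>1. \<alpha> i = 0"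
      let ?D = "(C / sqrt s1) powr (\<nu> / 2)"
      have "\<forall>\<^sub>F (N, T) in F. \<forall>i\<in>{1..N}. 0 \<le> ?\<psi> \<omega> N T i \<and> ?\<psi> \<omega> N T i \<le> a_norm N * d" if d: "d > 0" for d
      proof -
        have "\<forall>\<^sub>F (N, T) in F. ?D * real T powr (- (\<delta> * \<nu> / 2)) \<le> a_norm N * d"
          using \<delta> nu by (intro eventually_psi_negligible[OF N_lim T_lim NT _ d \<gamma>]) auto
        with bounds show ?thesis
        proof eventually_elim
          case (elim q)
          obtain N T where q: "q = (N, T)" by (cases q)
          have "?\<psi> \<omega> N T i \<le> ?D * real T powr (- (\<delta> * \<nu> / 2))" if "i \<in> {1..N}" for i
          proof (rule psi_upper)
            show "\<bar>?\<alpha> T i\<bar> \<le> C * real T powr (- (1 / \<nu> + \<delta>))"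
              using elim(1) that H0 by (auto simp: q)
          qed (use elim(1) nu C s in \<open>auto simp: q\<close>)
          then show ?case using elim(2) by (fastforce simp: q psi_def)
        qed
      qed
      then have "((\<lambda>(N, T). \<Prod>i = 1..N. Phi (a_norm N * x + b_norm N - ?\<psi> \<omega> N T i)) \<longlongrightarrow> exp (- exp (- x))) F" for x
        by (rule tendsto_prod_Phi_null[OF N_lim])
      then show "((\<lambda>(N, T). measure (\<kappa> N T \<omega>) {..x}) \<longlongrightarrow> exp (- exp (- x))) F"
        by (rule lift[of "\<lambda>x. exp (- exp (- x))" x]) (intro continuous_intros)
    next
      fix x assume "\<exists>i\<ge>1. \<alpha> i \<noteq> 0"
      then obtain j where j: "j \<ge> 1" "\<alpha> j \<noteq> 0" by blast
      \<comment> \<open>The estimate eventually keeps half of the true intercept, and the scale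
        estimate stays below \<open>sqrt s2\<close>.\<close>
      let ?D = "(\<bar>\<alpha> j\<bar> / 2 / sqrt s2) powr (\<nu> / 2)"
      have "(\<lambda>T::nat. C * real T powr (- (1 / \<nu> + \<delta>))) \<longlonglongrightarrow> 0" using \<rho>(1) by real_asymp
      then have "\<forall>\<^sub>F T in sequentially. C * real T powr (- (1 / \<nu> + \<delta>)) < \<bar>\<alpha> j\<bar> / 2"
        using j by (intro order_tendstoD) auto
      from bounds eventually_compose_filterlim[OF this T_lim]
        eventually_compose_filterlim[OF eventually_ge_at_top[of j] N_lim]
      have "\<forall>\<^sub>F (N, T) in F. ?D * real T powr (1 / 2) \<le> ?\<psi> \<omega> N T j"
      proof eventually_elim
        case (elim q)
        obtain N T where q: "q = (N, T)" by (cases q)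
        have "?D * real T powr (1 / 2) \<le> ?\<psi> \<omega> N T j"
        proof (rule psi_lower)
          have "\<bar>?\<alpha> T j - \<alpha> j\<bar> \<le> \<bar>\<alpha> j\<bar> / 2" using elim j by (force simp: q)
          then show "\<bar>\<alpha> j\<bar> / 2 \<le> \<bar>?\<alpha> T j\<bar>" by linarith
          have "sqrt s1 > 0" using s by simp
          moreover have "sqrt s1 \<le> s_hat N T (\<lambda>i t. y i t \<omega>) (\<lambda>t. f t \<omega>)" using elim(1) by (simp add: q)
          ultimately show "0 < s_hat N T (\<lambda>i t. y i t \<omega>) (\<lambda>t. f t \<omega>)" by linarith
        qed (use elim(1) nu j in \<open>auto simp: q\<close>)
        then show ?case by (simp add: q)
      qed
      then have "filterlim (\<lambda>(N, T). a_norm N * x + b_norm N - ?\<psi> \<omega> N T j) at_bot F" for x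
        using j s by (intro filterlim_threshold_at_bot[OF N_lim T_lim NT \<gamma>]) auto
      then have "((\<lambda>(N, T). \<Prod>i = 1..N. Phi (a_norm N * x + b_norm N - ?\<psi> \<omega> N T i)) \<longlongrightarrow> 0) F" for x
        by (rule tendsto_prod_Phi_alt[OF N_lim j(1)])
      then show "((\<lambda>(N, T). measure (\<kappa> N T \<omega>) {..x}) \<longlongrightarrow> 0) F"
        by (rule lift[of "\<lambda>_. 0" x]) simp
    qed
  qed
  show ?thesis
  proof (intro conjI impI)
    assume "\<forall>i\<ge>1. \<alpha> i = 0"
    with main show "AE \<omega> in M. \<forall>x. ((\<lambda>(N, T). measure (\<kappa> N T \<omega>) {..x}) \<longlongrightarrow> exp (- exp (- x))) F"
      by (auto elim: AE_mp)
  next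
    assume "\<exists>i\<ge>1. \<alpha> i \<noteq> 0"
    with main show "AE \<omega> in M. \<forall>x. ((\<lambda>(N, T). measure (\<kappa> N T \<omega>) {..x}) \<longlongrightarrow> 0) F"
      by (auto elim: AE_mp)
  qed
qed

end
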